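(* Let $M$ be a sphere with a Euclidean polyhedral metric with singular set $\Sigma$, and let $V=\Sigma$. Then weighted Delaunay tesselations of $(M,V)$ with positive associated functions $\widetilde{q_T}$ are in one-to-one correspondence with generalized convex polytopes with boundary $M$. (The correspondence assigns to the generalized convex polytope represented by a couple $(T,r)$ the weighted Delaunay tesselation $(\overline T,q)$ obtained from $(T,q)$ with $q_i=r_i^2$, $i\in\Sigma$.)
   Context: A Euclidean polyhedral metric on a closed surface $M$ is a metric such that every point has an open neighborhood isometric either to an open subset of $\mathbb{R}^2$ (regular point) or to an open subset of a Euclidean cone of angle $\alpha\neq 2\pi$ with the point mapped to the apex (singular point). $\Sigma$ is the finite set of singular points. A geodesic triangulation $T$ of $M$ is a decomposition of $M$ into Euclidean triangles by geodesics with endpoints in $\Sigma$, with vertex set $\mathcal V(T)=\Sigma$; $\mathcal E(T)$ and $\mathcal F(T)$ are the sets of edges and faces. Loops, multiple edges and triangles with self-identifications on the boundary are allowed. Generalized convex polytopes: let $r=(r_i)_{i\in\Sigma}$ be positive numbers such that for every $ijk\in\mathcal F(T)$ there is a (non-degenerate) pyramid with base $ijk$ and side edges of lengths $r_i,r_j,r_k$. The generalized polytope given by $(T,r)$ is the complex glued from these pyramids following the gluing rules of $T$; all apices are glued to one point, the apex. Two couples are equivalent (represent the same generalized polytope with boundary $M$) if there is an isometry between the resulting polyhedra which is the identity on the boundary and maps apex to apex. It is convex if for every edge $ij\in\mathcal E(T)$ the sum $\theta_{ij}$ of the dihedral angles of the pyramids at $ij$ is at most $\pi$. Weighted Delaunay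 tesselations: a $Q$-function is a function of the form $x\mapsto\|x-p\|^2+b$ on a subset of a Euclidean space. A $PQ$-function on $M$ is a continuous function that is a $Q$-function on each triangle (developed to the plane) of some geodesic triangulation. It is $Q$-concave if on each geodesic arc (locally straight, with no singular point in its interior) it becomes concave after subtracting the squared arc length. For $q:V\to\mathbb{R}$ and a geodesic triangulation $T$ with $\mathcal V(T)=V$, $\widetilde{q_T}:M\to\mathbb{R}$ denotes the $PQ$-extension of $q$ with respect to $T$, i.e. the continuous extension that is a $Q$-function on each triangle of $T$. A couple $(T,q)$ is a weighted Delaunay triangulation of $(M,V)$ with weights $q$ if $\widetilde{q_T}$ is $Q$-concave. An edge of $T$ is inessential if $\widetilde{q_T}$ is a $Q$-function in a neighborhood of any interior point of the edge. The weighted Delaunay tesselation $(\overline T,q)$ is obtained from the weighted Delaunay triangulation $(T,q)$ by removing from $T$ all inessential edges. Its associated function is $\widetilde{q_T}$. *)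

theory Defs
  imports "HOL-Analysis.Analysis"
begin

section \<open>Euclidean polyhedral metrics\<close>

text \<open>
  The Euclidean cone of angle \<open>\<alpha>\<close>, in polar coordinates \<open>(\<rho>, \<theta>)\<close> with the angle taken in
  \<open>[0, \<alpha>)\<close>; the apex is \<open>(0, 0)\<close>.  The distance is given by the law of cosines applied to
  the angle between the two rays, capped at \<open>pi\<close> (beyond which shortest paths run through
  the apex).
\<close>

definition cone :: "real \<Rightarrow> (real \<times> real) set" where
  "cone \<alpha> = insert (0, 0) {(\<rho>, \<theta>). 0 < \<rho> \<and> 0 \<le> \<theta> \<and> \<theta> < \<alpha>}"

definition cone_dist :: "real \<Rightarrow> real \<times> real \<Rightarrow> real \<times> real \<Rightarrow> real" where
  "cone_dist \<alpha> = (\<lambda>(\<rho>1, \<theta>1) (\<rho>2, \<theta>2).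
     sqrt (\<rho>1\<^sup>2 + \<rho>2\<^sup>2
       - 2 * \<rho>1 * \<rho>2 * cos (min pi (min \<bar>\<theta>1 - \<theta>2\<bar> (\<alpha> - \<bar>\<theta>1 - \<theta>2\<bar>)))))"

definition open_in_cone :: "real \<Rightarrow> (real \<times> real) set \<Rightarrow> bool" where
  "open_in_cone \<alpha> W \<longleftrightarrow> W \<subseteq> cone \<alpha> \<and>
     (\<forall>p\<in>W. \<exists>\<epsilon>>0. \<forall>q\<in>cone \<alpha>. cone_dist \<alpha> p q < \<epsilon> \<longrightarrow> q \<in> W)"

definition planar_chart :: "'a::metric_space set \<Rightarrow> 'a set \<Rightarrow> ('a \<Rightarrow> real^2) \<Rightarrow> bool" where
  "planar_chart M U h \<longleftrightarrow> openin (top_of_set M) U \<and> open (h ` U) \<and>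
     (\<forall>y\<in>U. \<forall>z\<in>U. dist (h y) (h z) = dist y z)"

definition conical_chart ::
    "'a::metric_space set \<Rightarrow> real \<Rightarrow> 'a set \<Rightarrow> ('a \<Rightarrow> real \<times> real) \<Rightarrow> bool" where
  "conical_chart M \<alpha> U h \<longleftrightarrow> openin (top_of_set M) U \<and> open_in_cone \<alpha> (h ` U) \<and>
     (\<forall>y\<in>U. \<forall>z\<in>U. cone_dist \<alpha> (h y) (h z) = dist y z)"

definition regular_point :: "'a::metric_space set \<Rightarrow> 'a \<Rightarrow> bool" where
  "regular_point M x \<longleftrightarrow> (\<exists>U h. planar_chart M U h \<and> x \<in> U)"

definition singular_point :: "'a::metric_space set \<Rightarrow> 'a \<Rightarrow> bool" where
  "singular_point M x \<longleftrightarrow>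
     (\<exists>\<alpha> U h. 0 < \<alpha> \<and> \<alpha> \<noteq> 2 * pi \<and> conical_chart M \<alpha> U h \<and> x \<in> U \<and> h x = (0, 0))"

text \<open>
  Only the metric near each point matters: no notion below uses distances in \<open>M\<close> between
  points that are far apart, so \<open>dist\<close> is not required to be a length metric.
\<close>

definition polyhedral_metric :: "'a::metric_space set \<Rightarrow> bool" where
  "polyhedral_metric M \<longleftrightarrow> (\<forall>x\<in>M. regular_point M x \<or> singular_point M x)"

definition Sing :: "'a::metric_space set \<Rightarrow> 'a set" where
  "Sing M = {x\<in>M. singular_point M x}"


section \<open>Geodesic triangulations\<close>

text \<open>Geodesic arcs are parametrized by arc length; the end points may be singular.\<close>

definition geodesic_arc :: "'a::metric_space set \<Rightarrow> real \<Rightarrow> (real \<Rightarrow> 'a) \<Rightarrow> bool" where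
  "geodesic_arc M L \<gamma> \<longleftrightarrow> 0 < L \<and> \<gamma> ` {0..L} \<subseteq> M \<and>
     (\<forall>t\<in>{0<..<L}. \<gamma> t \<notin> Sing M) \<and>
     (\<forall>t\<in>{0..L}. \<exists>\<epsilon>>0. \<forall>s\<in>{0..L} \<inter> ball t \<epsilon>. \<forall>s'\<in>{0..L} \<inter> ball t \<epsilon>.
        dist (\<gamma> s) (\<gamma> s') = \<bar>s - s'\<bar>)"

text \<open>
  A decomposition of \<open>M\<close> is given by its open edges (without end points) and its open faces,
  as subsets of \<open>M\<close>.  The vertex set is always \<open>Sing M\<close>.
\<close>

record 'a decomposition =
  edges :: "'a set set"
  faces :: "'a set set"

text \<open>The vertices of a Euclidean triangle are \<open>v 0\<close>, \<open>v 1\<close>, \<open>v 2\<close>.\<close>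

definition triangle :: "(nat \<Rightarrow> real^2) \<Rightarrow> (real^2) set" where
  "triangle v = convex hull {v 0, v 1, v 2}"

definition side :: "(nat \<Rightarrow> real^2) \<Rightarrow> nat \<Rightarrow> (real^2) set" where
  "side v k = open_segment (v k) (v ((k + 1) mod 3))"

text \<open>
  \<open>F\<close> is the image of the interior of a Euclidean triangle.  At the vertices \<open>\<phi>\<close> is only
  required to be continuous, and \<open>\<phi>\<close> may identify vertices and sides of the triangle.
\<close>

definition face_chart ::
    "'a::metric_space set \<Rightarrow> 'a set \<Rightarrow> (nat \<Rightarrow> real^2) \<Rightarrow> (real^2 \<Rightarrow> 'a) \<Rightarrow> bool" where
  "face_chart M F v \<phi> \<longleftrightarrow>
     \<not> collinear {v 0, v 1, v 2} \<and>
     continuous_on (triangle v) \<phi> \<and>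
     bij_betw \<phi> (interior (triangle v)) F \<and>
     (\<forall>x\<in>triangle v - {v 0, v 1, v 2}. \<exists>\<epsilon>>0. \<forall>y\<in>triangle v \<inter> ball x \<epsilon>. \<forall>z\<in>triangle v \<inter> ball x \<epsilon>.
        dist (\<phi> y) (\<phi> z) = dist y z) \<and>
     (\<forall>k<3. \<phi> (v k) \<in> Sing M \<and> inj_on \<phi> (side v k))"

definition geodesic_triangulation :: "'a::metric_space set \<Rightarrow> 'a decomposition \<Rightarrow> bool" where
  "geodesic_triangulation M T \<longleftrightarrow>
     finite (edges T) \<and> finite (faces T) \<and>
     partition_on M ((\<lambda>i. {i}) ` Sing M \<union> edges T \<union> faces T) \<and>
     (\<lambda>i. {i}) ` Sing M \<inter> edges T = {} \<and> edges T \<inter> faces T = {} \<and>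
     (\<forall>e\<in>edges T. \<exists>L \<gamma>. geodesic_arc M L \<gamma> \<and> bij_betw \<gamma> {0<..<L} e \<and>
        \<gamma> 0 \<in> Sing M \<and> \<gamma> L \<in> Sing M) \<and>
     (\<forall>F\<in>faces T. \<exists>v \<phi>. face_chart M F v \<phi> \<and> (\<forall>k<3. \<phi> ` side v k \<in> edges T))"

text \<open>
  A chart of a face is unique up to a Euclidean motion and a renumbering of the vertices.
  Everything defined from the chosen charts below is invariant under these changes.
\<close>

definition chart_of :: "'a::metric_space set \<Rightarrow> 'a set \<Rightarrow> (nat \<Rightarrow> real^2) \<times> (real^2 \<Rightarrow> 'a)" where
  "chart_of M F = (SOME (v, \<phi>). face_chart M F v \<phi>)"


section \<open>Generalized convex polytopes\<close>

text \<open>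
  The plane of the base is \<open>real^2\<close>, embedded in the 3-space \<open>real^2 \<times> real\<close> as the plane of
  height \<open>0\<close>.  The pyramid is non-degenerate iff its apex is off this plane; the apex is taken
  in the upper half-space.
\<close>

definition pyramid_apex ::
    "(nat \<Rightarrow> real^2) \<Rightarrow> (nat \<Rightarrow> real) \<Rightarrow> (real^2) \<times> real \<Rightarrow> bool" where
  "pyramid_apex v \<rho> A \<longleftrightarrow> 0 < snd A \<and> (\<forall>k<3. dist A (v k, 0) = \<rho> k)"

definition face_apex ::
    "'a::metric_space set \<Rightarrow> ('a \<Rightarrow> real) \<Rightarrow> 'a set \<Rightarrow> (real^2) \<times> real \<Rightarrow> bool" where
  "face_apex M r F A = (case chart_of M F of (v, \<phi>) \<Rightarrow> pyramid_apex v (\<lambda>k. r (\<phi> (v k))) A)"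

definition apex_of ::
    "'a::metric_space set \<Rightarrow> ('a \<Rightarrow> real) \<Rightarrow> 'a set \<Rightarrow> (real^2) \<times> real" where
  "apex_of M r F = (THE A. face_apex M r F A)"

text \<open>
  Couples \<open>(T, r)\<close> that define a generalized polytope.  Functions on a set are represented
  as extensional functions.
\<close>

definition polytope_couples ::
    "'a::metric_space set \<Rightarrow> ('a decomposition \<times> ('a \<Rightarrow> real)) set" where
  "polytope_couples M = {(T, r). geodesic_triangulation M T \<and> r \<in> extensional (Sing M) \<and>
     (\<forall>i\<in>Sing M. 0 < r i) \<and> (\<forall>F\<in>faces T. \<exists>A. face_apex M r F A)}"

text \<open>
  Points of the complex glued from the pyramids.  The point at parameter \<open>t\<close> on the segment from
  the apex (\<open>t = 0\<close>) to the base point \<open>x\<close> of the pyramid with chart \<open>\<phi>\<close> becomes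
  \<open>Pt (\<phi> x) t\<close>.  Thus points of two pyramids are glued iff they have the same parameter \<open>t > 0\<close>
  and their base points are glued in \<open>T\<close>, and all apices are glued to \<open>Apex\<close>.
\<close>

datatype 'a polytope_point = Apex | Pt 'a real

definition cone_pt :: "'a \<Rightarrow> real \<Rightarrow> 'a polytope_point" where
  "cone_pt x t = (if t = 0 then Apex else Pt x t)"

definition polytope_carrier :: "'a set \<Rightarrow> 'a polytope_point set" where
  "polytope_carrier M = {cone_pt x t |x t. x \<in> M \<and> t \<in> {0..1}}"

text \<open>\<open>d\<close> is the Euclidean distance between \<open>P\<close> and \<open>Q\<close> inside one of the pyramids.\<close>

definition pyramid_dist :: "'a::metric_space set \<Rightarrow> 'a decomposition \<Rightarrow> ('a \<Rightarrow> real) \<Rightarrow>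
    'a polytope_point \<Rightarrow> 'a polytope_point \<Rightarrow> real \<Rightarrow> bool" where
  "pyramid_dist M T r P Q d \<longleftrightarrow>
     (\<exists>F\<in>faces T. case chart_of M F of (v, \<phi>) \<Rightarrow>
        \<exists>x\<in>triangle v. \<exists>y\<in>triangle v. \<exists>s\<in>{0..1}. \<exists>t\<in>{0..1}.
          P = cone_pt (\<phi> x) s \<and> Q = cone_pt (\<phi> y) t \<and>
          d = dist ((1 - s) *\<^sub>R apex_of M r F + s *\<^sub>R (x, 0)) ((1 - t) *\<^sub>R apex_of M r F + t *\<^sub>R (y, 0)))"

text \<open>
  The quotient metric of the glued complex: the infimum of the lengths of chains whose links
  each lie in one pyramid.
\<close>

definition glued_dist :: "'a::metric_space set \<Rightarrow> 'a decomposition \<Rightarrow> ('a \<Rightarrow> real) \<Rightarrow>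
    'a polytope_point \<Rightarrow> 'a polytope_point \<Rightarrow> real" where
  "glued_dist M T r P Q = Inf {\<Sum>i<n. d i |n p d. p 0 = P \<and> p n = Q \<and>
     (\<forall>i<n. pyramid_dist M T r (p i) (p (Suc i)) (d i))}"

definition polytope_isometry :: "'a::metric_space set \<Rightarrow>
    'a decomposition \<times> ('a \<Rightarrow> real) \<Rightarrow> 'a decomposition \<times> ('a \<Rightarrow> real) \<Rightarrow>
    ('a polytope_point \<Rightarrow> 'a polytope_point) \<Rightarrow> bool" where
  "polytope_isometry M = (\<lambda>(T, r) (T', r') f.
     bij_betw f (polytope_carrier M) (polytope_carrier M) \<and>
     (\<forall>P\<in>polytope_carrier M. \<forall>Q\<in>polytope_carrier M.
        glued_dist M T' r' (f P) (f Q) = glued_dist M T r P Q) \<and>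
     f Apex = Apex \<and> (\<forall>x\<in>M. f (Pt x 1) = Pt x 1))"

definition same_polytope :: "'a::metric_space set \<Rightarrow>
    (('a decomposition \<times> ('a \<Rightarrow> real)) \<times> ('a decomposition \<times> ('a \<Rightarrow> real))) set" where
  "same_polytope M = {(c, c'). c \<in> polytope_couples M \<and> c' \<in> polytope_couples M \<and>
     (\<exists>f. polytope_isometry M c c' f)}"

lemma equiv_same_polytope: "equiv (polytope_couples M) (same_polytope M)"
proof (rule equivI)
  show "same_polytope M \<subseteq> polytope_couples M \<times> polytope_couples M"
    by (auto simp: same_polytope_def)
  have "polytope_isometry M c c id" for c
    by (cases c) (simp add: polytope_isometry_def)
  then show "refl_on (polytope_couples M) (same_polytope M)"
    unfolding refl_on_def same_polytope_def by blast
  have "\<exists>g. polytope_isometry M c' c g" if "polytope_isometry M c c' f" for c c' f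
  proof -
    let ?C = "polytope_carrier M"
    let ?g = "the_inv_into ?C f"
    obtain T r T' r' where c: "c = (T, r)" "c' = (T', r')" by (metis prod.exhaust)
    have f: "bij_betw f ?C ?C" and f0: "f Apex = Apex" and f1: "\<forall>x\<in>M. f (Pt x 1) = Pt x 1"
      and iso: "\<And>P Q. P \<in> ?C \<Longrightarrow> Q \<in> ?C \<Longrightarrow>
        glued_dist M T' r' (f P) (f Q) = glued_dist M T r P Q"
      using that by (auto simp: polytope_isometry_def c)
    have g: "bij_betw ?g ?C ?C" using f by (rule bij_betw_the_inv_into)
    have fg: "f (?g P) = P" if "P \<in> ?C" for P
      using f that by (simp add: bij_betw_def f_the_inv_into_f)
    have gf: "?g (f P) = P" if "P \<in> ?C" for P
      using f that by (simp add: bij_betw_def the_inv_into_f_f)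
    have gC: "?g P \<in> ?C" if "P \<in> ?C" for P
      using g that by (auto simp: bij_betw_def)
    have g1: "?g (Pt x 1) = Pt x 1" if "x \<in> M" for x
    proof -
      have "cone_pt x 1 \<in> ?C" using that unfolding polytope_carrier_def by fastforce
      then show ?thesis using gf[of "Pt x 1"] f1 that by (simp add: cone_pt_def)
    qed
    have giso: "glued_dist M T r (?g P) (?g Q) = glued_dist M T' r' P Q"
      if "P \<in> ?C" "Q \<in> ?C" for P Q
      using iso[OF gC gC] fg that by metis
    show ?thesis
    proof (cases "M = {}")
      case True
      then have "?C = {}" by (simp add: polytope_carrier_def)
      then have "polytope_isometry M c' c id"
        using True by (simp add: polytope_isometry_def c)
      then show ?thesis by blast
    next
      case False
      then obtain x where "x \<in> M" by blast
      then have "cone_pt x 0 \<in> ?C" unfolding polytope_carrier_def by fastforce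
      then have "?g Apex = Apex" using gf[of Apex] f0 by (simp add: cone_pt_def)
      then have "polytope_isometry M c' c ?g"
        using g g1 giso by (simp add: polytope_isometry_def c)
      then show ?thesis by blast
    qed
  qed
  then show "sym (same_polytope M)"
    unfolding sym_def same_polytope_def by blast
  have "polytope_isometry M c c'' (g \<circ> f)"
    if "polytope_isometry M c c' f" "polytope_isometry M c' c'' g" for c c' c'' f g
    using that by (cases c; cases c'; cases c'')
      (auto simp: polytope_isometry_def bij_betw_apply intro: bij_betw_trans)
  then show "trans (same_polytope M)"
    unfolding trans_def same_polytope_def by blast
qed

text \<open>The angle at the line \<open>pq\<close> between the half-planes bounded by it through \<open>a\<close> and \<open>b\<close>.\<close>

definition dihedral_angle :: "'b::euclidean_space \<Rightarrow> 'b \<Rightarrow> 'b \<Rightarrow> 'b \<Rightarrow> real" where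
  "dihedral_angle p q a b =
     (let n = (\<lambda>x. (x - p) - (((x - p) \<bullet> (q - p)) / ((q - p) \<bullet> (q - p))) *\<^sub>R (q - p))
      in arccos ((n a \<bullet> n b) / (norm (n a) * norm (n b))))"

text \<open>
  The sum is over pairs of a face and a side of it that is glued to \<open>e\<close>, so a face both of whose
  sides are glued to \<open>e\<close> contributes twice.
\<close>

definition theta :: "'a::metric_space set \<Rightarrow> 'a decomposition \<Rightarrow> ('a \<Rightarrow> real) \<Rightarrow> 'a set \<Rightarrow> real" where
  "theta M T r e = (\<Sum>F\<in>faces T. case chart_of M F of (v, \<phi>) \<Rightarrow>
     (\<Sum>k\<in>{k. k < 3 \<and> \<phi> ` side v k = e}.
        dihedral_angle (v k, 0) (v ((k + 1) mod 3), 0) (v ((k + 2) mod 3), 0) (apex_of M r F)))"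

definition convex_couples ::
    "'a::metric_space set \<Rightarrow> ('a decomposition \<times> ('a \<Rightarrow> real)) set" where
  "convex_couples M = {(T, r) \<in> polytope_couples M. \<forall>e\<in>edges T. theta M T r e \<le> pi}"

definition generalized_convex_polytopes ::
    "'a::metric_space set \<Rightarrow> ('a decomposition \<times> ('a \<Rightarrow> real)) set set" where
  "generalized_convex_polytopes M = convex_couples M // same_polytope M"


section \<open>Weighted Delaunay tesselations\<close>

definition Q_function :: "'b::euclidean_space set \<Rightarrow> ('b \<Rightarrow> real) \<Rightarrow> bool" where
  "Q_function S f \<longleftrightarrow> (\<exists>p b. \<forall>x\<in>S. f x = (norm (x - p))\<^sup>2 + b)"

definition PQ_function_wrt ::
    "'a::metric_space set \<Rightarrow> 'a decomposition \<Rightarrow> ('a \<Rightarrow> real) \<Rightarrow> bool" where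
  "PQ_function_wrt M T f \<longleftrightarrow> continuous_on M f \<and>
     (\<forall>F\<in>faces T. case chart_of M F of (v, \<phi>) \<Rightarrow> Q_function (triangle v) (f \<circ> \<phi>))"

definition PQ_function :: "'a::metric_space set \<Rightarrow> ('a \<Rightarrow> real) \<Rightarrow> bool" where
  "PQ_function M f \<longleftrightarrow> (\<exists>T. geodesic_triangulation M T \<and> PQ_function_wrt M T f)"

definition Q_concave :: "'a::metric_space set \<Rightarrow> ('a \<Rightarrow> real) \<Rightarrow> bool" where
  "Q_concave M f \<longleftrightarrow> PQ_function M f \<and>
     (\<forall>L \<gamma>. geodesic_arc M L \<gamma> \<longrightarrow> concave_on {0..L} (\<lambda>t. f (\<gamma> t) - t\<^sup>2))"

definition PQ_extension ::
    "'a::metric_space set \<Rightarrow> 'a decomposition \<Rightarrow> ('a \<Rightarrow> real) \<Rightarrow> 'a \<Rightarrow> real" where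
  "PQ_extension M T q = (THE f. f \<in> extensional M \<and> PQ_function_wrt M T f \<and> (\<forall>i\<in>Sing M. f i = q i))"

definition weighted_Delaunay_triangulation ::
    "'a::metric_space set \<Rightarrow> 'a decomposition \<Rightarrow> ('a \<Rightarrow> real) \<Rightarrow> bool" where
  "weighted_Delaunay_triangulation M T q \<longleftrightarrow> geodesic_triangulation M T \<and>
     q \<in> extensional (Sing M) \<and> Q_concave M (PQ_extension M T q)"

definition inessential ::
    "'a::metric_space set \<Rightarrow> 'a decomposition \<Rightarrow> ('a \<Rightarrow> real) \<Rightarrow> 'a set \<Rightarrow> bool" where
  "inessential M T q e \<longleftrightarrow>
     (\<forall>x\<in>e. \<exists>U h g. planar_chart M U h \<and> x \<in> U \<and> Q_function (h ` U) g \<and>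
        (\<forall>y\<in>U. PQ_extension M T q y = g (h y)))"

text \<open>
  Removing edges from \<open>T\<close> merges faces: the faces of the result are the connected components of
  the complement of the vertices and the remaining edges.  They need not be discs, and a vertex
  may be left without edges.
\<close>

definition Delaunay_tesselation :: "'a::metric_space set \<Rightarrow> 'a decomposition \<Rightarrow> ('a \<Rightarrow> real) \<Rightarrow>
    'a decomposition \<times> ('a \<Rightarrow> real)" where
  "Delaunay_tesselation M T q =
     (let E = {e\<in>edges T. \<not> inessential M T q e}
      in (\<lparr>edges = E, faces = components (M - Sing M - \<Union>E)\<rparr>, q))"

definition positive_Delaunay_tesselations ::
    "'a::metric_space set \<Rightarrow> ('a decomposition \<times> ('a \<Rightarrow> real)) set" where
  "positive_Delaunay_tesselations M =
     {Delaunay_tesselation M T q |T q. weighted_Delaunay_triangulation M T q \<and>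
        (\<forall>x\<in>M. 0 < PQ_extension M T q x)}"

end

theory Submission
  imports Defs
begin

text \<open>
  In each pyramid the squared distance of a point of the base from the apex is a Q-function, so on
  the boundary the squared distance from the apex is the PQ-extension of \<open>r\<^sup>2\<close>.  Across an edge the
  derivative of this function jumps by an amount whose sign tells whether the dihedral angle is at
  most \<open>\<pi>\<close>; hence the polytope is convex iff the PQ-extension is Q-concave.  Conversely, suppose that a
  positive Q-concave PQ-extension is \<open>dist x p ^ 2 + b\<close> with \<open>b \<le> 0\<close> on some face.  By positivity the face
  does not contain \<open>p\<close>, and crossing an edge towards \<open>p\<close> leads to a smaller \<open>b\<close>, or to the same \<open>b\<close>
  with \<open>p\<close> closer to the face, which cannot go on forever; so \<open>b > 0\<close> and all pyramids exist.
  An isometry of complexes that fixes the boundary and the apex preserves the PQ-extension, and the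
  PQ-extension determines the metric of the complex.  Finally, two PQ-extensions with the same weights
  and the same essential edges agree by the maximum principle, since their difference is locally
  affine off these edges.
\<close>

section \<open>Isometries\<close>

text \<open>Everything about an edge is governed by one quantity. For a side of a face,
  \<open>slope\<close> is the signed distance of the center \<open>cp\<close> from the line of this
  side, and \<open>slope\<^sup>2 + cb\<close> is the squared distance of the apex from it if
  \<open>cb\<close> is the squared height. The latter agrees for the two faces at an edge. Therefore
  a dihedral angle sum at most \<open>pi\<close>, Q-concavity across the edge and inessentiality of
  the edge depend only on the sum of the two slopes: it is nonnegative, nonnegative, zero. The
  obstacle is that a triangulation is merely a partition of \<open>M\<close> into images of open
  cells, with charts taken by choice and with faces that may be glued to themselves. That closed
  faces cover \<open>M\<close>, that an edge has two sides, and that the two faces unfold by one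
  rigid motion must all be derived from the metric near single points. For this reason a side is
  tracked as a pair of a face and an open segment in its chart. Compactness of \<open>M\<close> lets
  sequences be lifted to one triangle, and connectedness serves the maximum principle.\<close>

lemma isometry_affine:
  fixes f :: "'a::euclidean_space \<Rightarrow> 'b::real_inner"
  assumes x: "x \<in> interior S"
    and iso: "\<And>y z. y \<in> S \<Longrightarrow> z \<in> S \<Longrightarrow> dist (f y) (f z) = dist y z"
  shows "\<exists>L. linear L \<and> (\<forall>u. norm (L u) = norm u) \<and> (\<forall>z\<in>S. f z = f x + L (z - x))"
proof -
  obtain e where e: "e > 0" "cball x e \<subseteq> S"
    using x by (meson mem_interior_cball)
  have xS: "x \<in> S" using x interior_subset by blast
  define g where "g z = f z - f x" for z
  \<comment> \<open>Polarization: distances from \<open>x\<close> and between the two points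
    determine the inner product.\<close>
  have gin: "g y \<bullet> g z = (y - x) \<bullet> (z - x)" if "y \<in> S" "z \<in> S" for y z
  proof -
    have 1: "norm (g w) = norm (w - x)" if "w \<in> S" for w
      using iso[OF that xS] by (simp add: g_def dist_norm)
    have 2: "norm (g y - g z) = norm (y - z)"
      using iso[OF that] by (simp add: g_def dist_norm)
    have "2 * (g y \<bullet> g z) = (norm (g y))\<^sup>2 + (norm (g z))\<^sup>2 - (norm (g y - g z))\<^sup>2"
      by (simp add: power2_norm_eq_inner inner_diff inner_commute)
    also have "\<dots> = (norm (y - x))\<^sup>2 + (norm (z - x))\<^sup>2 - (norm ((y - x) - (z - x)))\<^sup>2"
      using 1 2 that by simp
    also have "\<dots> = 2 * ((y - x) \<bullet> (z - x))"
      by (simp only: power2_norm_eq_inner inner_diff) (simp add: inner_commute)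
    finally show ?thesis by simp
  qed
  \<comment> \<open>Images of the basis vectors, taken at length \<open>e\<close> to stay inside
    \<open>S\<close> and then rescaled. They are orthonormal but need not span the target, whose
    dimension may be larger, as for arcs in \<open>segment_isometry\<close>.\<close>
  define c where "c i = (1 / e) *\<^sub>R g (x + e *\<^sub>R i)" for i
  have mem: "x + e *\<^sub>R i \<in> S" if "i \<in> Basis" for i
    using e that by (auto simp: dist_norm)
  have gc: "g z \<bullet> c i = (z - x) \<bullet> i" if "z \<in> S" "i \<in> Basis" for z i
    using gin[OF that(1) mem[OF that(2)]] e by (simp add: c_def)
  have cc: "c i \<bullet> c j = (if i = j then 1 else 0)" if "i \<in> Basis" "j \<in> Basis" for i j
    using gc[OF mem[OF that(1)] that(2)] e that by (simp add: c_def inner_Basis)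
  define L where "L u = (\<Sum>i\<in>Basis. (u \<bullet> i) *\<^sub>R c i)" for u
  have lin: "linear L"
    unfolding L_def
    by (rule linearI) (simp_all add: inner_add_left scaleR_add_left sum.distrib scaleR_sum_right)
  have Lin: "L u \<bullet> L u = u \<bullet> u" for u
  proof -
    have "L u \<bullet> L u = (\<Sum>i\<in>Basis. \<Sum>j\<in>Basis. (u \<bullet> i) * ((u \<bullet> j) * (c j \<bullet> c i)))"
      unfolding L_def by (simp add: inner_sum_left inner_sum_right sum_distrib_left mult.assoc)
    also have "\<dots> = (\<Sum>i\<in>Basis. (u \<bullet> i) * (u \<bullet> i))"
      by (rule sum.cong) (simp_all add: cc if_distrib cong: if_cong)
    finally show ?thesis by (simp add: euclidean_inner[of u u])
  qed
  have "g z = L (z - x)" if "z \<in> S" for z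
  proof -
    have 1: "g z \<bullet> L (z - x) = (z - x) \<bullet> (z - x)"
      using that by (simp add: L_def inner_sum_right gc euclidean_inner[of "z - x" "z - x"])
    \<comment> \<open>\<open>L\<close> was built from the products with the \<open>c i\<close> only;
      that \<open>g z\<close> has no part outside their span follows by comparing lengths.\<close>
    have "(g z - L (z - x)) \<bullet> (g z - L (z - x)) = 0"
      using gin[OF that that] 1 Lin[of "z - x"]
      by (simp only: inner_diff_left inner_diff_right inner_commute[of "L (z - x)" "g z"])
    then show ?thesis by simp
  qed
  then show ?thesis
    using lin Lin by (intro exI[of _ L]) (simp add: g_def norm_eq_sqrt_inner algebra_simps)
qed

definition rigid :: "('a::euclidean_space \<Rightarrow> 'a) \<Rightarrow> bool" where
  "rigid R \<longleftrightarrow> (\<forall>x y. dist (R x) (R y) = dist x y)"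

text \<open>The linear part of a rigid motion: \<open>R\<close> moves points, \<open>lin R\<close>
  moves directions such as the normals of sides.\<close>

definition lin :: "('a::euclidean_space \<Rightarrow> 'a) \<Rightarrow> 'a \<Rightarrow> 'a" where
  "lin R u = R u - R 0"

lemma rigidD: "rigid R \<Longrightarrow> dist (R x) (R y) = dist x y"
  by (simp add: rigid_def)

lemma lin_orthogonal: "rigid R \<Longrightarrow> orthogonal_transformation (lin R)"
  unfolding orthogonal_transformation_isometry by (simp add: rigid_def lin_def dist_norm)

lemma lin_linear: "rigid R \<Longrightarrow> linear (lin R)"
  using lin_orthogonal orthogonal_transformation_linear by blast

lemma lin_inner: "rigid R \<Longrightarrow> lin R u \<bullet> lin R w = u \<bullet> w"
  using lin_orthogonal orthogonal_transformation_def by blast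

lemma lin_norm: "rigid R \<Longrightarrow> norm (lin R u) = norm u"
  by (simp add: norm_eq_sqrt_inner lin_inner)

lemma lin_diff: "rigid R \<Longrightarrow> R y - R x = lin R (y - x)"
  using linear_diff[OF lin_linear, of R y x] by (simp add: lin_def)

lemma rigid_eq: "rigid R \<Longrightarrow> R y = R x + lin R (y - x)"
  using lin_diff[of R y x] by (simp add: algebra_simps)

lemma lin_add: "rigid R \<Longrightarrow> lin R (u + w) = lin R u + lin R w"
  by (rule linear_add[OF lin_linear])

lemma lin_scaleR: "rigid R \<Longrightarrow> lin R (c *\<^sub>R u) = c *\<^sub>R lin R u"
  by (rule linear_scale[OF lin_linear])

lemma lin_minus: "rigid R \<Longrightarrow> lin R (- u) = - lin R u"
  by (rule linear_neg[OF lin_linear])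

lemma rigid_inj: "rigid R \<Longrightarrow> R x = R y \<longleftrightarrow> x = y"
  by (metis dist_eq_0_iff rigidD)

lemma rigid_surj: "rigid R \<Longrightarrow> surj R"
proof -
  assume R: "rigid R"
  have "surj (lin R)" using lin_orthogonal[OF R] orthogonal_transformation_surj by blast
  show ?thesis
  proof (rule surjI)
    fix y
    have "lin R (inv (lin R) (y - R 0)) = y - R 0"
      using \<open>surj (lin R)\<close> by (rule surj_f_inv_f)
    then show "R (inv (lin R) (y - R 0)) = y" by (simp add: lin_def)
  qed
qed

lemma rigid_bij: "rigid R \<Longrightarrow> bij R"
  using rigid_inj[of R] rigid_surj[of R] by (simp add: bij_def inj_def)

lemma rigid_inv_f [simp]: "rigid R \<Longrightarrow> inv R (R x) = x"
  using rigid_bij[of R] by (simp add: bij_is_inj)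

lemma rigid_f_inv [simp]: "rigid R \<Longrightarrow> R (inv R x) = x"
  using rigid_surj[of R] by (simp add: surj_f_inv_f)

lemma rigid_inv: "rigid R \<Longrightarrow> rigid (inv R)"
proof -
  assume R: "rigid R"
  have "dist (inv R x) (inv R y) = dist x y" for x y
    using rigidD[OF R, of "inv R x" "inv R y"] R by simp
  then show ?thesis by (simp add: rigid_def)
qed

lemma rigid_comp: "rigid R \<Longrightarrow> rigid R' \<Longrightarrow> rigid (\<lambda>x. R (R' x))"
  by (simp add: rigid_def)

lemma lin_comp: "rigid R \<Longrightarrow> rigid R' \<Longrightarrow> lin (\<lambda>x. R (R' x)) u = lin R (lin R' u)"
  using lin_diff[of R "R' u" "R' 0"] by (simp add: lin_def)

lemma lin_inv: "rigid R \<Longrightarrow> lin (inv R) (lin R u) = u"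
  using lin_comp[OF rigid_inv, of R R u] by (simp add: lin_def)

lemma rigid_extension:
  fixes f :: "'a::euclidean_space \<Rightarrow> 'a"
  assumes "interior S \<noteq> {}"
    and iso: "\<And>y z. y \<in> S \<Longrightarrow> z \<in> S \<Longrightarrow> dist (f y) (f z) = dist y z"
  shows "\<exists>R. rigid R \<and> (\<forall>z\<in>S. f z = R z)"
proof -
  obtain x where x: "x \<in> interior S" using assms by blast
  obtain L where L: "linear L" "\<And>u. norm (L u) = norm u" "\<And>z. z \<in> S \<Longrightarrow> f z = f x + L (z - x)"
    using isometry_affine[OF x iso] by blast
  have "rigid (\<lambda>z. f x + L (z - x))"
    unfolding rigid_def dist_norm using L(2)[of "_ - _"] by (simp add: linear_diff[OF L(1)])
  then show ?thesis using L(3) by blast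
qed

lemma rigid_eq_on_open:
  assumes "rigid R" "rigid R'" "open S" "S \<noteq> {}" "\<And>z. z \<in> S \<Longrightarrow> R z = R' z"
  shows "R = R'"
proof -
  obtain x where x: "x \<in> S" using assms by blast
  obtain e where e: "e > 0" "ball x e \<subseteq> S" using assms x openE by blast
  have "lin R u = lin R' u" for u
  proof (cases "u = 0")
    case True then show ?thesis by (simp add: lin_def)
  next
    case False
    define t where "t = e / (2 * norm u)"
    have t: "t > 0" "x + t *\<^sub>R u \<in> ball x e"
      using False e by (auto simp: t_def dist_norm)
    have "R (x + t *\<^sub>R u) = R' (x + t *\<^sub>R u)" "R x = R' x" using t e x assms(5) by blast+
    then have "t *\<^sub>R lin R u = t *\<^sub>R lin R' u"
      using lin_diff[OF assms(1), of "x + t *\<^sub>R u" x] lin_diff[OF assms(2), of "x + t *\<^sub>R u" x]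
      by (metis lin_scaleR assms(1,2) add_diff_cancel_left')
    then show ?thesis using t by simp
  qed
  moreover have "R x = R' x" using assms(5) x .
  ultimately have "R y = R' y" for y
    using rigid_eq[OF assms(1), of y x] rigid_eq[OF assms(2), of y x] by metis
  then show ?thesis by blast
qed

text \<open>By \<open>rigid_eq_on_open\<close> the motion valid near a point is unique, so motions
  at nearby points coincide; a locally constant choice on a connected set is constant.\<close>

lemma locally_rigid:
  fixes f :: "'a::euclidean_space \<Rightarrow> 'a"
  assumes "connected S" "open S" "S \<noteq> {}"
    and loc: "\<And>x. x \<in> S \<Longrightarrow> \<exists>e>0. \<exists>R. rigid R \<and> (\<forall>z\<in>ball x e. f z = R z)"
  shows "\<exists>R. rigid R \<and> (\<forall>z\<in>S. f z = R z)"
proof -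
  define r where "r x = (SOME R. rigid R \<and> (\<exists>e>0. \<forall>z\<in>ball x e. f z = R z))" for x
  have r: "rigid (r x) \<and> (\<exists>e>0. \<forall>z\<in>ball x e. f z = r x z)" if "x \<in> S" for x
    unfolding r_def
    by (rule someI_ex[of "\<lambda>R. rigid R \<and> (\<exists>e>0. \<forall>z\<in>ball x e. f z = R z)"]) (use loc[OF that] in blast)
  have const: "r x = r y" if "x \<in> S" "y \<in> S" for x y
  proof (rule connected_local_const[OF \<open>connected S\<close> that], rule ballI)
    fix a assume a: "a \<in> S"
    then obtain e where e: "e > 0" "\<forall>z\<in>ball a e. f z = r a z" using r by blast
    have "r a = r b" if b: "b \<in> S" "dist b a < e" for b
    proof -
      obtain d where d: "d > 0" "\<forall>z\<in>ball b d. f z = r b z" using r b by blast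
      have "b \<in> ball b d \<inter> ball a e" using d b by (simp add: dist_commute)
      moreover have "r a z = r b z" if "z \<in> ball b d \<inter> ball a e" for z
        using that d(2) e(2) by (metis IntE)
      ultimately show ?thesis
        using r[OF a] r[OF b(1)] by (intro rigid_eq_on_open[of _ _ "ball b d \<inter> ball a e"]) (blast | simp)+
    qed
    then show "eventually (\<lambda>b. r a = r b) (at a within S)"
      unfolding eventually_at using e by auto
  qed
  obtain x where x: "x \<in> S" using assms by blast
  have "f z = r x z" if "z \<in> S" for z
    using r[OF that] const[OF that x] by (metis centre_in_ball)
  then show ?thesis using r[OF x] by blast
qed

lemma rigid_convex_hull_3: "rigid R \<Longrightarrow> R ` (convex hull {a, b, c}) = convex hull {R a, R b, R c}"
proof -
  assume R: "rigid R"
  have *: "R ` S = (\<lambda>x. R 0 + x) ` (lin R ` S)" for S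
    unfolding image_image by (rule image_cong) (simp_all add: lin_def)
  have "R ` (convex hull S) = convex hull (R ` S)" for S
    by (simp only: * convex_hull_translation convex_hull_linear_image[OF lin_linear[OF R]])
  then show ?thesis by simp
qed

lemma rigid_open_segment: "rigid R \<Longrightarrow> R ` open_segment a b = open_segment (R a) (R b)"
proof -
  assume R: "rigid R"
  have "R ((1 - u) *\<^sub>R a + u *\<^sub>R b) = (1 - u) *\<^sub>R R a + u *\<^sub>R R b" for u
  proof -
    have "(1 - u) *\<^sub>R a + u *\<^sub>R b = a + u *\<^sub>R (b - a)" by (simp add: algebra_simps)
    then have "R ((1 - u) *\<^sub>R a + u *\<^sub>R b) = R a + u *\<^sub>R lin R (b - a)"
      using rigid_eq[OF R, of "a + u *\<^sub>R (b - a)" a] lin_scaleR[OF R] by simp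
    then show ?thesis by (simp add: lin_diff[OF R, symmetric] algebra_simps)
  qed
  note * = this
  show ?thesis
  proof (cases "a = b")
    case False
    then have "open_segment a b = (\<lambda>u. (1 - u) *\<^sub>R a + u *\<^sub>R b) ` {0<..<1}"
      "open_segment (R a) (R b) = (\<lambda>u. (1 - u) *\<^sub>R R a + u *\<^sub>R R b) ` {0<..<1}"
      using rigid_inj[OF R] by (simp_all add: open_segment_image_interval)
    then show ?thesis by (simp add: image_image *)
  qed simp
qed

lemma rigid_continuous: "rigid R \<Longrightarrow> continuous_on S R"
  by (rule continuous_onI) (auto simp: rigidD)

section \<open>Triangles in the plane\<close>

text \<open>The component of \<open>x - a\<close> orthogonal to the line \<open>ab\<close>.\<close>

definition perp :: "'b::euclidean_space \<Rightarrow> 'b \<Rightarrow> 'b \<Rightarrow> 'b" where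
  "perp a b x = (x - a) - (((x - a) \<bullet> (b - a)) / ((b - a) \<bullet> (b - a))) *\<^sub>R (b - a)"

text \<open>Unit normal of the side \<open>ab\<close>, pointing into the triangle
  \<open>abc\<close>.\<close>

definition inn :: "'b::euclidean_space \<Rightarrow> 'b \<Rightarrow> 'b \<Rightarrow> 'b" where
  "inn a b c = (1 / norm (perp a b c)) *\<^sub>R perp a b c"

text \<open>Signed distance from the line \<open>ab\<close>, positive on the side of
  \<open>c\<close>.\<close>

definition hgt :: "'b::euclidean_space \<Rightarrow> 'b \<Rightarrow> 'b \<Rightarrow> 'b \<Rightarrow> real" where
  "hgt a b c z = (z - a) \<bullet> inn a b c"

lemma perp_orth: "perp a b x \<bullet> (b - a) = 0"
  by (cases "b = a") (simp_all add: perp_def inner_diff_left[of "x - a"])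

lemma perp_nz: "\<not> collinear {a, b, c} \<Longrightarrow> perp a b c \<noteq> 0"
proof
  assume nc: "\<not> collinear {a, b, c}" and "perp a b c = 0"
  then obtain t where "c - a = t *\<^sub>R (b - a)" by (auto simp: perp_def)
  then have "c = (1 - t) *\<^sub>R a + t *\<^sub>R b" by (simp add: algebra_simps eq_diff_eq)
  then have "\<exists>u. c = u *\<^sub>R a + (1 - u) *\<^sub>R b" by (intro exI[of _ "1 - t"]) simp
  then show False using nc collinear_3_expand[of a c b] by (simp add: insert_commute)
qed

lemma inn_norm: "\<not> collinear {a, b, c} \<Longrightarrow> norm (inn a b c) = 1"
  using perp_nz[of a b c] by (simp add: inn_def)

lemma inn_orth: "inn a b c \<bullet> (b - a) = 0"
  by (simp add: inn_def perp_orth)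

lemma hgt_a [simp]: "hgt a b c a = 0"
  by (simp add: hgt_def)

lemma hgt_b [simp]: "hgt a b c b = 0"
  using inn_orth[of a b c] by (simp add: hgt_def inner_commute)

lemma hgt_c: "\<not> collinear {a, b, c} \<Longrightarrow> hgt a b c c > 0"
proof -
  assume nc: "\<not> collinear {a, b, c}"
  have "c - a = perp a b c + (((c - a) \<bullet> (b - a)) / ((b - a) \<bullet> (b - a))) *\<^sub>R (b - a)"
    by (simp add: perp_def)
  then have "(c - a) \<bullet> perp a b c = perp a b c \<bullet> perp a b c + 0"
    by (metis (no_types, lifting) inner_add_left inner_commute inner_scaleR_left mult_zero_right perp_orth)
  then show ?thesis
    using perp_nz[OF nc] by (simp add: hgt_def inn_def)
qed

lemma hgt_affine: "u + v + w = 1 \<Longrightarrow>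
  hgt a b c (u *\<^sub>R x + v *\<^sub>R y + w *\<^sub>R z) = u * hgt a b c x + v * hgt a b c y + w * hgt a b c z"
proof -
  assume "u + v + w = 1"
  then have "u *\<^sub>R x + v *\<^sub>R y + w *\<^sub>R z - a = u *\<^sub>R (x - a) + v *\<^sub>R (y - a) + w *\<^sub>R (z - a)"
    by (simp add: algebra_simps flip: scaleR_add_left)
  then show ?thesis by (simp add: hgt_def inner_add_left)
qed

text \<open>The barycentric coordinate at \<open>c\<close>. Written as a quotient of heights, so
  that the other two arise by permuting the corners and its sign is the sign of
  \<open>hgt\<close>.\<close>

definition bw :: "'b::euclidean_space \<Rightarrow> 'b \<Rightarrow> 'b \<Rightarrow> 'b \<Rightarrow> real" where
  "bw a b c z = hgt a b c z / hgt a b c c"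

lemma bw_affine: "u + v + w = 1 \<Longrightarrow> \<not> collinear {a, b, c} \<Longrightarrow>
  bw a b c (u *\<^sub>R a + v *\<^sub>R b + w *\<^sub>R c) = w"
  using hgt_affine[of u v w a b c a b c] hgt_c[of a b c] by (simp add: bw_def)

lemma affine_hull_triangle:
  fixes a b c :: "real^2"
  assumes "\<not> collinear {a, b, c}"
  obtains u v w where "u + v + w = 1" "z = u *\<^sub>R a + v *\<^sub>R b + w *\<^sub>R c"
proof -
  have "a \<noteq> b" "a \<noteq> c" "b \<noteq> c" "\<not> affine_dependent {a, b, c}"
    using assms by (auto simp: collinear_3_eq_affine_dependent)
  then have "affine hull {a, b, c} = UNIV"
    by (intro affine_independent_span_eq) auto
  then have "z \<in> {u *\<^sub>R a + v *\<^sub>R b + w *\<^sub>R c |u v w. u + v + w = 1}"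
    by (simp add: affine_hull_3)
  then show ?thesis using that by blast
qed

lemma barycentric:
  fixes a b c :: "real^2"
  assumes nc: "\<not> collinear {a, b, c}"
  shows "bw b c a z + bw a c b z + bw a b c z = 1"
    and "z = bw b c a z *\<^sub>R a + bw a c b z *\<^sub>R b + bw a b c z *\<^sub>R c"
proof -
  obtain u v w where 1: "u + v + w = 1" and 2: "z = u *\<^sub>R a + v *\<^sub>R b + w *\<^sub>R c"
    using affine_hull_triangle[OF nc] by blast
  have "bw a b c z = w" using bw_affine[OF 1 nc] 2 by simp
  moreover have "bw a c b z = v"
    using bw_affine[of u w v a c b] nc 1 2 by (simp add: insert_commute algebra_simps)
  moreover have "bw b c a z = u"
    using bw_affine[of v w u b c a] nc 1 2 by (simp add: insert_commute algebra_simps)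
  ultimately show "bw b c a z + bw a c b z + bw a b c z = 1"
    "z = bw b c a z *\<^sub>R a + bw a c b z *\<^sub>R b + bw a b c z *\<^sub>R c"
    using 1 2 by auto
qed

lemma in_triangle_iff:
  fixes a b c :: "real^2"
  assumes nc: "\<not> collinear {a, b, c}"
  shows "z \<in> convex hull {a, b, c} \<longleftrightarrow> 0 \<le> bw b c a z \<and> 0 \<le> bw a c b z \<and> 0 \<le> bw a b c z"
proof
  assume "z \<in> convex hull {a, b, c}"
  then obtain u v w where 0: "0 \<le> u" "0 \<le> v" "0 \<le> w"
    and 1: "u + v + w = 1" and 2: "z = u *\<^sub>R a + v *\<^sub>R b + w *\<^sub>R c"
    by (auto simp: convex_hull_3)
  have "bw a b c z = w" using bw_affine[OF 1 nc] 2 by simp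
  moreover have "bw a c b z = v"
    using bw_affine[of u w v a c b] nc 1 2 by (simp add: insert_commute algebra_simps)
  moreover have "bw b c a z = u"
    using bw_affine[of v w u b c a] nc 1 2 by (simp add: insert_commute algebra_simps)
  ultimately show "0 \<le> bw b c a z \<and> 0 \<le> bw a c b z \<and> 0 \<le> bw a b c z" using 0 by simp
next
  assume "0 \<le> bw b c a z \<and> 0 \<le> bw a c b z \<and> 0 \<le> bw a b c z"
  then show "z \<in> convex hull {a, b, c}"
    unfolding convex_hull_3 using barycentric[OF nc, of z] by blast
qed

lemma in_interior_triangle_iff:
  fixes a b c :: "real^2"
  assumes nc: "\<not> collinear {a, b, c}"
  shows "z \<in> interior (convex hull {a, b, c}) \<longleftrightarrow> 0 < bw b c a z \<and> 0 < bw a c b z \<and> 0 < bw a b c z"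
proof -
  have *: "interior (convex hull {a, b, c}) = {v. \<exists>x y z. 0 < x \<and> 0 < y \<and> 0 < z \<and> x + y + z = 1
      \<and> x *\<^sub>R a + y *\<^sub>R b + z *\<^sub>R c = v}"
    by (rule interior_convex_hull_3_minimal[OF nc]) simp
  show ?thesis
  proof
    assume "z \<in> interior (convex hull {a, b, c})"
    then obtain u v w where 0: "0 < u" "0 < v" "0 < w"
      and 1: "u + v + w = 1" and 2: "z = u *\<^sub>R a + v *\<^sub>R b + w *\<^sub>R c"
      by (auto simp: *)
    have "bw a b c z = w" using bw_affine[OF 1 nc] 2 by simp
    moreover have "bw a c b z = v"
      using bw_affine[of u w v a c b] nc 1 2 by (simp add: insert_commute algebra_simps)
    moreover have "bw b c a z = u"
      using bw_affine[of v w u b c a] nc 1 2 by (simp add: insert_commute algebra_simps)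
    ultimately show "0 < bw b c a z \<and> 0 < bw a c b z \<and> 0 < bw a b c z" using 0 by simp
  next
    assume "0 < bw b c a z \<and> 0 < bw a c b z \<and> 0 < bw a b c z"
    then show "z \<in> interior (convex hull {a, b, c})"
      unfolding * using barycentric[OF nc, of z] by (metis (mono_tags, lifting) mem_Collect_eq)
  qed
qed

lemma in_side_iff:
  fixes a b c :: "real^2"
  assumes nc: "\<not> collinear {a, b, c}"
  shows "z \<in> open_segment a b \<longleftrightarrow> 0 < bw b c a z \<and> 0 < bw a c b z \<and> bw a b c z = 0"
proof
  assume "z \<in> open_segment a b"
  then obtain u where u: "0 < u" "u < 1" and z: "z = (1 - u) *\<^sub>R a + u *\<^sub>R b + 0 *\<^sub>R c"
    by (auto simp: in_segment)
  have "bw a b c z = 0" using bw_affine[of "1-u" u 0 a b c] nc z by simp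
  moreover have "bw a c b z = u"
    using bw_affine[of "1-u" 0 u a c b] nc z by (simp add: insert_commute)
  moreover have "bw b c a z = 1-u"
    using bw_affine[of u 0 "1-u" b c a] nc z by (simp add: insert_commute add.commute)
  ultimately show "0 < bw b c a z \<and> 0 < bw a c b z \<and> bw a b c z = 0" using u by simp
next
  assume *: "0 < bw b c a z \<and> 0 < bw a c b z \<and> bw a b c z = 0"
  have "bw b c a z = 1 - bw a c b z" "z = bw b c a z *\<^sub>R a + bw a c b z *\<^sub>R b"
    using barycentric[OF nc, of z] * by auto
  then have "z = (1 - bw a c b z) *\<^sub>R a + bw a c b z *\<^sub>R b" "bw a c b z < 1" using * by auto
  moreover have "a \<noteq> b" using nc by auto
  ultimately show "z \<in> open_segment a b"
    using * by (auto simp: in_segment)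
qed

lemma continuous_bw: "isCont (bw a b c) z"
  unfolding bw_def hgt_def divide_inverse by (intro continuous_intros)

lemma inn_sym: "inn x y w = inn y x w"
proof (cases "x = y")
  case False
  then have nz: "(x - y) \<bullet> (x - y) \<noteq> 0" by simp
  have *: "(w - x) \<bullet> (y - x) = (x - y) \<bullet> (x - y) - (w - y) \<bullet> (x - y)"
    by (simp add: inner_diff inner_commute)
  have **: "(y - x) \<bullet> (y - x) = (x - y) \<bullet> (x - y)" by (simp add: inner_diff inner_commute)
  have "perp x y w = perp y x w"
    unfolding perp_def * ** diff_divide_distrib using nz by (simp add: algebra_simps)
  then show ?thesis by (simp add: inn_def)
qed simp

lemma bw_sym: "bw x y w = bw y x w"
proof -
  have "(z - x) \<bullet> inn y x w = (z - y) \<bullet> inn y x w" for z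
    using inn_orth[of y x w] by (simp add: inner_diff_left inner_diff_right inner_commute)
  then show ?thesis by (simp add: bw_def hgt_def fun_eq_iff inn_sym[of x y])
qed

text \<open>Near an inner point of a side the two other barycentric coordinates stay positive, so
  only the sign of the height over this side matters.\<close>

lemma triangle_near_side:
  fixes a b c :: "real^2"
  assumes nc: "\<not> collinear {a, b, c}" and y: "y \<in> open_segment a b"
  shows "\<exists>d>0. \<forall>z\<in>ball y d.
     (z \<in> convex hull {a, b, c} \<longleftrightarrow> 0 \<le> hgt a b c z) \<and>
     (z \<in> interior (convex hull {a, b, c}) \<longleftrightarrow> 0 < hgt a b c z) \<and>
     (z \<in> open_segment a b \<longleftrightarrow> hgt a b c z = 0)"
proof -
  have "(bw b c a \<longlongrightarrow> bw b c a y) (nhds y)" "(bw a c b \<longlongrightarrow> bw a c b y) (nhds y)"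
    using continuous_bw by (simp_all add: isCont_def tendsto_at_iff_tendsto_nhds)
  then have "\<forall>\<^sub>F z in nhds y. 0 < bw b c a z" "\<forall>\<^sub>F z in nhds y. 0 < bw a c b z"
    using y unfolding in_side_iff[OF nc] by (auto intro: order_tendstoD(1))
  then have "\<forall>\<^sub>F z in nhds y. 0 < bw b c a z \<and> 0 < bw a c b z"
    by eventually_elim auto
  then obtain d where d: "d > 0" "\<And>z. dist z y < d \<Longrightarrow> 0 < bw b c a z \<and> 0 < bw a c b z"
    unfolding eventually_nhds_metric by blast
  have "0 \<le> bw a b c z \<longleftrightarrow> 0 \<le> hgt a b c z" "0 < bw a b c z \<longleftrightarrow> 0 < hgt a b c z"
    "bw a b c z = 0 \<longleftrightarrow> hgt a b c z = 0" for z
    using hgt_c[OF nc] by (auto simp: bw_def zero_le_divide_iff zero_less_divide_iff)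
  then show ?thesis
    using d unfolding in_triangle_iff[OF nc] in_interior_triangle_iff[OF nc] in_side_iff[OF nc]
    by (intro exI[of _ d]) (auto simp: dist_commute less_imp_le)
qed

lemma triangle_cases:
  fixes a b c :: "real^2"
  assumes nc: "\<not> collinear {a, b, c}"
  shows "convex hull {a, b, c} = interior (convex hull {a, b, c}) \<union> open_segment a b \<union>
     open_segment b c \<union> open_segment c a \<union> {a, b, c}" (is "?L = ?R")
proof
  have "open_segment x y \<subseteq> ?L" if "x \<in> {a, b, c}" "y \<in> {a, b, c}" for x y
  proof -
    have "convex hull {x, y} \<subseteq> ?L" using that by (intro hull_mono) auto
    then show ?thesis using segment_open_subset_closed[of x y] by (simp add: segment_convex_hull)
  qed
  then have "open_segment a b \<subseteq> ?L" "open_segment b c \<subseteq> ?L" "open_segment c a \<subseteq> ?L" by auto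
  then show "?R \<subseteq> ?L"
    using interior_subset[of "convex hull {a,b,c}"] hull_subset[of "{a,b,c}" convex] by blast
  show "?L \<subseteq> ?R"
  proof
    fix z assume "z \<in> ?L"
    then have 0: "0 \<le> bw b c a z" "0 \<le> bw a c b z" "0 \<le> bw a b c z"
      by (auto simp: in_triangle_iff[OF nc])
    note b = barycentric[OF nc, of z]
    consider "0 < bw b c a z" "0 < bw a c b z" "0 < bw a b c z"
      | "bw b c a z = 0" "bw a c b z = 0" | "bw b c a z = 0" "bw a b c z = 0" 
      | "bw a c b z = 0" "bw a b c z = 0"
      | "bw b c a z = 0" "0 < bw a c b z" "0 < bw a b c z"
      | "0 < bw b c a z" "bw a c b z = 0" "0 < bw a b c z"
      | "0 < bw b c a z" "0 < bw a c b z" "bw a b c z = 0" using 0 by linarith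
    then show "z \<in> ?R"
    proof cases
      case 1 then show ?thesis by (simp add: in_interior_triangle_iff[OF nc])
    next
      case 2 then show ?thesis using b by auto
    next
      case 3 then show ?thesis using b by auto
    next
      case 4 then show ?thesis using b by auto
    next
      case 5
      have "z \<in> open_segment b c"
        using 5 in_side_iff[of b c a z] nc by (simp add: insert_commute bw_sym[of c a] bw_sym[of b a])
      then show ?thesis by simp
    next
      case 6
      have "z \<in> open_segment c a"
        using 6 in_side_iff[of c a b z] nc by (simp add: insert_commute bw_sym[of c a] bw_sym[of c b])
      then show ?thesis by simp
    next
      case 7 then show ?thesis by (simp add: in_side_iff[OF nc])
    qed
  qed
qed


lemma orthonormal_expansion:
  fixes u n w :: "real^2"
  assumes "norm u = 1" "norm n = 1" "u \<bullet> n = 0"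
  shows "w = (w \<bullet> u) *\<^sub>R u + (w \<bullet> n) *\<^sub>R n"
proof -
  have "pairwise orthogonal {u, n}" "u \<noteq> n" "u \<noteq> 0" "n \<noteq> 0"
    using assms by (auto simp: pairwise_def orthogonal_def inner_commute norm_eq_sqrt_inner)
  then have "independent {u, n}" by (intro pairwise_orthogonal_independent) auto
  then have "UNIV \<subseteq> span {u, n}"
    using \<open>u \<noteq> n\<close> by (intro card_ge_dim_independent) auto
  then have "(\<Sum>b\<in>{u, n}. (w \<bullet> b) *\<^sub>R b) = w"
    by (intro orthonormal_basis_expand \<open>pairwise orthogonal {u, n}\<close>) (use assms in auto)
  then show ?thesis using \<open>u \<noteq> n\<close> by simp
qed

lemma orthogonal_to_side:
  fixes a b c w :: "real^2"
  assumes nc: "\<not> collinear {a, b, c}" and w: "w \<bullet> (b - a) = 0"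
  shows "w = (w \<bullet> inn a b c) *\<^sub>R inn a b c"
proof -
  have ab: "b \<noteq> a" using nc by auto
  define u where "u = (1 / norm (b - a)) *\<^sub>R (b - a)"
  have "norm u = 1" "u \<bullet> inn a b c = 0" "w \<bullet> u = 0"
    using ab inn_orth[of a b c] w by (simp_all add: u_def inner_commute)
  then show ?thesis using orthonormal_expansion[of u "inn a b c" w] inn_norm[OF nc] by simp
qed

section \<open>Quadratic functions\<close>

definition Qf :: "'b::euclidean_space \<Rightarrow> real \<Rightarrow> 'b \<Rightarrow> real" where
  "Qf p b z = (norm (z - p))\<^sup>2 + b"

text \<open>The quadratic terms cancel: two Q-functions differ by an affine function with gradient
  \<open>2 *\<^sub>R (p' - p)\<close>. Comparison on segments and triangles and the maximum
  principle rest on this.\<close>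

lemma Qf_diff: "Qf p b z - Qf p' b' z = 2 * ((p' - p) \<bullet> (z - x)) + (Qf p b x - Qf p' b' x)"
  unfolding Qf_def power2_norm_eq_inner
  by (simp only: inner_diff_left inner_diff_right) (simp add: inner_commute algebra_simps)

lemma Qf_expand: "Qf p b (x + w) = Qf p b x + w \<bullet> w - 2 * (w \<bullet> (p - x))"
  unfolding Qf_def power2_norm_eq_inner
  by (simp only: inner_diff_left inner_diff_right inner_add_left inner_add_right) (simp add: inner_commute algebra_simps)

lemma Qf_rigid: "rigid R \<Longrightarrow> Qf (R p) b (R z) = Qf p b z"
  using rigidD[of R z p] by (simp only: Qf_def dist_norm)

lemma Qf_exists:
  fixes a b c :: "real^2"
  assumes nc: "\<not> collinear {a, b, c}"
  shows "\<exists>p d. Qf p d a = x \<and> Qf p d b = y \<and> Qf p d c = z"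
proof -
  have ab: "b \<noteq> a" using nc by auto
  define L where "L = norm (b - a)"
  define u where "u = (1 / L) *\<^sub>R (b - a)"
  define n where "n = inn a b c"
  have L: "L > 0" using ab by (simp add: L_def)
  have BB: "(b - a) \<bullet> (b - a) = L\<^sup>2" by (simp only: L_def power2_norm_eq_inner)
  have u: "u \<bullet> u = 1" "(b - a) \<bullet> u = L"
    using L by (simp_all add: u_def BB power2_eq_square)
  have n: "n \<bullet> n = 1" "(b - a) \<bullet> n = 0" "u \<bullet> n = 0"
    using inn_norm[OF nc] inn_orth[of a b c] by (simp_all add: n_def u_def inner_commute norm_eq_sqrt_inner)
  define h where "h = (c - a) \<bullet> n"
  define m where "m = (c - a) \<bullet> u"
  have h: "h > 0" using hgt_c[OF nc] by (simp add: h_def n_def hgt_def)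
  \<comment> \<open>\<open>s\<close> and \<open>t\<close> solve the conditions at \<open>b\<close>
    and at \<open>c\<close> for a center \<open>a + s *\<^sub>R u + t *\<^sub>R n\<close>; the
    constant then fixes the value at \<open>a\<close>.\<close>
  define s where "s = (L\<^sup>2 - (y - x)) / (2 * L)"
  define t where "t = ((c - a) \<bullet> (c - a) - 2 * m * s - (z - x)) / (2 * h)"
  define p where "p = a + s *\<^sub>R u + t *\<^sub>R n"
  have e: "Qf p (x - (s\<^sup>2 + t\<^sup>2)) w = x + (w - a) \<bullet> (w - a) - 2 * (s * ((w - a) \<bullet> u) + t * ((w - a) \<bullet> n))" for w
  proof -
    have 1: "Qf p (x - (s\<^sup>2 + t\<^sup>2)) a = x"
      using u(1) n(1,3) unfolding Qf_def power2_norm_eq_inner p_def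
      by (simp add: inner_add_left inner_add_right inner_diff_left inner_diff_right inner_commute[of n u] power2_eq_square)
    have 2: "(w - a) \<bullet> (p - a) = s * ((w - a) \<bullet> u) + t * ((w - a) \<bullet> n)"
      by (simp add: p_def inner_add_right)
    show ?thesis using Qf_expand[of p "x - (s\<^sup>2 + t\<^sup>2)" a "w - a"] 1 2 by simp
  qed
  have "Qf p (x - (s\<^sup>2 + t\<^sup>2)) b = y" 
    using L unfolding e u n BB by (simp add: s_def field_simps)
  moreover have "Qf p (x - (s\<^sup>2 + t\<^sup>2)) c = z"
    using h unfolding e m_def[symmetric] h_def[symmetric] by (simp add: t_def field_simps)
  moreover have "Qf p (x - (s\<^sup>2 + t\<^sup>2)) a = x" unfolding e by simp
  ultimately show ?thesis by blast
qed

text \<open>Hence two Q-functions that agree at two points agree on the segment between them, and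
  those that agree at the corners of a triangle agree in the whole plane.\<close>

lemma Qf_affine_comb:
  assumes "u + v + w = (1::real)"
  shows "Qf p b (u *\<^sub>R x + v *\<^sub>R y + w *\<^sub>R z) - Qf p' b' (u *\<^sub>R x + v *\<^sub>R y + w *\<^sub>R z) =
    u * (Qf p b x - Qf p' b' x) + v * (Qf p b y - Qf p' b' y) + w * (Qf p b z - Qf p' b' z)"
proof -
  define g where "g = (\<lambda>z. Qf p b z - Qf p' b' z)"
  have g: "g z = 2 * ((p' - p) \<bullet> z) + g 0" for z
    using Qf_diff[of p b z p' b' 0] by (simp add: g_def)
  have u: "u = 1 - v - w" using assms by simp
  have "g (u *\<^sub>R x + v *\<^sub>R y + w *\<^sub>R z) = u * g x + v * g y + w * g z"
    unfolding g[of "_ + _"] g[of x] g[of y] g[of z]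
    unfolding u by (simp add: inner_add_right algebra_simps)
  then show ?thesis by (simp add: g_def)
qed

lemma Qf_eq_on_segment:
  assumes "Qf p b x = Qf p' b' x" "Qf p b y = Qf p' b' y" "z \<in> closed_segment x y"
  shows "Qf p b z = Qf p' b' z"
proof -
  obtain u where "z = (1 - u) *\<^sub>R x + u *\<^sub>R y + 0 *\<^sub>R y" using assms by (auto simp: in_segment)
  then show ?thesis using Qf_affine_comb[of "1-u" u 0 p b x y y p' b'] assms by simp
qed

lemma Qf_eq_on_triangle:
  fixes a b c :: "real^2"
  assumes "\<not> collinear {a, b, c}"
    "Qf p d a = Qf p' d' a" "Qf p d b = Qf p' d' b" "Qf p d c = Qf p' d' c"
  shows "Qf p d z = Qf p' d' z"
proof -
  obtain u v w where "u + v + w = 1" "z = u *\<^sub>R a + v *\<^sub>R b + w *\<^sub>R c"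
    using affine_hull_triangle[OF assms(1)] by blast
  then show ?thesis using Qf_affine_comb[of u v w p d a b c p' d'] assms by simp
qed

lemma small_multiple:
  fixes w :: "'b::real_normed_vector"
  assumes "e > 0"
  obtains t :: real where "t > 0" "norm (t *\<^sub>R w) < e"
proof
  have *: "0 < norm w + 1" by (simp add: add_nonneg_pos)
  then show "e / (norm w + 1) > 0" using assms by simp
  have "e * norm w < e * (norm w + 1)" using assms by simp
  then have "e * norm w / (norm w + 1) < e" using * by (simp only: pos_divide_less_eq)
  then show "norm ((e / (norm w + 1)) *\<^sub>R w) < e" using assms * by simp
qed

lemma Qf_unique:
  assumes "\<And>z. z \<in> ball x e \<Longrightarrow> Qf p b z = Qf p' b' z" "e > 0"
  shows "p = p'" "b = b'"
proof -
  \<comment> \<open>Testing along the gradient of the difference shows that it vanishes.\<close>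
  obtain t where t: "t > 0" "norm (t *\<^sub>R (p' - p)) < e" using small_multiple[OF assms(2)] by blast
  define w where "w = t *\<^sub>R (p' - p)"
  have "Qf p b (x + w) = Qf p' b' (x + w)" using t by (intro assms) (simp add: dist_norm w_def)
  moreover have 0: "Qf p b x = Qf p' b' x" using assms by simp
  ultimately have "(p' - p) \<bullet> w = 0" using Qf_diff[of p b "x + w" p' b' x] by simp
  then have "(p' - p) \<bullet> (p' - p) = 0" using t by (simp add: w_def)
  then show "p = p'" by simp
  then show "b = b'" using 0 by (simp add: Qf_def)
qed

text \<open>The difference is affine and vanishes on the line through \<open>x\<close> with normal
  \<open>N\<close>, so the centers differ by a multiple of \<open>N\<close>. The last equation
  compares the values at \<open>x\<close> after removing the common tangential part: the apexes have
  equal squared distances from the line.\<close>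

lemma Qf_halves:
  fixes N x :: "real^2"
  assumes N: "norm N = 1" and e: "e > 0"
    and eq: "\<And>z. z \<in> ball x e \<Longrightarrow> (z - x) \<bullet> N = 0 \<Longrightarrow> Qf p b z = Qf p' b' z"
  shows "p - p' = ((p - p') \<bullet> N) *\<^sub>R N"
    and "Qf p b z - Qf p' b' z = - 2 * ((p - p') \<bullet> N) * ((z - x) \<bullet> N)"
    and "((p - x) \<bullet> N)\<^sup>2 + b = ((p' - x) \<bullet> N)\<^sup>2 + b'"
proof -
  \<comment> \<open>The tangential part of \<open>p - p'\<close>, to be shown zero; moving along it
    stays on the line, where the two functions agree.\<close>
  define w where "w = (p - p') - ((p - p') \<bullet> N) *\<^sub>R N"
  have NN: "N \<bullet> N = 1" using N by (simp add: norm_eq_sqrt_inner)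
  have wN: "w \<bullet> N = 0" using NN by (simp add: w_def inner_diff_left)
  obtain t where t: "t > 0" "norm (t *\<^sub>R w) < e" using small_multiple[OF e] by blast
  then have "Qf p b (x + t *\<^sub>R w) = Qf p' b' (x + t *\<^sub>R w)"
    by (intro eq) (simp_all add: dist_norm wN)
  moreover have 0: "Qf p b x = Qf p' b' x" using e eq by simp
  ultimately have "t * ((p' - p) \<bullet> w) = 0"
    using Qf_diff[of p b "x + t *\<^sub>R w" p' b' x] by simp
  then have "(p - p') \<bullet> w = 0" using t(1) by (simp add: inner_diff_left)
  moreover have "w \<bullet> w = (p - p') \<bullet> w - ((p - p') \<bullet> N) * (w \<bullet> N)"
    by (subst (1) w_def) (simp only: inner_diff_left[of "p - p'"] inner_scaleR_left inner_commute[of N w])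
  ultimately have "w = 0" using wN by simp
  then show *: "p - p' = ((p - p') \<bullet> N) *\<^sub>R N" by (simp add: w_def)
  define l where "l = (p - p') \<bullet> N"
  have p: "p' - p = (- l) *\<^sub>R N" using * by (simp add: l_def algebra_simps)
  show "Qf p b z - Qf p' b' z = - 2 * ((p - p') \<bullet> N) * ((z - x) \<bullet> N)"
    using Qf_diff[of p b z p' b' x] 0 unfolding p l_def[symmetric] by (simp add: inner_commute)
  have "p - x = (p' - x) + l *\<^sub>R N" using p by (simp add: algebra_simps)
  then have "(p - x) \<bullet> (p - x) = (p' - x) \<bullet> (p' - x) + 2 * l * ((p' - x) \<bullet> N) + l\<^sup>2"
    "(p - x) \<bullet> N = (p' - x) \<bullet> N + l"
    using NN by (simp_all add: inner_add inner_commute power2_eq_square algebra_simps)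
  moreover have "(p - x) \<bullet> (p - x) + b = (p' - x) \<bullet> (p' - x) + b'"
    using 0 by (simp add: Qf_def power2_norm_eq_inner inner_diff inner_commute)
  ultimately show "((p - x) \<bullet> N)\<^sup>2 + b = ((p' - x) \<bullet> N)\<^sup>2 + b'"
    by (simp add: power2_eq_square algebra_simps)
qed

section \<open>Dihedral angles\<close>

text \<open>Look along the edge: in the plane spanned by the inward normal and the vertical, the
  base lies along the first axis and the apex is seen at \<open>(hgt a b c p, h)\<close>.\<close>

lemma dihedral_angle_pyramid:
  fixes a b c p :: "real^2"
  assumes nc: "\<not> collinear {a, b, c}" and h: "h > 0"
  shows "dihedral_angle (a, 0) (b, 0) (c, 0) (p, h) =
    arccos (hgt a b c p / sqrt ((hgt a b c p)\<^sup>2 + h\<^sup>2))"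
proof -
  have *: "(x, k) - (a, 0) - (((x, k) - (a, 0)) \<bullet> ((b, 0) - (a, 0)) / (((b, 0) - (a, 0)) \<bullet> ((b, 0) - (a, 0)))) *\<^sub>R
    ((b, 0) - (a, 0)) = (perp a b x, k)" for x and k :: real
    by (simp add: perp_def)
  have "perp a b p = (perp a b p \<bullet> inn a b c) *\<^sub>R inn a b c"
    by (rule orthogonal_to_side[OF nc perp_orth])
  also have "perp a b p \<bullet> inn a b c = hgt a b c p"
    unfolding perp_def hgt_def inner_diff_left[of "p - a"] inner_scaleR_left
    using inn_orth[of a b c] by (simp only: inner_commute[of "b - a" "inn a b c"])
  finally have p: "perp a b p = hgt a b c p *\<^sub>R inn a b c" .
  have c: "perp a b c = norm (perp a b c) *\<^sub>R inn a b c"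
    using perp_nz[OF nc] by (simp add: inn_def)
  have ii: "inn a b c \<bullet> inn a b c = 1" using inn_norm[OF nc] by (simp add: norm_eq_sqrt_inner)
  have "perp a b c \<bullet> perp a b p = norm (perp a b c) * hgt a b c p"
    by (subst c, subst p) (simp add: ii)
  moreover have "norm (perp a b p, h) = sqrt ((hgt a b c p)\<^sup>2 + h\<^sup>2)"
    by (simp add: norm_prod_def p inn_norm[OF nc])
  moreover have "norm (perp a b c, 0::real) = norm (perp a b c)" by (simp add: norm_prod_def)
  ultimately show ?thesis
    unfolding dihedral_angle_def Let_def * using perp_nz[OF nc] by simp
qed

lemma arccos_add_le_pi_iff:
  assumes "\<bar>x\<bar> \<le> 1" "\<bar>y\<bar> \<le> 1"
  shows "arccos x + arccos y \<le> pi \<longleftrightarrow> 0 \<le> x + y"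
proof -
  have "arccos x + arccos y \<le> pi \<longleftrightarrow> arccos y \<le> arccos (- x)"
    using assms arccos_minus[of x] by auto
  also have "\<dots> \<longleftrightarrow> - x \<le> y" using assms by (intro arccos_le_mono) auto
  finally show ?thesis by auto
qed

text \<open>Both cosines have the same denominator, the distance of the apex from the edge, so their
  sum has the sign of \<open>s + s'\<close>.\<close>

lemma dihedral_sum_iff:
  assumes "s\<^sup>2 + h\<^sup>2 = s'\<^sup>2 + h'\<^sup>2" "h \<noteq> 0"
  shows "arccos (s / sqrt (s\<^sup>2 + h\<^sup>2)) + arccos (s' / sqrt (s'\<^sup>2 + h'\<^sup>2)) \<le> pi \<longleftrightarrow> 0 \<le> s + s'"
proof -
  define r where "r = sqrt (s\<^sup>2 + h\<^sup>2)"
  have "0 < s\<^sup>2 + h\<^sup>2" using assms(2) by (simp add: add_nonneg_pos)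
  then have r: "r > 0" by (simp add: r_def)
  have "\<bar>s\<bar> \<le> r" unfolding r_def by (rule real_le_rsqrt) simp
  moreover have "\<bar>s'\<bar> \<le> r" unfolding r_def assms(1) by (rule real_le_rsqrt) simp
  ultimately
  have "\<bar>s / r\<bar> \<le> 1" "\<bar>s' / r\<bar> \<le> 1" using r by (simp_all add: divide_le_eq_1)
  then show ?thesis
    using arccos_add_le_pi_iff r unfolding assms(1)[symmetric] r_def[symmetric]
    by (simp add: add_divide_distrib[symmetric] zero_le_divide_iff)
qed

section \<open>Charts\<close>

text \<open>A planar chart taking a metric ball onto the ball of the same radius. With full balls,
  shrinking a chart and lifting a point of the plane to \<open>M\<close> are immediate.\<close>

definition disc_chart :: "'a::metric_space set \<Rightarrow> 'a \<Rightarrow> real \<Rightarrow> ('a \<Rightarrow> real^2) \<Rightarrow> bool" where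
  "disc_chart M x d h \<longleftrightarrow> 0 < d \<and> x \<in> M \<and>
     (\<forall>y\<in>M \<inter> ball x d. \<forall>z\<in>M \<inter> ball x d. dist (h y) (h z) = dist y z) \<and>
     ball (h x) d \<subseteq> h ` (M \<inter> ball x d)"

lemma disc_chart_dist:
  "disc_chart M x d h \<Longrightarrow> y \<in> M \<Longrightarrow> dist x y < d \<Longrightarrow> z \<in> M \<Longrightarrow> dist x z < d \<Longrightarrow>
   dist (h y) (h z) = dist y z"
  by (simp add: disc_chart_def)

lemma disc_chart_pos: "disc_chart M x d h \<Longrightarrow> 0 < d" "disc_chart M x d h \<Longrightarrow> x \<in> M"
  by (auto simp: disc_chart_def)

lemma disc_chart_surj:
  assumes "disc_chart M x d h" "w \<in> ball (h x) e" "e \<le> d"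
  obtains y where "y \<in> M" "dist x y = dist (h x) w" "dist x y < e" "h y = w"
proof -
  have "w \<in> h ` (M \<inter> ball x d)" using assms by (auto simp: disc_chart_def)
  then obtain y where y: "y \<in> M" "dist x y < d" "w = h y" by auto
  have "dist (h x) (h y) = dist x y"
    using disc_chart_dist[OF assms(1) _ _ y(1,2)] disc_chart_pos[OF assms(1)] by simp
  with y assms(2) show ?thesis by (intro that[of y]) simp_all
qed

lemma disc_chart_inj:
  "disc_chart M x d h \<Longrightarrow> y \<in> M \<Longrightarrow> dist x y < d \<Longrightarrow> z \<in> M \<Longrightarrow> dist x z < d \<Longrightarrow> h y = h z \<Longrightarrow> y = z"
  using disc_chart_dist[of M x d h y z] by simp

lemma disc_chart_shrink:
  assumes "disc_chart M x d h" "0 < e" "e \<le> d"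
  shows "disc_chart M x e h"
proof -
  have "ball (h x) e \<subseteq> h ` (M \<inter> ball x e)"
  proof
    fix w assume "w \<in> ball (h x) e"
    then show "w \<in> h ` (M \<inter> ball x e)"
      using disc_chart_surj[OF assms(1) _ assms(3)] by (metis IntI imageI mem_ball)
  qed
  then show ?thesis using assms by (simp add: disc_chart_def)
qed

lemma disc_chart_image: "disc_chart M x d h \<Longrightarrow> h ` (M \<inter> ball x d) = ball (h x) d"
proof -
  assume c: "disc_chart M x d h"
  have "h y \<in> ball (h x) d" if "y \<in> M \<inter> ball x d" for y
    using disc_chart_dist[OF c, of x y] disc_chart_pos[OF c] that by simp
  then show ?thesis using c by (auto simp: disc_chart_def)
qed

lemma disc_chart_planar:
  assumes "disc_chart M x d h" shows "planar_chart M (M \<inter> ball x d) h"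
  unfolding planar_chart_def disc_chart_image[OF assms]
  using disc_chart_dist[OF assms] by (auto intro: openin_open_Int)

lemma planar_disc_chart:
  assumes "planar_chart M U h" "x \<in> U"
  obtains d where "disc_chart M x d h" "M \<inter> ball x d \<subseteq> U"
proof -
  have U: "openin (top_of_set M) U" and hU: "open (h ` U)"
    and iso: "\<And>y z. y \<in> U \<Longrightarrow> z \<in> U \<Longrightarrow> dist (h y) (h z) = dist y z"
    using assms(1) by (auto simp: planar_chart_def)
  obtain e where e: "e > 0" "\<And>y. y \<in> M \<Longrightarrow> dist y x < e \<Longrightarrow> y \<in> U" and UM: "U \<subseteq> M"
    using U assms(2) unfolding openin_euclidean_subtopology_iff by blast
  obtain e' where e': "e' > 0" "ball (h x) e' \<subseteq> h ` U"
    using hU assms(2) by (meson openE imageI)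
  define d where "d = min e e'"
  have d: "d > 0" "d \<le> e" "d \<le> e'" using e e' by (auto simp: d_def)
  have sub: "M \<inter> ball x d \<subseteq> U" using e d by (auto simp: dist_commute)
  have "ball (h x) d \<subseteq> h ` (M \<inter> ball x d)"
  proof
    fix w assume w: "w \<in> ball (h x) d"
    then have "w \<in> h ` U" using e' d by auto
    then obtain y where "y \<in> U" "w = h y" by auto
    then show "w \<in> h ` (M \<inter> ball x d)"
      using iso[OF assms(2), of y] w UM by auto
  qed
  then have "disc_chart M x d h"
    unfolding disc_chart_def using d sub assms(2) UM by (intro conjI ballI iso) blast+
  then show ?thesis using that sub by blast
qed

lemma regular_point_iff: "regular_point M x \<longleftrightarrow> (\<exists>d h. disc_chart M x d h)"
proof
  assume "regular_point M x"
  then show "\<exists>d h. disc_chart M x d h"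
    unfolding regular_point_def using planar_disc_chart by metis
next
  assume "\<exists>d h. disc_chart M x d h"
  then obtain d h where c: "disc_chart M x d h" by blast
  have "x \<in> M \<inter> ball x d" using disc_chart_pos[OF c] by simp
  then show "regular_point M x" using disc_chart_planar[OF c] by (auto simp: regular_point_def)
qed

lemma disc_chart_regular:
  assumes "disc_chart M x d h" "y \<in> M" "dist x y < d"
  shows "regular_point M y"
  unfolding regular_point_def using disc_chart_planar[OF assms(1)] assms(2,3)
  by (intro exI[of _ "M \<inter> ball x d"] exI[of _ h]) simp

section \<open>Regular and singular points\<close>

lemma parallelogram: "(norm (u + w))\<^sup>2 = 2 * (norm u)\<^sup>2 + 2 * (norm w)\<^sup>2 - (norm (u - w))\<^sup>2"
  for u w :: "'b::real_inner"
  unfolding power2_norm_eq_inner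
  by (simp add: inner_add_left inner_add_right inner_diff_left inner_diff_right)

lemma cone_dist_apex: "0 \<le> \<rho> \<Longrightarrow> cone_dist \<alpha> (0, 0) (\<rho>, \<theta>) = \<rho>"
  by (simp add: cone_dist_def)

lemma cone_dist_same:
  assumes "0 \<le> r"
  shows "(cone_dist \<alpha> (r, \<theta>1) (r, \<theta>2))\<^sup>2 =
     2 * r\<^sup>2 * (1 - cos (min pi (min \<bar>\<theta>1 - \<theta>2\<bar> (\<alpha> - \<bar>\<theta>1 - \<theta>2\<bar>))))"
proof -
  define c where "c = cos (min pi (min \<bar>\<theta>1 - \<theta>2\<bar> (\<alpha> - \<bar>\<theta>1 - \<theta>2\<bar>)))"
  have "c \<le> 1" by (simp add: c_def)
  then have "0 \<le> 2 * r\<^sup>2 * (1 - c)" by simp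
  moreover have "r\<^sup>2 + r\<^sup>2 - 2 * r * r * c = 2 * r\<^sup>2 * (1 - c)"
    by (simp add: power2_eq_square algebra_simps)
  ultimately show ?thesis by (simp add: cone_dist_def c_def[symmetric])
qed

text \<open>Count the points at distance \<open>2 * r\<close> from a given point of the circle of
  radius \<open>r\<close> around \<open>x\<close>. In the plane there is precisely one; in a cone
  there is none if \<alpha> is less than \<open>2 * pi\<close>, and there are several if it is
  greater.\<close>

lemma not_regular_and_singular: "regular_point M x \<Longrightarrow> \<not> singular_point M x"
proof
  assume "regular_point M x" and "singular_point M x"
  then obtain d h \<alpha> U k where c: "disc_chart M x d h" and \<alpha>: "0 < \<alpha>" "\<alpha> \<noteq> 2 * pi"
    and k: "conical_chart M \<alpha> U k" and xU: "x \<in> U" and kx: "k x = (0, 0)"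
    unfolding regular_point_iff singular_point_def by blast
  have U: "openin (top_of_set M) U" and kU: "open_in_cone \<alpha> (k ` U)"
    and iso: "\<And>y z. y \<in> U \<Longrightarrow> z \<in> U \<Longrightarrow> cone_dist \<alpha> (k y) (k z) = dist y z"
    using k by (auto simp: conical_chart_def)
  obtain e where e: "e > 0" "\<And>y. y \<in> M \<Longrightarrow> dist y x < e \<Longrightarrow> y \<in> U" and UM: "U \<subseteq> M"
    using U xU unfolding openin_euclidean_subtopology_iff by blast
  have "(0, 0) \<in> k ` U" using xU kx by force
  then obtain e' where e': "e' > 0" "\<And>q. q \<in> cone \<alpha> \<Longrightarrow> cone_dist \<alpha> (0, 0) q < e' \<Longrightarrow> q \<in> k ` U"
    and kc: "k ` U \<subseteq> cone \<alpha>"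
    using kU unfolding open_in_cone_def by blast
  define r where "r = min d (min e e') / 2"
  have r: "r > 0" "r < d" "r < e" "r < e'"
    using e e' disc_chart_pos[OF c] by (auto simp: r_def min_def)
  have polar: "\<exists>\<theta>. k y = (r, \<theta>) \<and> 0 \<le> \<theta> \<and> \<theta> < \<alpha>" if y: "y \<in> U" "dist x y = r" for y
  proof -
    obtain \<rho> \<theta> where ky: "k y = (\<rho>, \<theta>)" by (meson surj_pair)
    have yc: "(\<rho>, \<theta>) \<in> cone \<alpha>" using kc y ky by (metis image_eqI subsetD)
    then have "0 \<le> \<rho>" by (auto simp: cone_def)
    then have "\<rho> = r" using iso[OF xU y(1)] y ky kx by (simp add: cone_dist_apex)
    then show ?thesis using yc r ky by (auto simp: cone_def)
  qed
  have lift: "\<exists>y. y \<in> U \<and> dist x y = r \<and> k y = (r, \<theta>)" if "0 \<le> \<theta>" "\<theta> < \<alpha>" for \<theta>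
  proof -
    have "(r, \<theta>) \<in> k ` U" using r that by (intro e') (auto simp: cone_def cone_dist_apex)
    then obtain y where "y \<in> U" "k y = (r, \<theta>)" by auto
    then show ?thesis using iso[OF xU, of y] kx r by (auto simp: cone_dist_apex)
  qed
  show False
  proof (cases "\<alpha> < 2 * pi")
    case True
    \<comment> \<open>Two opposite points of the planar circle. In the cone, their distance
      \<open>2 * r\<close> forces an angle of at least \<open>pi\<close> both ways around the
      apex.\<close>
    define u :: "real^2" where "u = r *\<^sub>R axis 1 1"
    have u: "norm u = r" using r by (simp add: u_def norm_axis_1)
    obtain y where y: "y \<in> M" "dist x y = r" "h y = h x + u"
    proof (rule disc_chart_surj[OF c, of "h x + u" d])
      show "h x + u \<in> ball (h x) d" using u r by (simp add: dist_norm)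
    qed (use u in \<open>auto simp: dist_norm\<close>)
    obtain z where z: "z \<in> M" "dist x z = r" "h z = h x - u"
    proof (rule disc_chart_surj[OF c, of "h x - u" d])
      show "h x - u \<in> ball (h x) d" using u r by (simp add: dist_norm)
    qed (use u in \<open>auto simp: dist_norm\<close>)
    have "dist (h y) (h z) = norm (2 *\<^sub>R u)" by (simp add: y z dist_norm scaleR_2)
    then have yz: "dist y z = 2 * r"
      using disc_chart_dist[OF c y(1) _ z(1)] y z r u by simp
    have yU: "y \<in> U" and zU: "z \<in> U" using y z e r by (auto simp: dist_commute)
    obtain \<theta>1 where ky: "k y = (r, \<theta>1)" using polar[OF yU y(2)] by blast
    obtain \<theta>2 where kz: "k z = (r, \<theta>2)" using polar[OF zU z(2)] by blast
    define m where "m = min pi (min \<bar>\<theta>1 - \<theta>2\<bar> (\<alpha> - \<bar>\<theta>1 - \<theta>2\<bar>))"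
    obtain \<theta>1': "0 \<le> \<theta>1" "\<theta>1 < \<alpha>" and \<theta>2': "0 \<le> \<theta>2" "\<theta>2 < \<alpha>"
      using polar[OF yU y(2)] polar[OF zU z(2)] ky kz by auto
    have m: "0 \<le> m" "m \<le> pi" using \<theta>1' \<theta>2' by (auto simp: m_def)
    have "(2 * r)\<^sup>2 = 2 * r\<^sup>2 * (1 - cos m)"
      using cone_dist_same[of r \<alpha> \<theta>1 \<theta>2] iso[OF yU zU] r yz ky kz by (simp add: m_def)
    then have "2 * r\<^sup>2 * (1 + cos m) = 0" by (simp add: power2_eq_square algebra_simps)
    then have "cos m = cos pi" using r by (simp add: eq_neg_iff_add_eq_0 add.commute)
    then have "m = pi" using m cos_inj_pi[of m pi] by simp
    then have "pi \<le> \<bar>\<theta>1 - \<theta>2\<bar>" "pi \<le> \<alpha> - \<bar>\<theta>1 - \<theta>2\<bar>" by (auto simp: m_def min_def split: if_splits)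
    then show False using True by linarith
  next
    case False
    then have big: "\<alpha> > 2 * pi" using \<alpha> by simp
    \<comment> \<open>Half of the excess angle. Seen from the ray at angle 0, the rays at
      \<open>pi\<close> and at \<open>pi + \<delta>\<close> both lie at least \<open>pi\<close> away
      in both directions.\<close>
    define \<delta> where "\<delta> = (\<alpha> - 2 * pi) / 2"
    have \<delta>: "\<delta> > 0" "2 * \<delta> = \<alpha> - 2 * pi" using big by (auto simp: \<delta>_def)
    obtain a where a: "a \<in> U" "dist x a = r" "k a = (r, 0)" using lift[of 0] \<alpha> by auto
    obtain b where b: "b \<in> U" "dist x b = r" "k b = (r, pi)" using lift[of pi] big pi_gt_zero by auto
    obtain c' where c': "c' \<in> U" "dist x c' = r" "k c' = (r, pi + \<delta>)"
      using lift[of "pi + \<delta>"] \<delta> pi_gt_zero by auto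
    \<comment> \<open>By the parallelogram law a point at distance \<open>2 * r\<close> from
      \<open>a\<close> on the planar circle is the antipode of \<open>a\<close>, hence
      unique.\<close>
    have anti: "h y = 2 *\<^sub>R h x - h a" if y: "y \<in> U" "dist x y = r" "(dist a y)\<^sup>2 = 4 * r\<^sup>2" for y
    proof -
      have 1: "norm (h a - h x) = r" "norm (h y - h x) = r" "dist (h a) (h y) = dist a y"
        using disc_chart_dist[OF c] disc_chart_pos[OF c] a y UM r
        by (metis dist_commute dist_norm dist_self subsetD)+
      have "(norm ((h a - h x) - (h y - h x)))\<^sup>2 = 4 * r\<^sup>2" using 1(3) y by (simp add: dist_norm)
      then have "(norm ((h a - h x) + (h y - h x)))\<^sup>2 = 0"
        using parallelogram[of "h a - h x" "h y - h x"] 1(1,2) by simp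
      then have "(h a - h x) + (h y - h x) = 0" by simp
      then show ?thesis by (simp add: scaleR_2 algebra_simps eq_neg_iff_add_eq_0)
    qed
    have "(dist a b)\<^sup>2 = 4 * r\<^sup>2"
      using cone_dist_same[of r \<alpha> 0 pi] r iso[OF a(1) b(1)] a b big by (simp add: min_def)
    moreover have "(dist a c')\<^sup>2 = 4 * r\<^sup>2"
      using cone_dist_same[of r \<alpha> 0 "pi + \<delta>"] r iso[OF a(1) c'(1)] a c' \<delta> pi_gt_zero by (simp add: min_def)
    ultimately have "h b = h c'" using anti b c' by metis
    then have "dist b c' = 0"
      using disc_chart_dist[OF c, of b c'] b c' UM r by auto
    moreover have "(dist b c')\<^sup>2 = 2 * r\<^sup>2 * (1 - cos (min pi (min \<delta> (\<alpha> - \<delta>))))"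
      using cone_dist_same[of r \<alpha> pi "pi + \<delta>"] r iso[OF b(1) c'(1)] b c' \<delta> by simp
    moreover have "cos (min pi (min \<delta> (\<alpha> - \<delta>))) < cos 0"
      using \<delta> pi_gt_zero by (intro cos_monotone_0_pi) (auto simp: min_def)
    ultimately show False using r by simp
  qed
qed

lemma dist_plane: "dist (x::real^2) y = sqrt ((x$1 - y$1)\<^sup>2 + (x$2 - y$2)\<^sup>2)"
  by (simp add: dist_vec_def L2_set_def sum_2 dist_real_def)

text \<open>The bounds on \<beta> make the two angles differ by less than
  \<open>\<alpha> / 2\<close> and \<open>pi / 2\<close>, so both minima in \<open>cone_dist\<close>
  select the plain difference and the planar law of cosines remains.\<close>

lemma cone_dist_sector:
  assumes "0 < \<rho>1" "0 < \<rho>2" "\<bar>\<theta>1 - \<alpha> / 2\<bar> < \<beta>" "\<bar>\<theta>2 - \<alpha> / 2\<bar> < \<beta>" "\<beta> \<le> \<alpha> / 4" "\<beta> \<le> pi / 4"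
  shows "dist (vector [\<rho>1 * cos (\<theta>1 - \<alpha>/2), \<rho>1 * sin (\<theta>1 - \<alpha>/2)] :: real^2)
           (vector [\<rho>2 * cos (\<theta>2 - \<alpha>/2), \<rho>2 * sin (\<theta>2 - \<alpha>/2)]) = cone_dist \<alpha> (\<rho>1, \<theta>1) (\<rho>2, \<theta>2)"
proof -
  have "\<bar>\<theta>1 - \<theta>2\<bar> < 2 * \<beta>" using assms by linarith
  then have "min pi (min \<bar>\<theta>1 - \<theta>2\<bar> (\<alpha> - \<bar>\<theta>1 - \<theta>2\<bar>)) = \<bar>\<theta>1 - \<theta>2\<bar>"
    using assms pi_gt_zero by (auto simp: min_def)
  then have c: "cos (min pi (min \<bar>\<theta>1 - \<theta>2\<bar> (\<alpha> - \<bar>\<theta>1 - \<theta>2\<bar>))) = cos (\<theta>1 - \<theta>2)" by simp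
  define x y where "x = \<theta>1 - \<alpha>/2" and "y = \<theta>2 - \<alpha>/2"
  have s: "(sin z)\<^sup>2 = 1 - (cos z)\<^sup>2" for z :: real by (simp add: sin_squared_eq)
  have "(\<rho>1 * cos x - \<rho>2 * cos y)\<^sup>2 + (\<rho>1 * sin x - \<rho>2 * sin y)\<^sup>2 =
    \<rho>1\<^sup>2 * ((cos x)\<^sup>2 + (sin x)\<^sup>2) + \<rho>2\<^sup>2 * ((cos y)\<^sup>2 + (sin y)\<^sup>2) - 2 * \<rho>1 * \<rho>2 * (cos x * cos y + sin x * sin y)"
    by algebra
  moreover have "cos (\<theta>1 - \<theta>2) = cos x * cos y + sin x * sin y"
    using cos_diff[of x y] by (simp add: x_def y_def)
  ultimately show ?thesis
    unfolding dist_plane cone_dist_def prod.case c x_def[symmetric] y_def[symmetric] by simp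
qed

text \<open>Take a point on the ray at angle \<open>\<alpha> / 2\<close>, away from the cut at angle
  0, and unroll a narrow sector around this ray into the plane.\<close>

lemma regular_near_singular:
  assumes x: "singular_point M x" and W: "openin (top_of_set M) W" and xW: "x \<in> W"
  shows "\<exists>y\<in>W. regular_point M y"
proof -
  obtain \<alpha> U k where \<alpha>: "0 < \<alpha>" "\<alpha> \<noteq> 2 * pi"
    and k: "conical_chart M \<alpha> U k" and xU: "x \<in> U" and kx: "k x = (0, 0)"
    using x unfolding singular_point_def by blast
  have U: "openin (top_of_set M) U" and kU: "open_in_cone \<alpha> (k ` U)"
    and iso: "\<And>y z. y \<in> U \<Longrightarrow> z \<in> U \<Longrightarrow> cone_dist \<alpha> (k y) (k z) = dist y z"
    using k by (auto simp: conical_chart_def)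
  have UM: "U \<subseteq> M" using U by (simp add: openin_euclidean_subtopology_iff)
  obtain e where e: "e > 0" "\<And>y. y \<in> M \<Longrightarrow> dist y x < e \<Longrightarrow> y \<in> W"
    using W xW unfolding openin_euclidean_subtopology_iff by blast
  have kc: "k ` U \<subseteq> cone \<alpha>"
    and kop: "\<And>p. p \<in> k ` U \<Longrightarrow> \<exists>\<epsilon>>0. \<forall>q\<in>cone \<alpha>. cone_dist \<alpha> p q < \<epsilon> \<longrightarrow> q \<in> k ` U"
    using kU unfolding open_in_cone_def by blast+
  have "(0, 0) \<in> k ` U" using xU kx by force
  then obtain e' where e': "e' > 0" "\<And>q. q \<in> cone \<alpha> \<Longrightarrow> cone_dist \<alpha> (0, 0) q < e' \<Longrightarrow> q \<in> k ` U"
    using kop by blast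
  define r where "r = min e e' / 2"
  have r: "r > 0" "r < e" "r < e'" using e e' by (auto simp: r_def min_def)
  have "(r, \<alpha>/2) \<in> k ` U" using r \<alpha> by (intro e') (auto simp: cone_def cone_dist_apex)
  then obtain y where y: "y \<in> U" "k y = (r, \<alpha>/2)" by auto
  have "dist x y = r" using iso[OF xU y(1)] y kx r by (simp add: cone_dist_apex)
  then have yW: "y \<in> W" using e r y UM by (auto simp: dist_commute)
  obtain \<epsilon> where \<epsilon>: "\<epsilon> > 0" "\<And>q. q \<in> cone \<alpha> \<Longrightarrow> cone_dist \<alpha> (r, \<alpha>/2) q < \<epsilon> \<Longrightarrow> q \<in> k ` U"
    using kop[OF \<open>(r, \<alpha>/2) \<in> k ` U\<close>] by blast
  obtain \<epsilon>' where \<epsilon>': "\<epsilon>' > 0" "\<And>z. z \<in> M \<Longrightarrow> dist z y < \<epsilon>' \<Longrightarrow> z \<in> U"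
    using U y(1) unfolding openin_euclidean_subtopology_iff by blast
  define \<beta> where "\<beta> = min (\<alpha>/4) (pi/4)"
  have \<beta>: "0 < \<beta>" "\<beta> \<le> \<alpha>/4" "\<beta> \<le> pi/4" using \<alpha> by (auto simp: \<beta>_def)
  have \<beta>2: "\<beta> < pi/2" using \<beta>(3) pi_gt_zero by linarith
  have sb: "0 < sin \<beta>" using \<beta> pi_gt_zero by (intro sin_gt_zero) auto
  have tb: "0 < tan \<beta>" using \<beta> \<beta>2 by (intro tan_gt_zero) auto
  \<comment> \<open>\<open>r * sin \<beta>\<close> is the distance of \<open>y\<close> from the rays
    bounding the sector. The bounds \<open>r / 2\<close> and \<open>r / 2 * tan \<beta>\<close> keep
    the planar disc around \<open>(r, 0)\<close> inside the unrolled sector.\<close>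
  define d where "d = min (min \<epsilon> \<epsilon>') (min (r * sin \<beta>) (min (r / 2) (r / 2 * tan \<beta>)))"
  have d: "d > 0" "d \<le> \<epsilon>" "d \<le> \<epsilon>'" "d \<le> r * sin \<beta>" "d \<le> r/2" "d \<le> r/2 * tan \<beta>"
    using \<epsilon> \<epsilon>' r sb tb by (auto simp: d_def)
  define h where "h z = (case k z of (\<rho>, \<theta>) \<Rightarrow> (vector [\<rho> * cos (\<theta> - \<alpha>/2), \<rho> * sin (\<theta> - \<alpha>/2)] :: real^2))" for z
  have hy: "h y = vector [r, 0]" by (simp add: h_def y)
  have sector: "\<exists>\<rho> \<theta>. k z = (\<rho>, \<theta>) \<and> 0 < \<rho> \<and> \<bar>\<theta> - \<alpha>/2\<bar> < \<beta> \<and> z \<in> U" if z: "z \<in> M" "dist y z < d" for z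
  proof -
    have zU: "z \<in> U" using z \<epsilon>' d by (auto simp: dist_commute)
    obtain \<rho> \<theta> where kz: "k z = (\<rho>, \<theta>)" by (meson surj_pair)
    have "(\<rho>, \<theta>) \<in> cone \<alpha>" using kc zU kz by (metis image_eqI subsetD)
    then consider "\<rho> = 0" "\<theta> = 0" | "0 < \<rho>" "0 \<le> \<theta>" "\<theta> < \<alpha>" by (auto simp: cone_def)
    then show ?thesis
    proof cases
      case 1
      then have "k z = k x" using kz kx by simp
      then have "dist x z = 0" using iso[OF xU zU] kx by (simp add: cone_dist_def)
      then have "dist y z = r" using \<open>dist x y = r\<close> by (simp add: dist_commute)
      then show ?thesis using z d r by simp
    next
      case 2
      define m where "m = min pi (min \<bar>\<alpha>/2 - \<theta>\<bar> (\<alpha> - \<bar>\<alpha>/2 - \<theta>\<bar>))"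
      have m: "0 \<le> m" "m \<le> pi" using 2 by (auto simp: m_def)
      have lt: "r\<^sup>2 + \<rho>\<^sup>2 - 2 * r * \<rho> * cos m < d\<^sup>2"
      proof -
        have "sqrt (r\<^sup>2 + \<rho>\<^sup>2 - 2 * r * \<rho> * cos m) < d"
          using iso[OF y(1) zU] y kz z by (simp add: cone_dist_def m_def)
        moreover have "0 \<le> r\<^sup>2 + \<rho>\<^sup>2 - 2 * r * \<rho> * cos m"
        proof -
          have "2 * r * \<rho> * cos m \<le> 2 * r * \<rho> * 1" using r 2 by (intro mult_left_mono) auto
          also have "\<dots> \<le> r\<^sup>2 + \<rho>\<^sup>2" using sum_squares_bound[of r \<rho>] by simp
          finally show ?thesis by simp
        qed
        ultimately show ?thesis
          using power_strict_mono[of "sqrt (r\<^sup>2 + \<rho>\<^sup>2 - 2 * r * \<rho> * cos m)" d 2] by simp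
      qed
      have "m < \<beta>"
      proof (rule ccontr)
        assume "\<not> m < \<beta>"
        then have mb: "\<beta> \<le> m" by simp
        have dd: "d\<^sup>2 \<le> r\<^sup>2 * (sin \<beta>)\<^sup>2" using power_mono[OF d(4), of 2] d(1) by (simp add: power_mult_distrib)
        \<comment> \<open>Points on a ray at angle \<open>m\<close> from \<open>y\<close> have
          distance at least \<open>r * sin m\<close> if \<open>m\<close> is at most a right angle,
          and more than \<open>r\<close> otherwise only up to the apex, that is at least
          \<open>r\<close>; both contradict the choice of \<open>d\<close>.\<close>
        show False
        proof (cases "m \<le> pi/2")
          case True
          have "sin \<beta> \<le> sin m" using mb True \<beta> by (intro sin_monotone_2pi_le) auto
          then have "(sin \<beta>)\<^sup>2 \<le> (sin m)\<^sup>2" using sb by (intro power_mono) auto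
          then have "d\<^sup>2 \<le> r\<^sup>2 * (sin m)\<^sup>2" using dd by (meson mult_left_mono order_trans zero_le_power2)
          also have "\<dots> \<le> (\<rho> - r * cos m)\<^sup>2 + r\<^sup>2 * (sin m)\<^sup>2" by simp
          also have "\<dots> = r\<^sup>2 * ((cos m)\<^sup>2 + (sin m)\<^sup>2) + \<rho>\<^sup>2 - 2 * r * \<rho> * cos m"
            by (simp only: power2_eq_square algebra_simps)
          finally show False using lt by simp
        next
          case False
          then have "cos m \<le> 0" using m cos_monotone_0_pi_le[of "pi/2" m] by simp
          then have "r * \<rho> * cos m \<le> 0" using r 2 by (intro mult_nonneg_nonpos) auto
          then have "r\<^sup>2 < d\<^sup>2" using lt zero_le_power2[of \<rho>] by linarith
          then have "r < d" using d(1) by (meson less_imp_le power_less_imp_less_base)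
          then show False using d r by linarith
        qed
      qed
      moreover have "\<bar>\<alpha>/2 - \<theta>\<bar> \<le> \<alpha>/2" using 2 by linarith
      ultimately have "\<bar>\<theta> - \<alpha>/2\<bar> < \<beta>" using \<beta> pi_gt_zero \<alpha>(1) by (auto simp: m_def min_def abs_minus_commute split: if_splits)
      then show ?thesis using 2 kz zU by blast
    qed
  qed
  have "disc_chart M y d h"
    unfolding disc_chart_def
  proof (intro conjI ballI subsetI)
    show "0 < d" "y \<in> M" using d y UM by auto
  next
    fix z z' assume z: "z \<in> M \<inter> ball y d" "z' \<in> M \<inter> ball y d"
    obtain \<rho> \<theta> where 1: "k z = (\<rho>, \<theta>)" "0 < \<rho>" "\<bar>\<theta> - \<alpha>/2\<bar> < \<beta>" "z \<in> U" using sector[of z] z by auto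
    obtain \<rho>' \<theta>' where 2: "k z' = (\<rho>', \<theta>')" "0 < \<rho>'" "\<bar>\<theta>' - \<alpha>/2\<bar> < \<beta>" "z' \<in> U" using sector[of z'] z by auto
    show "dist (h z) (h z') = dist z z'"
      using cone_dist_sector[OF 1(2) 2(2) 1(3) 2(3) \<beta>(2,3)] iso[OF 1(4) 2(4)] 1 2 by (simp add: h_def)
  next
    fix w assume "w \<in> ball (h y) d"
    then have "dist (h y) w < d" by simp
    moreover have "dist (h y) w = sqrt ((r - w$1)\<^sup>2 + (w$2)\<^sup>2)" by (simp add: hy dist_plane)
    ultimately have w: "sqrt ((r - w$1)\<^sup>2 + (w$2)\<^sup>2) < d" by simp
    have "r - w$1 \<le> sqrt ((r - w$1)\<^sup>2 + (w$2)\<^sup>2)" by (rule real_le_rsqrt) simp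
    then have w1: "w$1 > r/2" using d w by linarith
    have "\<bar>w$2\<bar> \<le> sqrt ((r - w$1)\<^sup>2 + (w$2)\<^sup>2)" by (rule real_le_rsqrt) simp
    then have "\<bar>w$2\<bar> < r/2 * tan \<beta>" using d w by linarith
    also have "\<dots> < w$1 * tan \<beta>" using w1 tb by simp
    finally have w2: "\<bar>w$2 / w$1\<bar> < tan \<beta>" using w1 r by (simp add: abs_divide divide_less_eq mult.commute)
    \<comment> \<open>Polar coordinates of \<open>w\<close>; \<open>arctan\<close> gives the angle
      because \<open>w$1\<close> is positive, and the bounds on \<open>d\<close> keep it below
      \<beta>.\<close>
    define t where "t = arctan (w$2 / w$1)"
    have "arctan (- tan \<beta>) < t" "t < arctan (tan \<beta>)" 
      unfolding t_def arctan_less_iff using w2 by linarith+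
    moreover have "arctan (tan \<beta>) = \<beta>" using \<beta> \<beta>2 by (intro arctan_tan) auto
    ultimately have t: "\<bar>t\<bar> < \<beta>" by (simp add: arctan_minus)
    define \<rho> where "\<rho> = w$1 / cos t"
    have ct: "cos t > 0" using t \<beta>2 by (intro cos_gt_zero_pi) auto
    have \<rho>: "\<rho> > 0" using w1 r ct by (simp add: \<rho>_def)
    have rc: "\<rho> * cos t = w$1" using ct by (simp add: \<rho>_def)
    have "tan t = w$2 / w$1" by (simp add: t_def tan_arctan)
    then have rs: "\<rho> * sin t = w$2" using w1 r ct by (simp add: \<rho>_def tan_def field_simps)
    have kk: "(vector [\<rho> * cos ((\<alpha>/2 + t) - \<alpha>/2), \<rho> * sin ((\<alpha>/2 + t) - \<alpha>/2)] :: real^2) = w"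
      by (simp add: rc rs vec_eq_iff forall_2)
    have "cone_dist \<alpha> (r, \<alpha>/2) (\<rho>, \<alpha>/2 + t) = dist (h y) w"
      using cone_dist_sector[OF r(1) \<rho>, of "\<alpha>/2" \<alpha> \<beta> "\<alpha>/2 + t"] \<beta> t kk hy by simp
    then have cd: "cone_dist \<alpha> (r, \<alpha>/2) (\<rho>, \<alpha>/2 + t) < d" using \<open>dist (h y) w < d\<close> by simp
    have "(\<rho>, \<alpha>/2 + t) \<in> k ` U" 
      using cd d t \<beta> \<rho> by (intro \<epsilon>) (auto simp: cone_def)
    then obtain z where z: "z \<in> U" "k z = (\<rho>, \<alpha>/2 + t)" by auto
    have "dist y z < d" using iso[OF y(1) z(1)] y z cd by simp
    moreover have "h z = w" using kk by (simp add: h_def z)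
    ultimately show "w \<in> h ` (M \<inter> ball y d)" using z UM by auto
  qed
  then show ?thesis using yW regular_point_iff by blast
qed

section \<open>Faces and edges of a geodesic triangulation\<close>

lemma triangle_interior_nonempty:
  fixes a b c :: "real^2"
  assumes nc: "\<not> collinear {a, b, c}"
  shows "interior (convex hull {a, b, c}) \<noteq> {}"
proof -
  define z where "z = (1/3) *\<^sub>R a + (1/3) *\<^sub>R b + (1/3) *\<^sub>R c"
  have "bw a b c z = 1/3" "bw b c a z = 1/3" "bw a c b z = 1/3"
    using bw_affine[of "1/3" "1/3" "1/3" a b c] bw_affine[of "1/3" "1/3" "1/3" b c a]
      bw_affine[of "1/3" "1/3" "1/3" a c b] nc
    by (simp_all add: z_def insert_commute add.commute add.left_commute)
  then have "z \<in> interior (convex hull {a, b, c})" by (simp add: in_interior_triangle_iff[OF nc])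
  then show ?thesis by blast
qed

lemma triangle_closure_interior:
  fixes a b c :: "real^2"
  assumes "\<not> collinear {a, b, c}"
  shows "closure (interior (convex hull {a, b, c})) = convex hull {a, b, c}"
proof -
  have "closure (interior (convex hull {a, b, c})) = closure (convex hull {a, b, c})"
    by (rule convex_closure_interior[OF convex_convex_hull triangle_interior_nonempty[OF assms]])
  also have "\<dots> = convex hull {a, b, c}"
    by (intro closure_closed compact_imp_closed finite_imp_compact_convex_hull) simp
  finally show ?thesis .
qed

lemma noncollinear_distinct: "\<not> collinear {a, b, c} \<Longrightarrow> a \<noteq> b \<and> b \<noteq> c \<and> a \<noteq> c"
  using collinear_3_eq_affine_dependent[of a b c] by blast

text \<open>The corners are the extreme points of the triangle.\<close>

lemma triangle_vertices_unique:
  fixes a b c a' b' c' :: "real^2"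
  assumes "\<not> collinear {a, b, c}" "\<not> collinear {a', b', c'}"
    and eq: "convex hull {a, b, c} = convex hull {a', b', c'}"
  shows "{a, b, c} = {a', b', c'}"
proof -
  have "\<not> affine_dependent {a, b, c}" "\<not> affine_dependent {a', b', c'}"
    using assms(1,2) by (auto simp: collinear_3_eq_affine_dependent)
  then have "x \<in> {a, b, c} \<longleftrightarrow> x \<in> {a', b', c'}" for x
    using extreme_point_of_convex_hull_affine_independent[of "{a, b, c}" x]
      extreme_point_of_convex_hull_affine_independent[of "{a', b', c'}" x] eq by simp
  then show ?thesis by blast
qed

lemma face_chart_noncollinear: "face_chart M F v \<phi> \<Longrightarrow> \<not> collinear {v 0, v 1, v 2}"
  by (simp add: face_chart_def)

text \<open>A face chart is only said to map the interior onto \<open>F\<close>; closedness of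
  \<open>M\<close> and continuity take care of the boundary.\<close>

lemma face_chart_subset:
  assumes "face_chart M F v \<phi>" "F \<subseteq> M" "closed M"
  shows "\<phi> ` triangle v \<subseteq> M"
proof -
  note cl = triangle_closure_interior[OF face_chart_noncollinear[OF assms(1)], folded triangle_def]
  have "\<phi> ` interior (triangle v) = F" using assms(1) by (simp add: face_chart_def bij_betw_def)
  moreover have "continuous_on (closure (interior (triangle v))) \<phi>"
    using assms(1) by (simp only: cl) (simp add: face_chart_def)
  ultimately have "\<phi> ` closure (interior (triangle v)) \<subseteq> closure M"
    using assms(2) closure_subset[of M] by (intro image_closure_subset) auto
  then show ?thesis using assms(3) by (simp add: cl closure_closed)
qed

text \<open>Even if \<open>z\<close> lies on a side, the part of the triangle near \<open>z\<close>
  has interior points, so the isometry \<open>h \<circ> \<phi>\<close> on this part extends to a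
  rigid motion of the plane.\<close>

lemma face_chart_in_disc_chart:
  assumes c: "face_chart M F v \<phi>" and M: "\<phi> ` triangle v \<subseteq> M"
    and z: "z \<in> triangle v - {v 0, v 1, v 2}" and h: "disc_chart M (\<phi> z) d h"
  obtains e A where "0 < e" "e \<le> d" "rigid A"
    "\<And>w. w \<in> triangle v \<Longrightarrow> dist z w < e \<Longrightarrow> dist (\<phi> z) (\<phi> w) = dist z w \<and> h (\<phi> w) = A w"
proof -
  note nc = face_chart_noncollinear[OF c]
  obtain e0 where e0: "e0 > 0" and iso: "\<And>y w. y \<in> triangle v \<inter> ball z e0 \<Longrightarrow> w \<in> triangle v \<inter> ball z e0 \<Longrightarrow>
      dist (\<phi> y) (\<phi> w) = dist y w"
    using c z unfolding face_chart_def by meson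
  define e where "e = min e0 d"
  have e: "0 < e" "e \<le> e0" "e \<le> d" using e0 disc_chart_pos(1)[OF h] by (auto simp: e_def)
  define S where "S = triangle v \<inter> ball z e"
  have zS: "z \<in> triangle v \<inter> ball z e0" using z e0 by simp
  have SM: "\<phi> w \<in> M \<and> dist (\<phi> z) (\<phi> w) = dist z w \<and> dist z w < d" if "w \<in> S" for w
    using that M e iso[OF zS, of w] by (auto simp: S_def)
  have hS: "dist (h (\<phi> y)) (h (\<phi> w)) = dist y w" if "y \<in> S" "w \<in> S" for y w
  proof -
    have "dist (\<phi> y) (\<phi> w) = dist y w" using that e by (intro iso) (auto simp: S_def)
    then show ?thesis
      using disc_chart_dist[OF h, of "\<phi> y" "\<phi> w"] SM[OF that(1)] SM[OF that(2)] by simp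
  qed
  have "interior S \<noteq> {}"
  proof -
    have "z \<in> closure (interior (triangle v))"
      using z triangle_closure_interior[OF nc] by (simp add: triangle_def)
    then have "interior (triangle v) \<inter> ball z e \<noteq> {}"
      using e(1) by (meson centre_in_ball closure_iff_nhds_not_empty open_ball order_refl)
    then show ?thesis by (simp add: S_def)
  qed
  then obtain A where A: "rigid A" "\<And>w. w \<in> S \<Longrightarrow> h (\<phi> w) = A w"
    using rigid_extension[of S "\<lambda>w. h (\<phi> w)"] hS by blast
  show thesis
  proof (rule that[OF e(1) e(3) A(1)])
    fix w assume "w \<in> triangle v" "dist z w < e"
    then have "w \<in> S" by (simp add: S_def)
    then show "dist (\<phi> z) (\<phi> w) = dist z w \<and> h (\<phi> w) = A w" using SM A(2) by simp
  qed
qed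

lemma interior_not_vertex:
  assumes "\<not> collinear {v 0, v 1, v 2 :: real^2}" "z \<in> interior (triangle v)"
  shows "z \<in> triangle v - {v 0, v 1, v 2}"
proof -
  have *: "\<not> (0 < bw (v 0) (v 1) (v 2) z \<and> 0 < bw (v 0) (v 2) (v 1) z \<and> 0 < bw (v 1) (v 2) (v 0) z)"
    if "z \<in> {v 0, v 1, v 2}"
    using that by (auto simp: bw_def)
  have "0 < bw (v 0) (v 1) (v 2) z \<and> 0 < bw (v 0) (v 2) (v 1) z \<and> 0 < bw (v 1) (v 2) (v 0) z"
    using assms by (simp add: triangle_def in_interior_triangle_iff)
  then show ?thesis using * interior_subset assms(2) by blast
qed

text \<open>The chart taken by \<open>SOME\<close> need not be the one for which the sides are known
  to be edges; this lemma transfers properties between them. The transition map between the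
  interiors is rigid near each point, as seen in disc charts, hence rigid; continuity extends it to
  the closed triangles.\<close>

lemma face_charts_congruent:
  assumes c: "face_chart M F v \<phi>" and c': "face_chart M F v' \<phi>'" and FM: "F \<subseteq> M" and M: "closed M"
    and reg: "\<And>x. x \<in> F \<Longrightarrow> regular_point M x"
  obtains R where "rigid R" "R ` triangle v = triangle v'" "\<And>z. z \<in> triangle v \<Longrightarrow> \<phi>' (R z) = \<phi> z"
proof -
  define I where "I = interior (triangle v)"
  define I' where "I' = interior (triangle v')"
  note nc = face_chart_noncollinear[OF c] and nc' = face_chart_noncollinear[OF c']
  have cl: "closure I = triangle v" and cl': "closure I' = triangle v'"
    using triangle_closure_interior[OF nc] triangle_closure_interior[OF nc']
    by (simp_all add: I_def I'_def triangle_def)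
  have bij: "bij_betw \<phi> I F" and bij': "bij_betw \<phi>' I' F"
    and cont: "continuous_on (triangle v) \<phi>" "continuous_on (triangle v') \<phi>'"
    using c c' by (simp_all add: face_chart_def I_def I'_def)
  note sub = face_chart_subset[OF c FM M] and sub' = face_chart_subset[OF c' FM M]
  define \<psi> where "\<psi> z = inv_into I' \<phi>' (\<phi> z)" for z
  have \<psi>: "\<psi> z \<in> I'" "\<phi>' (\<psi> z) = \<phi> z" if "z \<in> I" for z
  proof -
    have "\<phi> z \<in> \<phi>' ` I'" using bij bij' that by (auto simp: bij_betw_def)
    then show "\<psi> z \<in> I'" "\<phi>' (\<psi> z) = \<phi> z" unfolding \<psi>_def by (rule inv_into_into, rule f_inv_into_f)
  qed
  have \<psi>_eq: "\<psi> z = w" if "z \<in> I" "w \<in> I'" "\<phi>' w = \<phi> z" for z w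
    using \<psi>[OF that(1)] that bij' by (simp add: bij_betw_def inj_on_def)
  have surj: "\<psi> ` I = I'"
  proof
    show "\<psi> ` I \<subseteq> I'" using \<psi> by blast
    show "I' \<subseteq> \<psi> ` I"
    proof
      fix w assume w: "w \<in> I'"
      then have "\<phi>' w \<in> \<phi> ` I" using bij bij' by (auto simp: bij_betw_def)
      then obtain z where "z \<in> I" "\<phi>' w = \<phi> z" by auto
      then show "w \<in> \<psi> ` I" using \<psi>_eq[of z w] w by auto
    qed
  qed
  have "\<exists>R. rigid R \<and> (\<forall>z\<in>I. \<psi> z = R z)"
  proof (rule locally_rigid)
    show "connected I" unfolding I_def triangle_def
      by (intro convex_connected convex_interior convex_convex_hull)
    show "open I" "I \<noteq> {}" using triangle_interior_nonempty[OF nc] by (auto simp: I_def triangle_def)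
  next
    fix z assume z: "z \<in> I"
    have "\<phi> z \<in> F" using bij z by (auto simp: bij_betw_def)
    then obtain d h where h: "disc_chart M (\<phi> z) d h" using reg regular_point_iff by blast
    obtain e A where e: "0 < e" "e \<le> d" and A: "rigid A" and eA:
      "\<And>w. w \<in> triangle v \<Longrightarrow> dist z w < e \<Longrightarrow> dist (\<phi> z) (\<phi> w) = dist z w \<and> h (\<phi> w) = A w"
      using face_chart_in_disc_chart[OF c sub interior_not_vertex[OF nc] h] z by (auto simp: I_def)
    have h': "disc_chart M (\<phi>' (\<psi> z)) d h" using h \<psi>(2)[OF z] by simp
    obtain e' A' where e': "0 < e'" "e' \<le> d" and A': "rigid A'" and eA':
      "\<And>w. w \<in> triangle v' \<Longrightarrow> dist (\<psi> z) w < e' \<Longrightarrow> dist (\<phi>' (\<psi> z)) (\<phi>' w) = dist (\<psi> z) w \<and> h (\<phi>' w) = A' w"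
      using face_chart_in_disc_chart[OF c' sub' interior_not_vertex[OF nc'] h'] \<psi>(1)[OF z] by (auto simp: I'_def)
    obtain e1 where e1: "0 < e1" "ball z e1 \<subseteq> I" using z open_interior openE unfolding I_def by blast
    obtain e2 where e2: "0 < e2" "ball (\<psi> z) e2 \<subseteq> I'"
      using \<psi>(1)[OF z] open_interior openE unfolding I'_def by blast
    define e3 where "e3 = min (min e e') (min e1 e2)"
    have e3: "e3 > 0" "e3 \<le> e" "e3 \<le> e'" "e3 \<le> e1" "e3 \<le> e2" using e e' e1 e2 by (auto simp: e3_def)
    have It: "I \<subseteq> triangle v" "I' \<subseteq> triangle v'" using interior_subset by (auto simp: I_def I'_def)
    have "z \<in> triangle v" "\<psi> z \<in> triangle v'" using z \<psi>(1)[OF z] It by blast+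
    then have hz: "A z = A' (\<psi> z)"
      using eA[of z] eA'[of "\<psi> z"] \<psi>(2)[OF z] e e' by simp
    have "\<psi> w = inv A' (A w)" if w: "w \<in> ball z e3" for w
    proof (rule \<psi>_eq)
      show wI: "w \<in> I" using w e1 e3 by auto
      define w' where "w' = inv A' (A w)"
      have Aw: "A' w' = A w" using A' by (simp add: w'_def)
      have dw: "dist (\<psi> z) w' = dist z w"
        using rigidD[OF A', of "\<psi> z" w'] rigidD[OF A, of z w] Aw hz by simp
      then show w'I: "inv A' (A w) \<in> I'" using e2 e3 w by (auto simp: w'_def[symmetric])
      have 1: "dist (\<phi> z) (\<phi> w) = dist z w" "h (\<phi> w) = A w"
        using eA[of w] wI It w e3 by auto
      have 2: "dist (\<phi>' (\<psi> z)) (\<phi>' w') = dist z w" "h (\<phi>' w') = A w"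
        using eA'[of w'] w'I It w e3 dw Aw by (auto simp: w'_def[symmetric])
      have "\<phi>' w' = \<phi> w"
      proof (rule disc_chart_inj[OF h])
        have "w \<in> triangle v" "w' \<in> triangle v'" using It wI w'I unfolding w'_def by blast+
        then show "\<phi>' w' \<in> M" "\<phi> w \<in> M" using sub sub' by blast+
        show "dist (\<phi> z) (\<phi>' w') < d" "dist (\<phi> z) (\<phi> w) < d"
          using 1 2 \<psi>(2)[OF z] w e3 e by auto
        show "h (\<phi>' w') = h (\<phi> w)" using 1 2 by simp
      qed
      then show "\<phi>' (inv A' (A w)) = \<phi> w" by (simp add: w'_def)
    qed
    then show "\<exists>e>0. \<exists>R. rigid R \<and> (\<forall>w\<in>ball z e. \<psi> w = R w)"
      using e3(1) rigid_comp[OF rigid_inv[OF A'] A] by blast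
  qed
  then obtain R where R: "rigid R" "\<And>z. z \<in> I \<Longrightarrow> \<psi> z = R z" by blast
  have RI: "R ` I = I'" using surj R(2) by (metis image_cong)
  have im: "R ` triangle v = triangle v'"
  proof
    show "R ` triangle v \<subseteq> triangle v'"
      unfolding cl[symmetric] cl'[symmetric] using RI closure_subset[of I']
      by (intro image_closure_subset rigid_continuous[OF R(1)]) auto
    have "inv R ` I' \<subseteq> I" unfolding RI[symmetric] using R(1) by auto
    then have invR: "inv R ` triangle v' \<subseteq> triangle v"
      unfolding cl'[symmetric] cl[symmetric] using closure_subset[of I]
      by (intro image_closure_subset rigid_continuous[OF rigid_inv[OF R(1)]]) auto
    show "triangle v' \<subseteq> R ` triangle v"
    proof
      fix w assume "w \<in> triangle v'"
      then have "inv R w \<in> triangle v" using invR by blast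
      then show "w \<in> R ` triangle v" using rigid_f_inv[OF R(1), of w] by (metis imageI)
    qed
  qed
  have "\<phi>' (R z) = \<phi> z" if z: "z \<in> triangle v" for z
  proof -
    have "dist (\<phi>' (R z)) (\<phi> z) = 0"
    proof (rule continuous_constant_on_closure[of I "\<lambda>z. dist (\<phi>' (R z)) (\<phi> z)"])
      show "continuous_on (closure I) (\<lambda>z. dist (\<phi>' (R z)) (\<phi> z))"
        unfolding cl
        by (intro continuous_on_dist cont(1) continuous_on_compose2[OF cont(2) rigid_continuous[OF R(1)]])
          (simp add: im)
      show "dist (\<phi>' (R x)) (\<phi> x) = 0" if "x \<in> I" for x
        using \<psi>(2)[OF that] R(2)[OF that] by simp
      show "z \<in> closure I" using z cl by simp
    qed
    then show ?thesis by simp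
  qed
  then show thesis using that[OF R(1) im] by blast
qed

lemma less_3_cases: "k < (3::nat) \<longleftrightarrow> k = 0 \<or> k = 1 \<or> k = 2" by auto

lemma side_simps: "side v 0 = open_segment (v 0) (v 1)"
  "side v 1 = open_segment (v 1) (v 2)" "side v (Suc 0) = open_segment (v 1) (v 2)"
  "side v 2 = open_segment (v 2) (v 0)"
proof -
  have "(0 + 1) mod 3 = (1::nat)" "(1 + 1) mod 3 = (2::nat)" "(2 + 1) mod 3 = (0::nat)" by simp_all
  then show "side v 0 = open_segment (v 0) (v 1)"
    "side v 1 = open_segment (v 1) (v 2)" "side v 2 = open_segment (v 2) (v 0)"
    by (simp_all only: side_def)
  then show "side v (Suc 0) = open_segment (v 1) (v 2)" by (simp only: One_nat_def)
qed

lemma side_of_vertices: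
  assumes "x \<in> {v 0, v 1, v 2}" "y \<in> {v 0, v 1, v 2}" "x \<noteq> y"
  obtains k where "k < 3" "open_segment x y = side v k"
proof -
  have "open_segment x y = side v 0 \<or> open_segment x y = side v 1 \<or> open_segment x y = side v 2"
    using assms by (auto simp: side_simps open_segment_commute)
  then show thesis using that[of 0] that[of 1] that[of 2] by (elim disjE) simp_all
qed

lemma rigid_collinear:
  assumes R: "rigid R" and c: "collinear (R ` S)"
  shows "collinear S"
proof -
  obtain u where u: "\<forall>x\<in>R ` S. \<forall>y\<in>R ` S. \<exists>c. x - y = c *\<^sub>R u" using c unfolding collinear_def by blast
  have "\<exists>c. x - y = c *\<^sub>R lin (inv R) u" if xy: "x \<in> S" "y \<in> S" for x y
  proof -
    obtain c where "R x - R y = c *\<^sub>R u" using u xy by blast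
    then have "lin R (x - y) = c *\<^sub>R u" by (simp only: lin_diff[OF R])
    then have "lin (inv R) (lin R (x - y)) = c *\<^sub>R lin (inv R) u"
      by (simp only: lin_scaleR[OF rigid_inv[OF R]])
    then show ?thesis by (simp only: lin_inv[OF R]) blast
  qed
  then show ?thesis unfolding collinear_def by blast
qed

section \<open>Cells and chosen charts of a triangulated surface\<close>

locale triangulated =
  fixes M :: "'a::metric_space set" and T :: "'a decomposition"
  assumes compact_M: "compact M" and poly: "polyhedral_metric M"
    and geod: "geodesic_triangulation M T"
begin

definition vt :: "'a set \<Rightarrow> nat \<Rightarrow> real^2" where "vt F = fst (chart_of M F)"
definition ch :: "'a set \<Rightarrow> real^2 \<Rightarrow> 'a" where "ch F = snd (chart_of M F)"
definition tri :: "'a set \<Rightarrow> (real^2) set" where "tri F = triangle (vt F)"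

lemma chart_of_eq: "chart_of M F = (vt F, ch F)"
  by (simp add: vt_def ch_def)

lemma regular_iff: "x \<in> M \<Longrightarrow> regular_point M x \<longleftrightarrow> x \<notin> Sing M"
  using poly not_regular_and_singular[of M x] by (auto simp: polyhedral_metric_def Sing_def)

lemma disc_chart_ex:
  assumes "x \<in> M" "x \<notin> Sing M" obtains d h where "disc_chart M x d h"
  using assms regular_iff regular_point_iff by blast

lemma disc_chart_nonsing: "disc_chart M x d h \<Longrightarrow> y \<in> M \<Longrightarrow> dist x y < d \<Longrightarrow> y \<notin> Sing M"
  using disc_chart_regular regular_iff by blast

lemma finite_T: "finite (edges T)" "finite (faces T)"
  using geod by (auto simp: geodesic_triangulation_def)

lemma part: "partition_on M ((\<lambda>i. {i}) ` Sing M \<union> edges T \<union> faces T)"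
  using geod by (simp add: geodesic_triangulation_def)

lemma M_eq: "M = Sing M \<union> \<Union>(edges T) \<union> \<Union>(faces T)"
  using partition_onD1[OF part] by (simp add: Un_assoc)

lemma cells_disjoint: "X \<in> (\<lambda>i. {i}) ` Sing M \<union> edges T \<union> faces T \<Longrightarrow>
    Y \<in> (\<lambda>i. {i}) ` Sing M \<union> edges T \<union> faces T \<Longrightarrow> X \<noteq> Y \<Longrightarrow> X \<inter> Y = {}"
  using partition_onD2[OF part] by (simp add: disjoint_def)

lemma faces_eq: "F \<in> faces T \<Longrightarrow> F' \<in> faces T \<Longrightarrow> x \<in> F \<Longrightarrow> x \<in> F' \<Longrightarrow> F = F'"
  using cells_disjoint[of F F'] by blast

lemma edges_eq: "e \<in> edges T \<Longrightarrow> e' \<in> edges T \<Longrightarrow> x \<in> e \<Longrightarrow> x \<in> e' \<Longrightarrow> e = e'"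
  using cells_disjoint[of e e'] by blast

lemma edge_face: "e \<in> edges T \<Longrightarrow> F \<in> faces T \<Longrightarrow> x \<in> e \<Longrightarrow> x \<in> F \<Longrightarrow> False"
proof -
  assume *: "e \<in> edges T" "F \<in> faces T" "x \<in> e" "x \<in> F"
  have "edges T \<inter> faces T = {}" using geod by (simp add: geodesic_triangulation_def)
  then have "e \<noteq> F" using * by blast
  then show False using cells_disjoint[of e F] * by blast
qed

lemma edge_sing: "e \<in> edges T \<Longrightarrow> x \<in> e \<Longrightarrow> x \<in> M \<and> x \<notin> Sing M"
proof -
  assume *: "e \<in> edges T" "x \<in> e"
  have "(\<lambda>i. {i}) ` Sing M \<inter> edges T = {}" using geod by (simp add: geodesic_triangulation_def)
  then have "x \<in> Sing M \<Longrightarrow> e \<noteq> {x}" using * by blast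
  then have "x \<notin> Sing M" using cells_disjoint[of e "{x}"] * by blast
  then show ?thesis using M_eq * by blast
qed

lemma face_sing: "F \<in> faces T \<Longrightarrow> x \<in> F \<Longrightarrow> x \<in> M \<and> x \<notin> Sing M"
proof
  assume *: "F \<in> faces T" "x \<in> F"
  show "x \<in> M" using M_eq * by blast
  obtain v \<phi> where c: "face_chart M F v \<phi>"
    using geod * unfolding geodesic_triangulation_def by blast
  show "x \<notin> Sing M"
  proof
    assume "x \<in> Sing M"
    \<comment> \<open>Disjointness of cells leaves only this case, but a face is in bijection with a
      nonempty open set of the plane.\<close>
    then have "F = {x}" using cells_disjoint[of F "{x}"] * by blast
    then have "\<phi> ` interior (triangle v) = {x}" "inj_on \<phi> (interior (triangle v))"
      using c by (auto simp: face_chart_def bij_betw_def)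
    then obtain y where y: "y \<in> interior (triangle v)" by auto
    have "z = y" if "z \<in> interior (triangle v)" for z
      using \<open>\<phi> ` _ = {x}\<close> \<open>inj_on \<phi> _\<close> y that by (metis imageI inj_onD singletonD)
    then have "interior (triangle v) = {y}" using y by blast
    then show False using open_interior[of "triangle v"] not_open_singleton by metis
  qed
qed

text \<open>For the last claim, the rigid motion from \<open>face_charts_congruent\<close> carries
  corners to corners and so sides to sides.\<close>

lemma chart_props:
  assumes F: "F \<in> faces T"
  shows "face_chart M F (vt F) (ch F)" and "ch F ` tri F \<subseteq> M"
    and "k < 3 \<Longrightarrow> ch F ` side (vt F) k \<in> edges T"
proof -
  have FM: "F \<subseteq> M" using face_sing F by blast
  have reg: "regular_point M x" if "x \<in> F" for x using face_sing[OF F that] regular_iff by blast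
  have cM: "closed M" using compact_M compact_imp_closed by blast
  obtain v \<phi> where c: "face_chart M F v \<phi>" and ed: "\<And>k. k < 3 \<Longrightarrow> \<phi> ` side v k \<in> edges T"
    using geod F unfolding geodesic_triangulation_def by blast
  have "case chart_of M F of (v, \<phi>) \<Rightarrow> face_chart M F v \<phi>"
    unfolding chart_of_def by (rule someI[of _ "(v, \<phi>)"]) (simp add: c)
  then show c': "face_chart M F (vt F) (ch F)" by (simp add: chart_of_eq)
  show "ch F ` tri F \<subseteq> M" unfolding tri_def by (rule face_chart_subset[OF c' FM cM])
  obtain R where R: "rigid R" "R ` triangle v = triangle (vt F)"
    "\<And>z. z \<in> triangle v \<Longrightarrow> ch F (R z) = \<phi> z"
    using face_charts_congruent[OF c c' FM cM reg] by blast
  note nc = face_chart_noncollinear[OF c] and nc' = face_chart_noncollinear[OF c']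
  have "convex hull {R (v 0), R (v 1), R (v 2)} = convex hull {vt F 0, vt F 1, vt F 2}"
    using R(2) rigid_convex_hull_3[OF R(1)] by (simp add: triangle_def)
  moreover have "\<not> collinear {R (v 0), R (v 1), R (v 2)}"
  proof
    assume "collinear {R (v 0), R (v 1), R (v 2)}"
    then show False using rigid_collinear[OF R(1), of "{v 0, v 1, v 2}"] nc by simp
  qed
  ultimately have vs: "{R (v 0), R (v 1), R (v 2)} = {vt F 0, vt F 1, vt F 2}"
    using triangle_vertices_unique nc' by blast
  assume k: "k < 3"
  define x where "x = vt F k"
  define y where "y = vt F ((k + 1) mod 3)"
  have xy: "x \<in> {vt F 0, vt F 1, vt F 2}" "y \<in> {vt F 0, vt F 1, vt F 2}" "x \<noteq> y"
  proof -
    have "k = 0 \<and> (k + 1) mod 3 = 1 \<or> k = 1 \<and> (k + 1) mod 3 = 2 \<or> k = 2 \<and> (k + 1) mod 3 = 0"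
      using k unfolding less_3_cases by auto
    then show "x \<in> {vt F 0, vt F 1, vt F 2}" "y \<in> {vt F 0, vt F 1, vt F 2}" "x \<noteq> y"
      using noncollinear_distinct[OF nc'] unfolding x_def y_def by auto
  qed
  obtain x' y' where x': "x' \<in> {v 0, v 1, v 2}" "x = R x'" and y': "y' \<in> {v 0, v 1, v 2}" "y = R y'"
    using xy unfolding vs[symmetric] by blast
  obtain l where l: "l < 3" "open_segment x' y' = side v l"
    using side_of_vertices[of x' v y'] xy(3) x' y' by metis
  have "side (vt F) k = R ` side v l"
    using rigid_open_segment[OF R(1), of x' y'] x' y' l by (simp add: side_def x_def y_def)
  moreover have "side v l \<subseteq> triangle v"
  proof -
    have "open_segment (v 0) (v 1) \<subseteq> triangle v" "open_segment (v 1) (v 2) \<subseteq> triangle v"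
      "open_segment (v 2) (v 0) \<subseteq> triangle v"
      unfolding triangle_def using triangle_cases[OF nc] by blast+
    then show ?thesis using l(1) unfolding less_3_cases by (elim disjE) (simp_all only: side_simps)
  qed
  ultimately have "ch F ` side (vt F) k = \<phi> ` side v l"
    using R(3) by (simp add: image_image subset_iff cong: image_cong_simp)
  then show "ch F ` side (vt F) k \<in> edges T" using ed[OF l(1)] by simp
qed

text \<open>The corners of a face in any order. Naming a side by its ends \<open>a\<close>,
  \<open>b\<close> and the opposite corner \<open>c\<close> replaces indices modulo 3.\<close>

definition corner :: "'a set \<Rightarrow> real^2 \<Rightarrow> real^2 \<Rightarrow> real^2 \<Rightarrow> bool" where
  "corner F a b c \<longleftrightarrow> F \<in> faces T \<and> {a, b, c} = {vt F 0, vt F 1, vt F 2}"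

lemma corner_perm: "corner F a b c \<Longrightarrow> corner F b a c" "corner F a b c \<Longrightarrow> corner F a c b"
  "corner F a b c \<Longrightarrow> corner F b c a"
  by (simp_all add: corner_def insert_commute)

lemma corner_ex: "F \<in> faces T \<Longrightarrow> corner F (vt F 0) (vt F 1) (vt F 2)"
  by (simp add: corner_def)

lemma corner_side: "F \<in> faces T \<Longrightarrow> k < 3 \<Longrightarrow>
    corner F (vt F k) (vt F ((k + 1) mod 3)) (vt F ((k + 2) mod 3))"
proof -
  have "(0 + 1) mod 3 = (1::nat)" "(0 + 2) mod 3 = (2::nat)" "(1 + 1) mod 3 = (2::nat)"
    "(1 + 2) mod 3 = (0::nat)" "(2 + 1) mod 3 = (0::nat)" "(2 + 2) mod 3 = (1::nat)" by simp_all
  note mods = this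
  assume "F \<in> faces T" "k < 3"
  then show ?thesis
    unfolding less_3_cases corner_def by (elim disjE; simp only: mods; blast)
qed

lemma corner_face: "corner F a b c \<Longrightarrow> F \<in> faces T"
  by (simp add: corner_def)

lemma corner_nc: "corner F a b c \<Longrightarrow> \<not> collinear {a, b, c}"
  using face_chart_noncollinear[OF chart_props(1)] by (simp add: corner_def)

lemma corner_tri: "corner F a b c \<Longrightarrow> tri F = convex hull {a, b, c}"
  by (simp add: corner_def tri_def triangle_def)

lemma corner_distinct: "corner F a b c \<Longrightarrow> a \<noteq> b \<and> b \<noteq> c \<and> a \<noteq> c"
proof -
  assume "corner F a b c"
  then show ?thesis using noncollinear_distinct corner_nc by blast
qed

lemma corner_props:
  assumes c: "corner F a b c"
  shows "ch F ` open_segment a b \<in> edges T" "inj_on (ch F) (open_segment a b)"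
    "ch F a \<in> Sing M" "closed_segment a b \<subseteq> tri F" "open_segment a b \<subseteq> tri F" "a \<in> tri F"
proof -
  note F = corner_face[OF c]
  have "a \<in> {vt F 0, vt F 1, vt F 2}" "b \<in> {vt F 0, vt F 1, vt F 2}" using c by (auto simp: corner_def)
  moreover have "a \<noteq> b" using corner_distinct[OF c] by blast
  ultimately obtain k where k: "k < 3" "open_segment a b = side (vt F) k"
    by (rule side_of_vertices[of a "vt F" b])
  have fc: "\<And>k. k < 3 \<Longrightarrow> ch F (vt F k) \<in> Sing M \<and> inj_on (ch F) (side (vt F) k)"
    using chart_props(1)[OF F] by (simp add: face_chart_def)
  show "ch F ` open_segment a b \<in> edges T" "inj_on (ch F) (open_segment a b)"
    using chart_props(3)[OF F k(1)] fc[OF k(1)] k(2) by auto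
  show "ch F a \<in> Sing M" using \<open>a \<in> _\<close> fc[of 0] fc[of 1] fc[of 2] by auto
  show "closed_segment a b \<subseteq> tri F"
    unfolding corner_tri[OF c] segment_convex_hull by (rule hull_mono) auto
  then show "open_segment a b \<subseteq> tri F" "a \<in> tri F" using segment_open_subset_closed by auto
qed

lemma ch_cont: "F \<in> faces T \<Longrightarrow> continuous_on (tri F) (ch F)"
  using chart_props(1) by (simp add: face_chart_def tri_def)

lemma ch_bij: "F \<in> faces T \<Longrightarrow> bij_betw (ch F) (interior (tri F)) F"
  using chart_props(1) by (simp add: face_chart_def tri_def)

lemma ch_M: "F \<in> faces T \<Longrightarrow> z \<in> tri F \<Longrightarrow> ch F z \<in> M"
  using chart_props(2) by blast

lemma tri_compact: "F \<in> faces T \<Longrightarrow> compact (tri F)"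
  unfolding tri_def triangle_def by (intro finite_imp_compact_convex_hull) simp

lemma tri_point_cases:
  assumes F: "F \<in> faces T" and z: "z \<in> tri F"
  obtains (face) "z \<in> interior (tri F)" "ch F z \<in> F"
    | (edge) a b c where "corner F a b c" "z \<in> open_segment a b"
    | (vertex) a b c where "corner F a b c" "z = a" "ch F z \<in> Sing M"
proof -
  define a b c where "a = vt F 0" and "b = vt F 1" and "c = vt F 2"
  have co: "corner F a b c" using corner_ex[OF F] by (simp add: a_def b_def c_def)
  have "z \<in> interior (tri F) \<or> z \<in> open_segment a b \<or> z \<in> open_segment b c \<or> z \<in> open_segment c a \<or> z \<in> {a, b, c}"
    using z triangle_cases[OF corner_nc[OF co]] corner_tri[OF co] by auto
  then consider "z \<in> interior (tri F)" | "z \<in> open_segment a b" | "z \<in> open_segment b c" | "z \<in> open_segment c a"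
    | "z = a" | "z = b" | "z = c" by blast
  then show thesis
  proof cases
    case 1 then show ?thesis using face ch_bij[OF F] by (auto simp: bij_betw_def)
  next
    case 2 then show ?thesis using edge co by blast
  next
    case 3 then show ?thesis using edge co corner_perm by blast
  next
    case 4 then show ?thesis using edge co corner_perm by blast
  next
    case 5 then show ?thesis using vertex[OF co] corner_props(3)[OF co] by blast
  next
    case 6
    have "corner F b a c" using co corner_perm by blast
    then show ?thesis using 6 vertex corner_props(3) by blast
  next
    case 7
    have "corner F c a b" using co corner_perm by blast
    then show ?thesis using 7 vertex corner_props(3) by blast
  qed
qed

lemma ch_in_edge:
  assumes F: "F \<in> faces T" and z: "z \<in> tri F" and e: "e \<in> edges T" "ch F z \<in> e"
  obtains a b c where "corner F a b c" "z \<in> open_segment a b" "ch F ` open_segment a b = e"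
  using F z
proof (cases rule: tri_point_cases)
  case face then show ?thesis using edge_face e F by blast
next
  case (edge a b c)
  then have "ch F ` open_segment a b = e"
    using corner_props(1)[of F a b c] edges_eq[of _ e "ch F z"] e by blast
  then show ?thesis using edge that by blast
next
  case vertex then show ?thesis using edge_sing e by blast
qed

lemma not_vertex:
  assumes "F \<in> faces T" "z \<in> tri F" "ch F z \<notin> Sing M"
  shows "z \<in> triangle (vt F) - {vt F 0, vt F 1, vt F 2}"
proof -
  have "ch F (vt F k) \<in> Sing M" if "k < 3" for k
    using chart_props(1)[OF assms(1)] that by (simp add: face_chart_def)
  then have "ch F (vt F 0) \<in> Sing M" "ch F (vt F 1) \<in> Sing M" "ch F (vt F 2) \<in> Sing M" by simp_all
  then show ?thesis using assms by (auto simp: tri_def)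
qed

lemma local_isometry:
  assumes F: "F \<in> faces T" and z: "z \<in> tri F" "ch F z \<notin> Sing M"
  obtains e where "e > 0" "\<And>y w. y \<in> tri F \<Longrightarrow> w \<in> tri F \<Longrightarrow> dist z y < e \<Longrightarrow> dist z w < e \<Longrightarrow>
     dist (ch F y) (ch F w) = dist y w"
proof -
  obtain e where "e > 0" "\<forall>y\<in>triangle (vt F) \<inter> ball z e. \<forall>w\<in>triangle (vt F) \<inter> ball z e.
      dist (ch F y) (ch F w) = dist y w"
    using chart_props(1)[OF F] not_vertex[OF assms] unfolding face_chart_def by blast
  then show thesis by (intro that[of e]) (auto simp: tri_def)
qed

lemma in_disc_chart:
  assumes F: "F \<in> faces T" and z: "z \<in> tri F" and h: "disc_chart M (ch F z) d h"
  obtains e A where "0 < e" "e \<le> d" "rigid A" "\<And>w. w \<in> tri F \<Longrightarrow> dist z w < e \<Longrightarrow>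
     dist (ch F z) (ch F w) = dist z w \<and> h (ch F w) = A w"
proof -
  have "ch F z \<notin> Sing M"
    using disc_chart_nonsing[OF h disc_chart_pos(2)[OF h]] disc_chart_pos(1)[OF h] by simp
  then show thesis
    using face_chart_in_disc_chart[OF chart_props(1)[OF F] _ not_vertex[OF F z] h] chart_props(2)[OF F] that
    unfolding tri_def by blast
qed

section \<open>The closed faces cover the surface\<close>

text \<open>In the chart, the edge is a locally Lipschitz image of part of the first coordinate axis
  of the plane, which is a null set.\<close>

lemma edge_thin:
  assumes e: "e \<in> edges T" and h: "disc_chart M x d h"
  shows "negligible (h ` (e \<inter> ball x d))"
proof -
  obtain L \<gamma> where g: "geodesic_arc M L \<gamma>" and b: "bij_betw \<gamma> {0<..<L} e"
    using geod e unfolding geodesic_triangulation_def by blast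
  define S :: "(real^2) set" where "S = {z. z$2 = 0 \<and> z$1 \<in> {0<..<L} \<and> \<gamma> (z$1) \<in> ball x d}"
  define f :: "real^2 \<Rightarrow> real^2" where "f z = h (\<gamma> (z$1))" for z
  have im: "h ` (e \<inter> ball x d) \<subseteq> f ` S"
  proof
    fix w assume "w \<in> h ` (e \<inter> ball x d)"
    then obtain y where y: "y \<in> e" "y \<in> ball x d" "w = h y" by blast
    then obtain s where s: "s \<in> {0<..<L}" "y = \<gamma> s" using b by (auto simp: bij_betw_def)
    have "(vector [s, 0] :: real^2) \<in> S" "f (vector [s, 0]) = w" using s y by (auto simp: S_def f_def)
    then show "w \<in> f ` S" by blast
  qed
  have "negligible S"
  proof (rule negligible_subset[OF negligible_standard_hyperplane])
    show "axis 2 1 \<in> (Basis :: (real^2) set)" by simp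
    show "S \<subseteq> {z. z \<bullet> axis 2 1 = 0}" by (auto simp: S_def inner_axis)
  qed
  then have "negligible (f ` S)"
  proof (rule negligible_locally_Lipschitz_image[OF order_refl])
    fix z assume z: "z \<in> S"
    then have "z$1 \<in> {0..L}" by (auto simp: S_def)
    then obtain \<epsilon> where \<epsilon>: "\<epsilon> > 0" "\<And>s s'. s \<in> {0..L} \<inter> ball (z$1) \<epsilon> \<Longrightarrow> s' \<in> {0..L} \<inter> ball (z$1) \<epsilon> \<Longrightarrow>
        dist (\<gamma> s) (\<gamma> s') = \<bar>s - s'\<bar>"
      using g unfolding geodesic_arc_def by blast
    have "norm (f y - f z) \<le> 1 * norm (y - z)" if y: "y \<in> S \<inter> ball z \<epsilon>" for y
    proof -
      have c: "\<bar>y$1 - z$1\<bar> \<le> norm (y - z)" using component_le_norm_cart[of "y - z" 1] by simp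
      have m: "\<gamma> s \<in> M" if "s \<in> {0<..<L}" for s
      proof -
        have "s \<in> {0..L}" using that by simp
        then show ?thesis using g unfolding geodesic_arc_def by blast
      qed
      have "y$1 \<in> {0..L} \<inter> ball (z$1) \<epsilon>"
      proof -
        have "norm (y - z) < \<epsilon>" using y by (simp add: dist_norm norm_minus_commute)
        then have "dist (z$1) (y$1) < \<epsilon>" using c unfolding dist_real_def by linarith
        then show ?thesis using y by (simp add: S_def)
      qed
      moreover have "z$1 \<in> {0..L} \<inter> ball (z$1) \<epsilon>" using z \<epsilon> by (auto simp: S_def)
      ultimately have "dist (\<gamma> (y$1)) (\<gamma> (z$1)) = \<bar>y$1 - z$1\<bar>" using \<epsilon>(2) by blast
      moreover have "dist (f y) (f z) = dist (\<gamma> (y$1)) (\<gamma> (z$1))"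
        unfolding f_def using y z m by (intro disc_chart_dist[OF h]) (auto simp: S_def)
      ultimately show ?thesis using c by (simp add: dist_norm)
    qed
    then show "\<exists>T B. open T \<and> z \<in> T \<and> (\<forall>y\<in>S \<inter> T. norm (f y - f z) \<le> B * norm (y - z))"
      using \<epsilon>(1) by (intro exI[of _ "ball z \<epsilon>"] exI[of _ 1]) auto
  qed
  then show ?thesis using negligible_subset im by blast
qed

text \<open>Near a singular point pass to a regular one. A disc missing all faces would be covered
  by the edges, that is by finitely many null sets.\<close>

lemma faces_dense:
  assumes W: "openin (top_of_set M) W" and xW: "x \<in> W"
  shows "\<exists>y\<in>W. y \<in> \<Union>(faces T)"
proof -
  have WM: "W \<subseteq> M" using openin_imp_subset[OF W] .
  have "\<exists>y\<in>W. regular_point M y"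
  proof (cases "x \<in> Sing M")
    case True
    then show ?thesis using regular_near_singular[OF _ W xW] by (simp add: Sing_def)
  next
    case False then show ?thesis using regular_iff WM xW by blast
  qed
  then obtain y d h where y: "y \<in> W" and h: "disc_chart M y d h" using regular_point_iff by blast
  obtain e where e: "e > 0" "\<And>z. z \<in> M \<Longrightarrow> dist z y < e \<Longrightarrow> z \<in> W"
    using W y unfolding openin_euclidean_subtopology_iff by blast
  define d' where "d' = min d e"
  have d': "0 < d'" "d' \<le> d" "d' \<le> e" using e disc_chart_pos[OF h] by (auto simp: d'_def)
  have h': "disc_chart M y d' h" by (rule disc_chart_shrink[OF h d'(1,2)])
  show ?thesis
  proof (rule ccontr)
    assume no: "\<not> ?thesis"
    have "M \<inter> ball y d' \<subseteq> \<Union>(edges T)"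
    proof
      fix z assume z: "z \<in> M \<inter> ball y d'"
      then have "z \<in> W" using e d' by (auto simp: dist_commute)
      moreover have "z \<notin> Sing M" using disc_chart_nonsing[OF h'] z by auto
      ultimately show "z \<in> \<Union>(edges T)" using no M_eq WM by blast
    qed
    then have "h ` (M \<inter> ball y d') \<subseteq> (\<Union>e\<in>edges T. h ` (e \<inter> ball y d'))" by blast
    then have "ball (h y) d' \<subseteq> (\<Union>e\<in>edges T. h ` (e \<inter> ball y d'))"
      by (simp only: disc_chart_image[OF h'])
    moreover have "negligible (\<Union>e\<in>edges T. h ` (e \<inter> ball y d'))"
      using finite_T edge_thin h' by (intro negligible_Union) auto
    ultimately have "negligible (ball (h y) d')" using negligible_subset by blast
    then show False using open_not_negligible[of "ball (h y) d'"] d' by simp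
  qed
qed

text \<open>The union of the closed faces is compact, and it contains the open faces, which are
  dense.\<close>

lemma covering: "M = (\<Union>F\<in>faces T. ch F ` tri F)"
proof
  define K where "K = (\<Union>F\<in>faces T. ch F ` tri F)"
  show "(\<Union>F\<in>faces T. ch F ` tri F) \<subseteq> M" using ch_M by blast
  have "compact K" unfolding K_def
    using finite_T tri_compact ch_cont by (intro compact_UN compact_continuous_image) auto
  then have "openin (top_of_set M) (M - K)"
    using compact_imp_closed by (metis Diff_eq openin_open_Int open_Compl)
  moreover have "y \<in> K" if "y \<in> \<Union>(faces T)" for y
  proof -
    obtain F where F: "F \<in> faces T" "y \<in> F" using \<open>y \<in> _\<close> by blast
    then have "y \<in> ch F ` interior (tri F)" using ch_bij by (auto simp: bij_betw_def)
    then show ?thesis using F interior_subset unfolding K_def by blast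
  qed
  ultimately have "M - K = {}" using faces_dense by blast
  then show "M \<subseteq> (\<Union>F\<in>faces T. ch F ` tri F)" by (simp add: K_def)
qed

lemma lift_point: assumes "x \<in> M" obtains F z where "F \<in> faces T" "z \<in> tri F" "ch F z = x"
  using subsetD[OF equalityD1[OF covering] assms] by blast

text \<open>Since there are finitely many faces, a subsequence lifts to a single triangle, where
  compactness gives a further convergent one. This turns statements about a neighborhood of a point
  of \<open>M\<close> into statements about one triangle.\<close>

lemma lift_sequence:
  fixes x :: "nat \<Rightarrow> 'a"
  assumes x: "\<And>n. x n \<in> M" and lim: "x \<longlonglongrightarrow> l"
  obtains F r z z0 where "F \<in> faces T" "strict_mono (r :: nat \<Rightarrow> nat)" "\<And>n. z n \<in> tri F"
    "\<And>n. ch F (z n) = x (r n)" "z \<longlonglongrightarrow> z0" "z0 \<in> tri F" "ch F z0 = l"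
proof -
  have "\<forall>n. \<exists>F w. F \<in> faces T \<and> w \<in> tri F \<and> ch F w = x n" using x lift_point by metis
  then obtain G w where G: "\<And>n. G n \<in> faces T" "\<And>n. w n \<in> tri (G n)" "\<And>n. ch (G n) (w n) = x n"
    by metis
  have "finite (range G)" using finite_T(2) G(1) by (meson finite_subset image_subsetI)
  then obtain n0 where "infinite {n. G n = G n0}"
    using pigeonhole_infinite[of UNIV G] by auto
  then obtain r0 :: "nat \<Rightarrow> nat" where r0: "strict_mono r0" "\<And>n. r0 n \<in> {n. G n = G n0}"
    using infinite_enumerate by blast
  define F where "F = G n0"
  have F: "F \<in> faces T" using G by (simp add: F_def)
  have w: "\<And>n. w (r0 n) \<in> tri F" using G(2) r0(2) by (metis F_def mem_Collect_eq)
  have cw: "ch F (w (r0 n)) = x (r0 n)" for n using G(3)[of "r0 n"] r0(2)[of n] by (simp add: F_def)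
  obtain z0 r1 where z0: "z0 \<in> tri F" "strict_mono (r1 :: nat \<Rightarrow> nat)" "((\<lambda>n. w (r0 n)) \<circ> r1) \<longlonglongrightarrow> z0"
    using seq_compactE[OF compact_imp_seq_compact[OF tri_compact[OF F]], of "\<lambda>n. w (r0 n)"] w by blast
  define z where "z n = w (r0 (r1 n))" for n
  define r where "r = r0 \<circ> r1"
  have r: "strict_mono r" using strict_mono_o[OF r0(1) z0(2)] by (simp add: r_def)
  have z: "z n \<in> tri F" "ch F (z n) = x (r n)" for n using w cw by (auto simp: z_def r_def)
  have zl: "z \<longlonglongrightarrow> z0" using z0(3) by (simp add: z_def[abs_def] o_def)
  have "(\<lambda>n. ch F (z n)) \<longlonglongrightarrow> ch F z0"
    by (rule continuous_on_tendsto_compose[OF ch_cont[OF F] zl z0(1)]) (use z(1) in simp)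
  moreover have "(\<lambda>n. ch F (z n)) \<longlonglongrightarrow> l" using LIMSEQ_subseq_LIMSEQ[OF lim r] z(2) by (simp add: o_def)
  ultimately have "ch F z0 = l" using LIMSEQ_unique by blast
  then show thesis using that[OF F r z(1) z(2) zl z0(1)] by blast
qed

text \<open>Points sufficiently near \<open>x\<close> share a closed face with \<open>x\<close> and
  have the same distance from it there. Otherwise a sequence of exceptions tends to
  \<open>x\<close>; lifted to one triangle, it runs into the region where the chart is
  isometric.\<close>

lemma star:
  assumes x: "x \<in> M" "x \<notin> Sing M"
  obtains e where "e > 0" "\<And>y. y \<in> M \<Longrightarrow> dist x y < e \<Longrightarrow>
     \<exists>F z w. F \<in> faces T \<and> z \<in> tri F \<and> w \<in> tri F \<and> ch F z = x \<and> ch F w = y \<and> dist z w = dist x y"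
proof (rule ccontr)
  define P where "P y \<longleftrightarrow> (\<exists>F z w. F \<in> faces T \<and> z \<in> tri F \<and> w \<in> tri F \<and> ch F z = x \<and> ch F w = y \<and>
    dist z w = dist x y)" for y
  assume "\<not> thesis"
  then have "\<forall>e>0. \<exists>y. y \<in> M \<and> dist x y < e \<and> \<not> P y" using that unfolding P_def by blast
  then have "\<forall>n. \<exists>y. y \<in> M \<and> dist x y < inverse (real (Suc n)) \<and> \<not> P y" by simp
  then obtain y where y: "\<And>n. y n \<in> M" "\<And>n. dist x (y n) < inverse (real (Suc n))" "\<And>n. \<not> P (y n)"
    by metis
  have "y \<longlonglongrightarrow> x"
  proof (rule metric_LIMSEQ_I)
    fix s :: real assume "0 < s"
    then obtain N where N: "inverse (real (Suc N)) < s" using reals_Archimedean by blast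
    have "dist (y n) x < s" if "n \<ge> N" for n
    proof -
      have "inverse (real (Suc n)) \<le> inverse (real (Suc N))" using that by (intro le_imp_inverse_le) auto
      then show ?thesis using N y(2)[of n] dist_commute[of x "y n"] by linarith
    qed
    then show "\<exists>N. \<forall>n\<ge>N. dist (y n) x < s" by blast
  qed
  then obtain F r z z0 where F: "F \<in> faces T" "strict_mono (r :: nat \<Rightarrow> nat)" "\<And>n. z n \<in> tri F"
    "\<And>n. ch F (z n) = y (r n)" "z \<longlonglongrightarrow> z0" "z0 \<in> tri F" "ch F z0 = x"
    by (rule lift_sequence[of y x, OF y(1)]) blast
  obtain e where e: "e > 0" "\<And>y w. y \<in> tri F \<Longrightarrow> w \<in> tri F \<Longrightarrow> dist z0 y < e \<Longrightarrow> dist z0 w < e \<Longrightarrow>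
     dist (ch F y) (ch F w) = dist y w"
    by (rule local_isometry[OF F(1,6)]) (use F(7) x in blast)+
  obtain n where "dist (z n) z0 < e" using metric_LIMSEQ_D[OF F(5) e(1)] by blast
  then have "dist z0 (z n) = dist x (y (r n))"
    using e(2)[OF F(6) F(3), of n] e(1) F(4,7) by (simp add: dist_commute)
  then have "P (y (r n))" unfolding P_def using F by blast
  then show False using y(3) by blast
qed

end

section \<open>The two sides of an edge\<close>

lemma hgt_on_side:
  assumes nc: "\<not> collinear {a, b, c :: real^2}" and y: "y \<in> open_segment a b"
  shows "hgt a b c y = 0" "hgt a b c w = (w - y) \<bullet> inn a b c"
proof -
  show "hgt a b c y = 0" 
    using y in_side_iff[OF nc, of y] hgt_c[OF nc] by (simp add: bw_def)
  then show "hgt a b c w = (w - y) \<bullet> inn a b c" by (simp add: hgt_def inner_diff_left)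
qed

lemma sides_disjoint:
  assumes nc: "\<not> collinear {a, b, c :: real^2}" and y: "y \<in> open_segment a b" "y \<in> open_segment a' b'"
    and eq: "{a', b', c'} = {a, b, c}"
  shows "open_segment a b = open_segment a' b'"
proof -
  have b: "bw a b c y = 0" "0 < bw b c a y" "0 < bw a c b y"
    using y(1) by (simp_all add: in_side_iff[OF nc])
  have n: "y \<notin> open_segment b c" "y \<notin> open_segment c a"
    using in_side_iff[of b c a y] in_side_iff[of c a b y] nc b
    by (simp_all add: insert_commute bw_sym[of c a])
  have nc': "\<not> collinear {a', b', c'}" using nc eq by simp
  have "a' \<in> {a, b, c}" "b' \<in> {a, b, c}" "a' \<noteq> b'"
    using eq noncollinear_distinct[OF nc'] by blast+
  then show ?thesis using n y(2) by (auto simp: open_segment_commute)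
qed

lemma unit_vectors_opposite:
  fixes N N' :: "'b::real_inner"
  assumes "norm N = 1" "norm N' = 1" and orth: "\<And>w. w \<bullet> N' = 0 \<Longrightarrow> w \<bullet> N = 0"
  shows "N' = N \<or> N' = - N"
proof -
  have 1: "N \<bullet> N = 1" "N' \<bullet> N' = 1" using assms by (auto simp: norm_eq_sqrt_inner)
  define k where "k = N \<bullet> N'"
  have "(N - k *\<^sub>R N') \<bullet> N' = 0" using 1 by (simp add: inner_diff_left k_def)
  then have "(N - k *\<^sub>R N') \<bullet> N = 0" by (rule orth)
  then have "N \<bullet> N - k * (N' \<bullet> N) = 0" by (simp only: inner_diff_left inner_scaleR_left)
  then have "1 - k * k = 0" using 1 by (simp add: k_def inner_commute)
  then have k: "k = 1 \<or> k = -1" using square_eq_1_iff[of k] by simp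
  have "(N - k *\<^sub>R N') \<bullet> (N - k *\<^sub>R N') = 0"
    using \<open>(N - k *\<^sub>R N') \<bullet> N' = 0\<close> \<open>(N - k *\<^sub>R N') \<bullet> N = 0\<close>
    by (simp only: inner_diff_right inner_scaleR_right)
  then have "N = k *\<^sub>R N'" by simp
  then show ?thesis using k by (elim disjE) simp_all
qed

section \<open>Half-discs at the points of an edge\<close>

context triangulated
begin

text \<open>
  \<open>A\<close> places the face \<open>F\<close> near the point \<open>y\<close> of its side \<open>ab\<close> into the plane of the disc chart \<open>h\<close>.
\<close>

definition side_chart ::
    "'a set \<Rightarrow> real^2 \<Rightarrow> real^2 \<Rightarrow> real^2 \<Rightarrow> real^2 \<Rightarrow> ('a \<Rightarrow> real^2) \<Rightarrow> real \<Rightarrow> (real^2 \<Rightarrow> real^2) \<Rightarrow> bool" where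
  "side_chart F a b c y h e A \<longleftrightarrow> corner F a b c \<and> y \<in> open_segment a b \<and> rigid A \<and>
     disc_chart M (ch F y) e h \<and>
     (\<forall>w. dist y w < e \<longrightarrow>
        (w \<in> tri F \<longleftrightarrow> 0 \<le> hgt a b c w) \<and> (w \<in> interior (tri F) \<longleftrightarrow> 0 < hgt a b c w) \<and>
        (w \<in> open_segment a b \<longleftrightarrow> hgt a b c w = 0) \<and>
        (w \<in> tri F \<longrightarrow> ch F w \<in> M \<and> dist (ch F y) (ch F w) = dist y w \<and> h (ch F w) = A w))"

lemma side_chart_shrink:
  assumes "side_chart F a b c y h e A" "0 < e'" "e' \<le> e"
  shows "side_chart F a b c y h e' A"
proof -
  have "disc_chart M (ch F y) e' h"
    using assms disc_chart_shrink unfolding side_chart_def by blast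
  then show ?thesis using assms unfolding side_chart_def by (meson less_le_trans)
qed

lemma side_chart_ex:
  assumes c: "corner F a b c" and y: "y \<in> open_segment a b" and h: "disc_chart M (ch F y) d h"
  obtains e A where "0 < e" "e \<le> d" "side_chart F a b c y h e A"
proof -
  note F = corner_face[OF c]
  have yt: "y \<in> tri F" using corner_props(5)[OF c] y by blast
  obtain e1 A where e1: "0 < e1" "e1 \<le> d" and A: "rigid A" and w1: "\<And>w. w \<in> tri F \<Longrightarrow> dist y w < e1 \<Longrightarrow>
     dist (ch F y) (ch F w) = dist y w \<and> h (ch F w) = A w"
    using in_disc_chart[OF F yt h] by blast
  obtain e2 where e2: "0 < e2" and w2: "\<forall>z\<in>ball y e2.
     (z \<in> convex hull {a, b, c} \<longleftrightarrow> 0 \<le> hgt a b c z) \<and>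
     (z \<in> interior (convex hull {a, b, c}) \<longleftrightarrow> 0 < hgt a b c z) \<and>
     (z \<in> open_segment a b \<longleftrightarrow> hgt a b c z = 0)"
    using triangle_near_side[OF corner_nc[OF c] y] by blast
  define e where "e = min e1 e2"
  have e: "0 < e" "e \<le> d" "e \<le> e1" "e \<le> e2" using e1 e2 by (auto simp: e_def)
  have "side_chart F a b c y h e A"
    unfolding side_chart_def
  proof (intro conjI allI impI)
    show "disc_chart M (ch F y) e h" by (rule disc_chart_shrink[OF h e(1,2)])
    fix w assume w: "dist y w < e"
    then have wb: "w \<in> ball y e2" using e by simp
    show "w \<in> tri F \<longleftrightarrow> 0 \<le> hgt a b c w" "w \<in> interior (tri F) \<longleftrightarrow> 0 < hgt a b c w"
      "w \<in> open_segment a b \<longleftrightarrow> hgt a b c w = 0"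
      using w2 wb unfolding corner_tri[OF c] by blast+
    assume wt: "w \<in> tri F"
    show "ch F w \<in> M" using ch_M[OF F wt] .
    have "dist y w < e1" using w e by simp
    then show "dist (ch F y) (ch F w) = dist y w" "h (ch F w) = A w" using w1[OF wt] by blast+
  qed (use c y A in auto)
  then show thesis using that e by blast
qed

lemma side_chart_basic:
  assumes s: "side_chart F a b c y h e A"
  shows "0 < e" "rigid A" "corner F a b c" "y \<in> open_segment a b" "A y = h (ch F y)"
    "norm (lin A (inn a b c)) = 1" "disc_chart M (ch F y) e h"
    "hgt a b c w = (A w - h (ch F y)) \<bullet> lin A (inn a b c)"
proof -
  show A: "rigid A" and c: "corner F a b c" and y: "y \<in> open_segment a b" and h: "disc_chart M (ch F y) e h"
    using s by (auto simp: side_chart_def)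
  show e: "0 < e" using disc_chart_pos[OF h] by simp
  have "y \<in> tri F" using corner_props(5)[OF c] y by blast
  moreover have "dist y y < e" using e by simp
  ultimately show Ay: "A y = h (ch F y)" using s unfolding side_chart_def by metis
  show "norm (lin A (inn a b c)) = 1" using lin_norm[OF A] inn_norm[OF corner_nc[OF c]] by simp
  show "hgt a b c w = (A w - h (ch F y)) \<bullet> lin A (inn a b c)"
    unfolding Ay[symmetric] lin_diff[OF A] lin_inner[OF A]
    using hgt_on_side(2)[OF corner_nc[OF c] y] .
qed

text \<open>The converse to placing the face: every point of the half-disc on the inner side of the
  line comes from the triangle, so \<open>F\<close> fills that half-disc.\<close>

lemma side_chart_point:
  assumes s: "side_chart F a b c y h e A" and z: "dist (h (ch F y)) z < e"
    and u: "0 \<le> (z - h (ch F y)) \<bullet> lin A (inn a b c)"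
  shows "inv A z \<in> tri F" "ch F (inv A z) \<in> M" "h (ch F (inv A z)) = z"
    "dist (ch F y) (ch F (inv A z)) = dist (h (ch F y)) z"
    "0 < (z - h (ch F y)) \<bullet> lin A (inn a b c) \<Longrightarrow> inv A z \<in> interior (tri F) \<and> ch F (inv A z) \<in> F"
    "(z - h (ch F y)) \<bullet> lin A (inn a b c) = 0 \<Longrightarrow> inv A z \<in> open_segment a b"
proof -
  note b = side_chart_basic[OF s]
  define w where "w = inv A z"
  have Aw: "A w = z" using b(2) by (simp add: w_def)
  have d: "dist y w = dist (h (ch F y)) z" using rigidD[OF b(2), of y w] Aw b(5) by simp
  have hw: "hgt a b c w = (z - h (ch F y)) \<bullet> lin A (inn a b c)" using b(8)[of w] Aw by simp
  have *: "(w \<in> tri F \<longleftrightarrow> 0 \<le> hgt a b c w) \<and> (w \<in> interior (tri F) \<longleftrightarrow> 0 < hgt a b c w) \<and>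
        (w \<in> open_segment a b \<longleftrightarrow> hgt a b c w = 0) \<and>
        (w \<in> tri F \<longrightarrow> ch F w \<in> M \<and> dist (ch F y) (ch F w) = dist y w \<and> h (ch F w) = A w)"
    using s z d unfolding side_chart_def by simp
  show "inv A z \<in> tri F" using * u hw by (simp add: w_def[symmetric])
  then show "ch F (inv A z) \<in> M" "h (ch F (inv A z)) = z"
    "dist (ch F y) (ch F (inv A z)) = dist (h (ch F y)) z"
    using * d Aw by (simp_all add: w_def[symmetric])
  show "0 < (z - h (ch F y)) \<bullet> lin A (inn a b c) \<Longrightarrow> inv A z \<in> interior (tri F) \<and> ch F (inv A z) \<in> F"
    using * hw ch_bij[OF corner_face[OF b(3)]] unfolding w_def[symmetric] by (auto simp: bij_betw_def)
  show "(z - h (ch F y)) \<bullet> lin A (inn a b c) = 0 \<Longrightarrow> inv A z \<in> open_segment a b"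
    using * hw by (simp add: w_def[symmetric])
qed

text \<open>The line of one half-disc cannot enter the other open half-disc, because edges do not
  meet faces; so the normals are parallel. Equal normals would give the same half-disc, hence the
  same face and the same side.\<close>

lemma sides_opposite:
  assumes s: "side_chart F a b c y h e A" and s': "side_chart F' a' b' c' y' h e A'"
    and eq: "ch F y = ch F' y'" and ne: "(F, open_segment a b) \<noteq> (F', open_segment a' b')"
  shows "lin A' (inn a' b' c') = - lin A (inn a b c)"
proof -
  note b = side_chart_basic[OF s] and b' = side_chart_basic[OF s']
  define N where "N = lin A (inn a b c)"
  define N' where "N' = lin A' (inn a' b' c')"
  define o' where "o' = h (ch F y)"
  note p = side_chart_point[OF s, folded N_def o'_def]
  note p' = side_chart_point[OF s', folded eq, folded N'_def o'_def]
  have same: "ch F (inv A z) = ch F' (inv A' z)"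
    if "dist o' z < e" "0 \<le> (z - o') \<bullet> N" "0 \<le> (z - o') \<bullet> N'" for z
  proof (rule disc_chart_inj[OF b(7)])
    show "ch F (inv A z) \<in> M" "ch F' (inv A' z) \<in> M" using p(2) p'(2) that by blast+
    show "dist (ch F y) (ch F (inv A z)) < e" using p(4)[of z] that by simp
    show "dist (ch F y) (ch F' (inv A' z)) < e" using p'(4)[of z] that by simp
    show "h (ch F (inv A z)) = h (ch F' (inv A' z))" using p(3)[of z] p'(3)[of z] that by simp
  qed
  \<comment> \<open>A point of the second side lying in the open first half-disc would belong both
    to an edge and to a face.\<close>
  have le: "w \<bullet> N \<le> 0" if w: "w \<bullet> N' = 0" for w
  proof (rule ccontr)
    assume wN: "\<not> w \<bullet> N \<le> 0"
    obtain t where t: "t > 0" "norm (t *\<^sub>R w) < e" using small_multiple[OF b(1), of w] by blast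
    define z where "z = o' + t *\<^sub>R w"
    have z: "dist o' z < e" "(z - o') \<bullet> N' = 0" "0 < (z - o') \<bullet> N"
      using t w wN by (simp_all add: z_def dist_norm)
    have "ch F (inv A z) \<in> F" using p(5)[of z] z by simp
    moreover have "inv A' z \<in> open_segment a' b'" using p'(6)[of z] z by simp
    then have "ch F' (inv A' z) \<in> ch F' ` open_segment a' b'" by blast
    moreover have "ch F (inv A z) = ch F' (inv A' z)" using same[of z] z by simp
    ultimately show False
      using edge_face[OF corner_props(1)[OF b'(3)] corner_face[OF b(3)]] by simp
  qed
  have orth: "w \<bullet> N = 0" if "w \<bullet> N' = 0" for w
    using le[of w] le[of "- w"] that by simp
  have n: "norm N = 1" "norm N' = 1" using b(6) b'(6) by (simp_all add: N_def N'_def)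
  \<comment> \<open>With equal normals the open half-discs coincide. The charts then agree on an
    open set, by injectivity on the interior of the triangle, and \<open>y\<close> and
    \<open>y'\<close> are the same point of the same side.\<close>
  have "N' \<noteq> N"
  proof
    assume NN: "N' = N"
    define S where "S = {z. dist o' z < e \<and> 0 < (z - o') \<bullet> N}"
    have oS: "open S"
    proof -
      have "S = ball o' e \<inter> {z. 0 < (z - o') \<bullet> N}" by (auto simp: S_def)
      moreover have "open {z. 0 < (z - o') \<bullet> N}"
        by (intro open_Collect_less continuous_intros)
      ultimately show ?thesis by auto
    qed
    have NN1: "N \<bullet> N = 1" using n by (simp add: norm_eq_sqrt_inner)
    have mS: "o' + (e/2) *\<^sub>R N \<in> S" using b(1) n NN1 by (simp add: S_def dist_norm)
    have FF: "F = F'"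
    proof -
      obtain z where z: "z \<in> S" using mS by blast
      then have "ch F (inv A z) \<in> F" "ch F' (inv A' z) \<in> F'" using p(5)[of z] p'(5)[of z] NN by (auto simp: S_def)
      moreover have "ch F (inv A z) = ch F' (inv A' z)" using same[of z] z NN by (simp add: S_def)
      ultimately show ?thesis using faces_eq corner_face[OF b(3)] corner_face[OF b'(3)] by metis
    qed
    have "inv A z = inv A' z" if z: "z \<in> S" for z
    proof -
      have "inv A z \<in> interior (tri F)" "inv A' z \<in> interior (tri F)"
        using p(5)[of z] p'(5)[of z] NN z FF by (auto simp: S_def)
      moreover have "ch F (inv A z) = ch F (inv A' z)" using same[of z] z NN FF by (simp add: S_def)
      moreover have "inj_on (ch F) (interior (tri F))"
        using ch_bij[OF corner_face[OF b(3)]] by (simp add: bij_betw_def)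
      ultimately show ?thesis by (simp add: inj_on_def)
    qed
    then have "inv A = inv A'"
      using mS by (intro rigid_eq_on_open[OF rigid_inv[OF b(2)] rigid_inv[OF b'(2)] oS]) auto
    moreover have "y = inv A o'" "y' = inv A' o'"
      using b(2,5) b'(2,5) eq by (metis o'_def rigid_inv_f)+
    ultimately have yy: "y' = y" by simp
    have "{a', b', c'} = {a, b, c}" using b(3) b'(3) FF by (simp add: corner_def)
    then have "open_segment a b = open_segment a' b'"
      using sides_disjoint[OF corner_nc[OF b(3)] b(4)] b'(4) yy by simp
    then show False using ne FF by simp
  qed
  then have "N' = - N" using unit_vectors_opposite[OF n orth] by blast
  then show ?thesis by (simp add: N_def N'_def)
qed

lemma common_side_chart:
  assumes c: "corner F a b c" "y \<in> open_segment a b" and c': "corner F' a' b' c'" "y' \<in> open_segment a' b'"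
    and eq: "ch F y = ch F' y'" and h: "disc_chart M (ch F y) d h"
  obtains e A A' where "0 < e" "e \<le> d" "side_chart F a b c y h e A" "side_chart F' a' b' c' y' h e A'"
proof -
  obtain e1 A where 1: "0 < e1" "e1 \<le> d" "side_chart F a b c y h e1 A" by (rule side_chart_ex[OF c h])
  have h': "disc_chart M (ch F' y') d h" using h eq by simp
  obtain e2 A' where 2: "0 < e2" "e2 \<le> d" "side_chart F' a' b' c' y' h e2 A'" by (rule side_chart_ex[OF c' h'])
  have "0 < min e1 e2" "min e1 e2 \<le> d" "side_chart F a b c y h (min e1 e2) A"
    "side_chart F' a' b' c' y' h (min e1 e2) A'"
    using 1 2 side_chart_shrink[OF 1(3), of "min e1 e2"] side_chart_shrink[OF 2(3), of "min e1 e2"] by auto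
  then show thesis by (rule that)
qed

text \<open>Approach \<open>x\<close> through the half-disc that the given side leaves free; a
  subsequence lifts to one triangle. If its limit were on the same side, the lifted points would
  have nonnegative height and could not lie in the free half-disc.\<close>

lemma second_side:
  assumes c: "corner F a b c" and y: "y \<in> open_segment a b"
  obtains F' a' b' c' y' where "corner F' a' b' c'" "y' \<in> open_segment a' b'" "ch F' y' = ch F y"
    "(F, open_segment a b) \<noteq> (F', open_segment a' b')"
proof -
  define x where "x = ch F y"
  note F = corner_face[OF c]
  have xe: "x \<in> ch F ` open_segment a b" using y by (simp add: x_def)
  note e = corner_props(1)[OF c]
  have xM: "x \<in> M" "x \<notin> Sing M" using edge_sing[OF e xe] by auto
  obtain d0 h where h0: "disc_chart M (ch F y) d0 h" using disc_chart_ex xM unfolding x_def by blast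
  obtain d A where s: "side_chart F a b c y h d A" using side_chart_ex[OF c y h0] by blast
  note b = side_chart_basic[OF s]
  define N where "N = lin A (inn a b c)"
  have NN: "N \<bullet> N = 1" "norm N = 1" using b(6) by (simp_all add: N_def norm_eq_sqrt_inner)
  \<comment> \<open>Points on the outer normal; the summand 2 keeps them strictly inside the chart
    for every \<open>n\<close>.\<close>
  define z where "z n = h x - (d / (2 + real n)) *\<^sub>R N" for n :: nat
  have dz: "dist (h x) (z n) = d / (2 + real n)" for n
    using b(1) NN by (simp add: z_def dist_norm)
  have dlt: "d / (2 + real n) < d" for n using b(1) by (simp add: divide_less_eq)
  have "\<exists>p. p \<in> M \<and> dist x p = d / (2 + real n) \<and> h p = z n" for n
  proof -
    have "z n \<in> ball (h (ch F y)) d" using dz[of n] dlt[of n] by (simp add: x_def)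
    then obtain p where "p \<in> M" "dist (ch F y) p = dist (h (ch F y)) (z n)" "h p = z n"
      by (rule disc_chart_surj[OF b(7) _ order_refl])
    then show ?thesis using dz[of n] by (auto simp: x_def)
  qed
  then obtain p where p: "\<And>n. p n \<in> M" "\<And>n. dist x (p n) = d / (2 + real n)" "\<And>n. h (p n) = z n" by metis
  have "p \<longlonglongrightarrow> x"
  proof (rule metric_LIMSEQ_I)
    fix r :: real assume r: "0 < r"
    obtain n0 :: nat where n0: "d / r < real n0" using reals_Archimedean2 by blast
    have "dist (p n) x < r" if "n \<ge> n0" for n
    proof -
      have "d / r < 2 + real n" using n0 that by linarith
      then have "d / (2 + real n) < r" using r by (simp add: divide_less_eq mult.commute)
      then show ?thesis using p(2)[of n] by (simp add: dist_commute)
    qed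
    then show "\<exists>n0. \<forall>n\<ge>n0. dist (p n) x < r" by blast
  qed
  then obtain F' r w w0 where F': "F' \<in> faces T" "strict_mono (r :: nat \<Rightarrow> nat)" "\<And>n. w n \<in> tri F'"
    "\<And>n. ch F' (w n) = p (r n)" "w \<longlonglongrightarrow> w0" "w0 \<in> tri F'" "ch F' w0 = x"
    by (rule lift_sequence[of p x, OF p(1)]) blast
  have "ch F' w0 \<in> ch F ` open_segment a b" using F'(7) xe by simp
  then obtain a' b' c' where c': "corner F' a' b' c'" "w0 \<in> open_segment a' b'"
    using ch_in_edge[OF F'(1,6) e] by blast
  have "(F, open_segment a b) \<noteq> (F', open_segment a' b')"
  proof
    assume eq: "(F, open_segment a b) = (F', open_segment a' b')"
    then have SS: "open_segment a b = open_segment a' b'" and FF: "F = F'" by (blast dest: Pair_inject)+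
    have "w0 \<in> open_segment a b" unfolding SS by (rule c'(2))
    moreover have "ch F w0 = ch F y" using F'(7) FF by (simp add: x_def)
    ultimately have "w0 = y" using inj_onD[OF corner_props(2)[OF c], of w0 y] y by blast
    then obtain n where n: "dist (w n) y < d" using metric_LIMSEQ_D[OF F'(5) b(1)] by blast
    have wt: "w n \<in> tri F" using F'(3) FF by simp
    have "0 \<le> hgt a b c (w n)" "h (ch F (w n)) = A (w n)"
      using s n wt unfolding side_chart_def by (metis dist_commute)+
    moreover have "h (ch F (w n)) = z (r n)" using F'(4)[of n] p(3)[of "r n"] FF by simp
    ultimately have "0 \<le> (z (r n) - h x) \<bullet> N" using b(8)[of "w n"] by (simp add: N_def x_def)
    then have "0 \<le> - (d / (2 + real (r n)))" using NN by (simp add: z_def)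
    moreover have "0 < d / (2 + real (r n))" using b(1) by simp
    ultimately show False by linarith
  qed
  then show thesis using that[OF c'] F'(7) by (simp add: x_def)
qed

text \<open>Three unit normals cannot be pairwise opposite.\<close>

lemma at_most_two_sides:
  assumes c: "corner F a b c" "y \<in> open_segment a b" and c': "corner F' a' b' c'" "y' \<in> open_segment a' b'"
    and c'': "corner F'' a'' b'' c''" "y'' \<in> open_segment a'' b''"
    and eq: "ch F y = ch F' y'" "ch F y = ch F'' y''"
    and ne: "(F, open_segment a b) \<noteq> (F', open_segment a' b')"
      "(F, open_segment a b) \<noteq> (F'', open_segment a'' b'')"
  shows "(F', open_segment a' b') = (F'', open_segment a'' b'')"
proof (rule ccontr)
  assume ne3: "(F', open_segment a' b') \<noteq> (F'', open_segment a'' b'')"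
  have "ch F y \<in> ch F ` open_segment a b" using c by blast
  then have "ch F y \<in> M \<and> ch F y \<notin> Sing M" by (rule edge_sing[OF corner_props(1)[OF c(1)]])
  then obtain d h where h: "disc_chart M (ch F y) d h" using disc_chart_ex by blast
  obtain e A A' where e: "0 < e" "e \<le> d" and s: "side_chart F a b c y h e A" "side_chart F' a' b' c' y' h e A'"
    by (rule common_side_chart[OF c c' eq(1) h])
  have h'': "disc_chart M (ch F'' y'') e h" using disc_chart_shrink[OF h e] eq by simp
  obtain e2 A'' where e2: "0 < e2" "e2 \<le> e" and s'': "side_chart F'' a'' b'' c'' y'' h e2 A''"
    by (rule side_chart_ex[OF c'' h''])
  note s2 = side_chart_shrink[OF s(1) e2] side_chart_shrink[OF s(2) e2]
  have "lin A' (inn a' b' c') = - lin A (inn a b c)" by (rule sides_opposite[OF s2 eq(1) ne(1)])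
  moreover have "lin A'' (inn a'' b'' c'') = - lin A (inn a b c)" by (rule sides_opposite[OF s2(1) s'' eq(2) ne(2)])
  moreover have "lin A'' (inn a'' b'' c'') = - lin A' (inn a' b' c')"
    using sides_opposite[OF s2(2) s'' _ ne3] eq by simp
  ultimately have "lin A (inn a b c) = 0" by (simp add: eq_neg_iff_add_eq_0 flip: scaleR_2)
  then show False using side_chart_basic(6)[OF s(1)] by simp
qed

text \<open>\<open>c\<close> and \<open>c'\<close> are the corners opposite the common edge.
  Comparing pairs of face and segment allows \<open>F = F'\<close>, a face glued to itself along two
  different sides.\<close>

definition adjacent where
  "adjacent F a b c F' a' b' c' \<longleftrightarrow> corner F a b c \<and> corner F' a' b' c' \<and>
     ch F ` open_segment a b = ch F' ` open_segment a' b' \<and>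
     (F, open_segment a b) \<noteq> (F', open_segment a' b')"

lemma adjacent_ex:
  assumes c: "corner F a b c"
  obtains F' a' b' c' where "adjacent F a b c F' a' b' c'"
proof -
  have "a \<noteq> b" using corner_distinct[OF c] by blast
  then obtain y where y: "y \<in> open_segment a b" using open_segment_eq_empty[of a b] by blast
  obtain F' a' b' c' y' where c': "corner F' a' b' c'" "y' \<in> open_segment a' b'" "ch F' y' = ch F y"
    and ne: "(F, open_segment a b) \<noteq> (F', open_segment a' b')" by (rule second_side[OF c y])
  have "ch F ` open_segment a b = ch F' ` open_segment a' b'"
  proof (rule edges_eq[OF corner_props(1)[OF c] corner_props(1)[OF c'(1)]])
    show "ch F y \<in> ch F ` open_segment a b" using y by blast
    show "ch F y \<in> ch F' ` open_segment a' b'" unfolding c'(3)[symmetric] using c'(2) by (rule imageI)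
  qed
  then have "adjacent F a b c F' a' b' c'" using c c' ne by (simp add: adjacent_def)
  then show thesis by (rule that)
qed

lemma adjacent_unique:
  assumes a: "adjacent F a b c F' a' b' c'" and c: "corner F'' a'' b'' c''"
    and eq: "ch F'' ` open_segment a'' b'' = ch F ` open_segment a b"
  shows "(F'', open_segment a'' b'') \<in> {(F, open_segment a b), (F', open_segment a' b')}"
proof -
  have co: "corner F a b c" "corner F' a' b' c'" and im: "ch F ` open_segment a b = ch F' ` open_segment a' b'"
    and ne: "(F, open_segment a b) \<noteq> (F', open_segment a' b')" using a by (auto simp: adjacent_def)
  have "a \<noteq> b" using corner_distinct[OF co(1)] by blast
  then obtain y where y: "y \<in> open_segment a b" using open_segment_eq_empty[of a b] by blast
  obtain y' where y': "y' \<in> open_segment a' b'" "ch F y = ch F' y'" using im y by blast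
  obtain y'' where y'': "y'' \<in> open_segment a'' b''" "ch F y = ch F'' y''" using eq y by blast
  show ?thesis
    using at_most_two_sides[OF co(1) y co(2) y'(1) c y''(1) y'(2) y''(2) ne] by blast
qed

lemma edge_adjacent:
  assumes e: "e \<in> edges T" "x \<in> e"
  obtains F a b c F' a' b' c' where "adjacent F a b c F' a' b' c'" "ch F ` open_segment a b = e"
proof -
  have "x \<in> M" using edge_sing[OF e] by blast
  then obtain F z where F: "F \<in> faces T" "z \<in> tri F" "ch F z = x" by (rule lift_point)
  then have "ch F z \<in> e" using e by simp
  then obtain a b c where "corner F a b c" "ch F ` open_segment a b = e"
    using ch_in_edge[OF F(1,2) e(1)] by blast
  then show thesis using adjacent_ex that by metis
qed

text \<open>
  Unfolding two adjacent faces into one plane; the isometry is found locally along the edge and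
  is locally constant there.
\<close>

lemma gluing:
  assumes adj: "adjacent F a b c F' a' b' c'"
  obtains R where "rigid R" "lin R (inn a b c) = - inn a' b' c'"
    "R a = a' \<and> R b = b' \<or> R a = b' \<and> R b = a'"
    "\<And>y. y \<in> closed_segment a b \<Longrightarrow> ch F' (R y) = ch F y"
proof -
  have c: "corner F a b c" and c': "corner F' a' b' c'" and im: "ch F ` open_segment a b = ch F' ` open_segment a' b'"
    and ne: "(F, open_segment a b) \<noteq> (F', open_segment a' b')" using adj by (auto simp: adjacent_def)
  define S where "S = open_segment a b"
  define S' where "S' = open_segment a' b'"
  define n where "n = inn a b c"
  define n' where "n' = inn a' b' c'"
  have inj': "inj_on (ch F') S'" using corner_props(2)[OF c'] by (simp add: S'_def)
  \<comment> \<open>Near \<open>y\<close>, such an \<open>R\<close> is the transition map along the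
    edge. This determines it up to reflection in the line of the edge; prescribing the image of the
    normal removes the ambiguity.\<close>
  define good where "good y R \<longleftrightarrow> rigid R \<and> lin R n = - n' \<and>
    (\<exists>e>0. \<forall>w\<in>S. dist y w < e \<longrightarrow> R w \<in> S' \<and> ch F' (R w) = ch F w)" for y R
  have good_ex: "\<exists>R. good y R" if y: "y \<in> S" for y
  proof -
    obtain y' where y': "y' \<in> S'" "ch F y = ch F' y'" using im y unfolding S_def S'_def by blast
    have "ch F y \<in> ch F ` open_segment a b" using y S_def by blast
    then have "ch F y \<in> M \<and> ch F y \<notin> Sing M" by (rule edge_sing[OF corner_props(1)[OF c]])
    then obtain d h where h: "disc_chart M (ch F y) d h" using disc_chart_ex by blast
    obtain e A A' where e: "0 < e" "e \<le> d" and s: "side_chart F a b c y h e A"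
      and s': "side_chart F' a' b' c' y' h e A'"
      by (rule common_side_chart[OF c y[unfolded S_def] c' y'(1)[unfolded S'_def] y'(2) h])
    note b = side_chart_basic[OF s] and b' = side_chart_basic[OF s']
    define R where "R = (\<lambda>w. inv A' (A w))"
    have rR: "rigid R" unfolding R_def by (rule rigid_comp[OF rigid_inv[OF b'(2)] b(2)])
    have opp: "lin A' n' = - lin A n" unfolding n_def n'_def by (rule sides_opposite[OF s s' y'(2) ne])
    have "lin R n = lin (inv A') (lin A n)" unfolding R_def by (rule lin_comp[OF rigid_inv[OF b'(2)] b(2)])
    also have "\<dots> = lin (inv A') (- lin A' n')" using opp by simp
    also have "\<dots> = - lin (inv A') (lin A' n')" by (rule lin_minus[OF rigid_inv[OF b'(2)]])
    finally have "lin R n = - n'" by (simp add: lin_inv[OF b'(2)])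
    moreover have "R w \<in> S' \<and> ch F' (R w) = ch F w" if w: "w \<in> S" "dist y w < e" for w
    proof -
      have wt: "w \<in> tri F" using corner_props(5)[OF c] w(1) S_def by blast
      have w1: "ch F w \<in> M" "dist (ch F y) (ch F w) = dist y w" "h (ch F w) = A w" "hgt a b c w = 0"
        using s w wt unfolding side_chart_def S_def by blast+
      have 0: "(A w - h (ch F y)) \<bullet> lin A n = 0" using b(8)[of w] w1(4) by (simp add: n_def)
      then have zz: "(A w - h (ch F' y')) \<bullet> lin A' (inn a' b' c') = 0"
        using opp y'(2) by (simp add: n'_def)
      have d: "dist (h (ch F' y')) (A w) < e" 
        using rigidD[OF b(2), of y w] b(5) w y'(2) by simp
      note p = side_chart_point[OF s' d]
      have "R w \<in> S'" using p(6) zz by (simp add: R_def S'_def)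
      moreover have "ch F' (R w) = ch F w"
      proof (rule disc_chart_inj[OF b(7)])
        show "ch F' (R w) \<in> M" using p(2) zz by (simp add: R_def)
        show "dist (ch F y) (ch F' (R w)) < e" using p(4) zz d y'(2) by (simp add: R_def)
        show "h (ch F' (R w)) = h (ch F w)" using p(3) zz w1 by (simp add: R_def)
      qed (use w1 w in auto)
      ultimately show ?thesis by blast
    qed
    ultimately have "good y R" unfolding good_def using rR e(1) by blast
    then show ?thesis by blast
  qed
  have ab: "a \<noteq> b" using corner_distinct[OF c] by blast
  have nc: "\<not> collinear {a, b, c}" by (rule corner_nc[OF c])
  \<comment> \<open>Agreement along the edge fixes the linear part on \<open>b - a\<close>, the
    condition in \<open>good\<close> fixes it on the normal, and these two directions span the
    plane.\<close>
  have good_unique: "R1 = R2" if y: "y \<in> S" and g: "good y R1" "good y R2" for y R1 R2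
  proof -
    obtain e1 where e1: "e1 > 0" "\<forall>w\<in>S. dist y w < e1 \<longrightarrow> R1 w \<in> S' \<and> ch F' (R1 w) = ch F w"
      using g(1) unfolding good_def by blast
    obtain e2 where e2: "e2 > 0" "\<forall>w\<in>S. dist y w < e2 \<longrightarrow> R2 w \<in> S' \<and> ch F' (R2 w) = ch F w"
      using g(2) unfolding good_def by blast
    obtain e3 where e3: "e3 > 0" "\<forall>z\<in>ball y e3. z \<in> open_segment a b \<longleftrightarrow> hgt a b c z = 0"
      using triangle_near_side[OF nc y[unfolded S_def]] by blast
    have r: "rigid R1" "rigid R2" and n12: "lin R1 n = lin R2 n" using g by (auto simp: good_def)
    have eqS: "R1 w = R2 w" if "w \<in> S" "dist y w < e1" "dist y w < e2" for w
      using e1(2) e2(2) that inj_onD[OF inj'] by metis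
    then have y12: "R1 y = R2 y" using y e1(1) e2(1) by simp
    obtain t where t: "t > 0" "norm (t *\<^sub>R (b - a)) < min e1 (min e2 e3)"
      using small_multiple[of "min e1 (min e2 e3)" "b - a"] e1(1) e2(1) e3(1) by auto
    define w where "w = y + t *\<^sub>R (b - a)"
    have dw: "dist y w < e1" "dist y w < e2" "w \<in> ball y e3" using t by (simp_all add: w_def dist_norm)
    have "hgt a b c w = 0"
      unfolding hgt_on_side(2)[OF nc y[unfolded S_def]] using inn_orth[of a b c] by (simp add: w_def inner_commute)
    then have "w \<in> S" using e3(2) dw(3) by (simp add: S_def)
    then have "R1 w - R1 y = R2 w - R2 y" using eqS dw y12 by simp
    then have "lin R1 (w - y) = lin R2 (w - y)" by (simp only: lin_diff[OF r(1)] lin_diff[OF r(2)])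
    then have u12: "lin R1 (b - a) = lin R2 (b - a)"
      using t(1) by (simp add: w_def lin_scaleR[OF r(1)] lin_scaleR[OF r(2)])
    have "R1 z = R2 z" for z
    proof -
      define u where "u = (1 / norm (b - a)) *\<^sub>R (b - a)"
      have "norm u = 1" "u \<bullet> n = 0"
        using ab inn_orth[of a b c] by (simp_all add: u_def n_def inner_commute)
      then have z: "z - y = ((z - y) \<bullet> u) *\<^sub>R u + ((z - y) \<bullet> n) *\<^sub>R n"
        using inn_norm[OF nc] by (intro orthonormal_expansion) (simp_all add: n_def)
      have "lin R1 u = lin R2 u" using u12 by (simp add: u_def lin_scaleR[OF r(1)] lin_scaleR[OF r(2)])
      then have "lin R1 (z - y) = lin R2 (z - y)"
        by (subst (1 2) z) (simp only: lin_add[OF r(1)] lin_add[OF r(2)] lin_scaleR[OF r(1)] lin_scaleR[OF r(2)] n12)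
      then show ?thesis using rigid_eq[OF r(1), of z y] rigid_eq[OF r(2), of z y] y12 by simp
    qed
    then show ?thesis by blast
  qed
  define G where "G y = (SOME R. good y R)" for y
  have G: "good y (G y)" if "y \<in> S" for y unfolding G_def by (rule someI_ex[OF good_ex[OF that]])
  have const: "G y = G w" if "y \<in> S" "w \<in> S" for y w
  proof (rule connected_local_const[OF _ that])
    show "connected S" unfolding S_def by (simp add: convex_connected)
    show "\<forall>y\<in>S. \<forall>\<^sub>F w in at y within S. G y = G w"
    proof
      fix y assume y: "y \<in> S"
      obtain e where e: "e > 0" "\<forall>w\<in>S. dist y w < e \<longrightarrow> G y w \<in> S' \<and> ch F' (G y w) = ch F w"
        and r: "rigid (G y)" "lin (G y) n = - n'"
        using G[OF y] unfolding good_def by blast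
      have "G y = G w" if w: "w \<in> S" "dist w y < e" for w
      proof (rule good_unique[OF w(1) _ G[OF w(1)]])
        have "G y v \<in> S' \<and> ch F' (G y v) = ch F v" if v: "v \<in> S" "dist w v < e - dist w y" for v
        proof -
          have "dist y v \<le> dist w y + dist w v" using dist_triangle[of y v w] by (simp add: dist_commute)
          then show ?thesis using e(2) v by simp
        qed
        moreover have "0 < e - dist w y" using w by simp
        ultimately show "good w (G y)" unfolding good_def using r by blast
      qed
      then show "\<forall>\<^sub>F w in at y within S. G y = G w" unfolding eventually_at using e(1) by blast
    qed
  qed
  obtain y0 where y0: "y0 \<in> S" using ab open_segment_eq_empty[of a b] unfolding S_def by blast
  define R where "R = G y0"
  have R: "rigid R" "lin R n = - n'" using G[OF y0] by (auto simp: good_def R_def)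
  have RS: "R y \<in> S'" "ch F' (R y) = ch F y" if y: "y \<in> S" for y
  proof -
    have "G y = R" unfolding R_def by (rule const[OF y y0])
    then have "good y R" using G[OF y] by simp
    then show "R y \<in> S'" "ch F' (R y) = ch F y" using y unfolding good_def by auto
  qed
  have "R ` S = S'"
  proof
    show "R ` S \<subseteq> S'" using RS by blast
    show "S' \<subseteq> R ` S"
    proof
      fix w assume w: "w \<in> S'"
      then obtain y where y: "y \<in> S" "ch F' w = ch F y" using im unfolding S_def S'_def by blast
      then have "w = R y" using inj_onD[OF inj', of w "R y"] RS w by simp
      then show "w \<in> R ` S" using y by blast
    qed
  qed
  then have "open_segment (R a) (R b) = open_segment a' b'"
    using rigid_open_segment[OF R(1)] by (simp add: S_def S'_def)
  moreover have "a' \<noteq> b'" using corner_distinct[OF c'] by blast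
  ultimately have "{R a, R b} = {a', b'}" by (simp add: open_segment_eq)
  then have ends: "R a = a' \<and> R b = b' \<or> R a = b' \<and> R b = a'" by (auto simp: doubleton_eq_iff)
  have cl: "closure S = closed_segment a b" unfolding S_def using ab by (simp add: closure_open_segment)
  have sub: "closed_segment a b \<subseteq> tri F" "closed_segment a' b' \<subseteq> tri F'"
    using corner_props(4)[OF c] corner_props(4)[OF c'] by blast+
  have Rsub: "R ` closure S \<subseteq> tri F'"
  proof -
    have "R ` closure S \<subseteq> closed_segment a' b'"
    proof (rule image_closure_subset[OF rigid_continuous[OF R(1)] closed_segment])
      show "R ` S \<subseteq> closed_segment a' b'"
        using RS(1) segment_open_subset_closed[of a' b'] by (auto simp: S'_def)
    qed
    then show ?thesis using sub(2) by blast
  qed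
  have "ch F' (R y) = ch F y" if y: "y \<in> closed_segment a b" for y
  proof -
    have "dist (ch F' (R y)) (ch F y) = 0"
    proof (rule continuous_constant_on_closure[of S "\<lambda>y. dist (ch F' (R y)) (ch F y)"])
      show "continuous_on (closure S) (\<lambda>y. dist (ch F' (R y)) (ch F y))"
      proof (rule continuous_on_dist)
        show "continuous_on (closure S) (\<lambda>y. ch F' (R y))"
          by (rule continuous_on_compose2[OF ch_cont[OF corner_face[OF c']] rigid_continuous[OF R(1)] Rsub])
        show "continuous_on (closure S) (ch F)"
          by (rule continuous_on_subset[OF ch_cont[OF corner_face[OF c]]]) (simp add: cl sub)
      qed
      show "dist (ch F' (R x)) (ch F x) = 0" if "x \<in> S" for x using RS(2)[OF that] by simp
      show "y \<in> closure S" using y cl by simp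
    qed
    then show ?thesis by simp
  qed
  then show thesis using that[OF R(1) R(2)[unfolded n_def n'_def] ends] by blast
qed

text \<open>Naming the ends of the second side \<open>R a\<close> and \<open>R b\<close> absorbs the
  two possible orientations of the gluing.\<close>

lemma adjacent_gluing:
  assumes c: "corner F a b c"
  obtains F' c' R where "rigid R" "adjacent F a b c F' (R a) (R b) c'"
    "lin R (inn a b c) = - inn (R a) (R b) c'"
    "\<And>y. y \<in> closed_segment a b \<Longrightarrow> ch F' (R y) = ch F y"
proof -
  obtain F' a' b' c' where adj: "adjacent F a b c F' a' b' c'" by (rule adjacent_ex[OF c])
  obtain R where R: "rigid R" "lin R (inn a b c) = - inn a' b' c'"
    "R a = a' \<and> R b = b' \<or> R a = b' \<and> R b = a'"
    "\<And>y. y \<in> closed_segment a b \<Longrightarrow> ch F' (R y) = ch F y" by (rule gluing[OF adj]) blast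
  from R(3) show thesis
  proof
    assume "R a = a' \<and> R b = b'"
    then show thesis using that[of R F' c'] R adj by simp
  next
    assume *: "R a = b' \<and> R b = a'"
    have "adjacent F a b c F' b' a' c'"
      using adj corner_perm(1)[of F' a' b' c'] by (simp add: adjacent_def open_segment_commute[of b' a'])
    then show thesis using that[of R F' c'] R * inn_sym[of a' b' c'] by simp
  qed
qed

end

section \<open>PQ-extensions\<close>

text \<open>The condition of \<open>inessential\<close> at a single point, for an arbitrary
  function.\<close>

definition Q_near :: "'a::metric_space set \<Rightarrow> ('a \<Rightarrow> real) \<Rightarrow> 'a \<Rightarrow> bool" where
  "Q_near M f x \<longleftrightarrow> (\<exists>U h g. planar_chart M U h \<and> x \<in> U \<and> Q_function (h ` U) g \<and> (\<forall>y\<in>U. f y = g (h y)))"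

lemma Q_function_iff: "Q_function S f \<longleftrightarrow> (\<exists>p b. \<forall>x\<in>S. f x = Qf p b x)"
  by (simp add: Q_function_def Qf_def)

lemma Q_near_disc_chart:
  assumes "disc_chart M x d h" "\<And>y. y \<in> M \<Longrightarrow> dist x y < d \<Longrightarrow> f y = Qf p b (h y)"
  shows "Q_near M f x"
  unfolding Q_near_def
proof (intro exI conjI)
  show "planar_chart M (M \<inter> ball x d) h" by (rule disc_chart_planar[OF assms(1)])
  show "x \<in> M \<inter> ball x d" using disc_chart_pos[OF assms(1)] by simp
  show "Q_function (h ` (M \<inter> ball x d)) (Qf p b)" unfolding Q_function_iff by blast
  show "\<forall>y\<in>M \<inter> ball x d. f y = Qf p b (h y)" using assms(2) by simp
qed

lemma Q_near_obtain:
  assumes "Q_near M f x"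
  obtains d h p b where "disc_chart M x d h" "\<And>y. y \<in> M \<Longrightarrow> dist x y < d \<Longrightarrow> f y = Qf p b (h y)"
proof -
  obtain U h g where U: "planar_chart M U h" "x \<in> U" "Q_function (h ` U) g" "\<forall>y\<in>U. f y = g (h y)"
    using assms unfolding Q_near_def by blast
  obtain p b where g: "\<forall>z\<in>h ` U. g z = Qf p b z" using U(3) unfolding Q_function_iff by blast
  obtain d where d: "disc_chart M x d h" "M \<inter> ball x d \<subseteq> U" by (rule planar_disc_chart[OF U(1,2)])
  have "f y = Qf p b (h y)" if "y \<in> M" "dist x y < d" for y
  proof -
    have "y \<in> U" using d(2) that by auto
    then show ?thesis using U(4) g by simp
  qed
  then show thesis using that d(1) by blast
qed

lemma segment_isometry:
  fixes c :: "real \<Rightarrow> 'b::real_inner"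
  assumes "e > 0" "\<And>s t. \<bar>s - t0\<bar> < e \<Longrightarrow> \<bar>t - t0\<bar> < e \<Longrightarrow> dist (c s) (c t) = \<bar>s - t\<bar>"
  obtains u where "norm u = 1" "\<And>t. \<bar>t - t0\<bar> < e \<Longrightarrow> c t = c t0 + (t - t0) *\<^sub>R u"
proof -
  have "t0 \<in> interior (ball t0 e)" using assms(1) by simp
  moreover have "dist (c s) (c t) = dist s t" if "s \<in> ball t0 e" "t \<in> ball t0 e" for s t
  proof -
    have "\<bar>s - t0\<bar> < e" "\<bar>t - t0\<bar> < e" using that unfolding mem_ball dist_real_def by linarith+
    then show ?thesis using assms(2) by (simp add: dist_real_def)
  qed
  ultimately obtain L where L: "linear L" "\<forall>u. norm (L u) = norm u" "\<forall>z\<in>ball t0 e. c z = c t0 + L (z - t0)"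
    using isometry_affine[of t0 "ball t0 e" c] by blast
  show thesis
  proof (rule that[of "L 1"])
    show "norm (L 1) = 1" using L(2) by simp
    fix t assume "\<bar>t - t0\<bar> < e"
    then have "t \<in> ball t0 e" unfolding mem_ball dist_real_def by linarith
    then have "c t = c t0 + L (t - t0)" using L(3) by blast
    moreover have "L (t - t0) = (t - t0) *\<^sub>R L 1" using linear_scale[OF L(1), of "t - t0" 1] by simp
    ultimately show "c t = c t0 + (t - t0) *\<^sub>R L 1" by simp
  qed
qed

text \<open>
  If the difference to a chord had a negative minimum, then the function would be constant near the
  leftmost minimum point.
\<close>

lemma concave_on_local:
  fixes g :: "real \<Rightarrow> real"
  assumes cont: "continuous_on {0..L} g"
    and loc: "\<And>t. 0 < t \<Longrightarrow> t < L \<Longrightarrow>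
      \<exists>e>0. \<exists>A B A' B'. \<forall>s. \<bar>s - t\<bar> < e \<longrightarrow> g s = min (A + B * s) (A' + B' * s)"
  shows "concave_on {0..L} g"
  unfolding concave_on_def
proof (rule convex_onI)
  fix t x y :: real assume t: "0 < t" "t < 1" and xy: "x \<in> {0..L}" "y \<in> {0..L}"
  define k where "k z = (y - x) * (g z - g x) - (z - x) * (g y - g x)" for z
  \<comment> \<open>\<open>k\<close> is the height of \<open>g\<close> above its chord, multiplied
    by \<open>y - x\<close> to avoid division.\<close>
  have chord: "0 \<le> k z" if lt: "x < y" and z: "z \<in> {x..y}" and xy: "x \<in> {0..L}" "y \<in> {0..L}"
    and k: "\<And>z. k z = (y - x) * (g z - g x) - (z - x) * (g y - g x)" for x y z and k :: "real \<Rightarrow> real"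
  proof (rule ccontr)
    assume neg: "\<not> 0 \<le> k z"
    have sub: "{x..y} \<subseteq> {0..L}" using xy by auto
    have ck: "continuous_on {x..y} k"
      unfolding k[abs_def] by (intro continuous_intros continuous_on_subset[OF cont sub])
    obtain s0 where s0: "s0 \<in> {x..y}" "\<forall>s\<in>{x..y}. k s0 \<le> k s"
      using continuous_attains_inf[OF _ _ ck] lt by auto
    define m where "m = k s0"
    have "k s0 \<le> k z" using s0(2) z by blast
    then have m: "m < 0" using neg unfolding m_def by linarith
    define S where "S = {s \<in> {x..y}. k s = m}"
    have "closed S" unfolding S_def
      using continuous_closed_preimage_constant[OF ck] by simp
    have S0: "s0 \<in> S" using s0 by (simp add: S_def m_def)
    have bd: "bdd_below S" by (rule bdd_belowI[of _ x]) (simp add: S_def)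
    define s where "s = Inf S"
    have sS: "s \<in> S" unfolding s_def using closed_contains_Inf[OF _ bd \<open>closed S\<close>] S0 by blast
    then have s: "s \<in> {x..y}" "k s = m" by (auto simp: S_def)
    have "k x = 0" "k y = 0" by (simp_all add: k)
    then have sxy: "x < s" "s < y" using s m by (auto simp: order_less_le)
    then have "0 < s" "s < L" using xy by auto
    then obtain e A B A' B' where e: "e > 0" and g: "\<forall>r. \<bar>r - s\<bar> < e \<longrightarrow> g r = min (A + B * r) (A' + B' * r)"
      using loc by blast
    \<comment> \<open>Whichever branch of the minimum is attained at \<open>s\<close> is an affine
      function touching \<open>g\<close> at \<open>s\<close> from above.\<close>
    have "\<exists>a b. g s = a + b * s \<and> (\<forall>r. \<bar>r - s\<bar> < e \<longrightarrow> g r \<le> a + b * r)"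
    proof (cases "A + B * s \<le> A' + B' * s")
      case True
      then show ?thesis using g e by (intro exI[of _ A] exI[of _ B]) simp
    next
      case False
      then show ?thesis using g e by (intro exI[of _ A'] exI[of _ B']) simp
    qed
    then obtain a b where ab: "g s = a + b * s" "\<And>r. \<bar>r - s\<bar> < e \<Longrightarrow> g r \<le> a + b * r" by blast
    define \<beta> where "\<beta> = (y - x) * b - (g y - g x)"
    have up: "k r \<le> m + \<beta> * (r - s)" if "\<bar>r - s\<bar> < e" for r
    proof -
      have "(y - x) * g r \<le> (y - x) * (a + b * r)" using ab(2)[OF that] lt by (intro mult_left_mono) auto
      then show ?thesis unfolding s(2)[symmetric] k \<beta>_def ab(1) by (simp add: algebra_simps)
    qed
    define \<delta> where "\<delta> = min (e / 2) (min (s - x) (y - s))"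
    have \<delta>: "0 < \<delta>" "\<delta> < e" "s - \<delta> \<in> {x..y}" "s + \<delta> \<in> {x..y}" using e sxy by (auto simp: \<delta>_def)
    \<comment> \<open>Both neighbouring values are at least \<open>m\<close>, while the affine bound
      makes their sum at most \<open>2 * m\<close>. So both equal \<open>m\<close>, and the left one
      contradicts the choice of \<open>s\<close>.\<close>
    have lo: "m \<le> k (s - \<delta>)" "m \<le> k (s + \<delta>)" using s0(2) \<delta> by (simp_all add: m_def)
    have "k (s - \<delta>) \<le> m - \<beta> * \<delta>" "k (s + \<delta>) \<le> m + \<beta> * \<delta>" using up[of "s - \<delta>"] up[of "s + \<delta>"] \<delta> by simp_all
    then have "k (s - \<delta>) = m" using lo by linarith
    then have "s - \<delta> \<in> S" using \<delta> by (simp add: S_def)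
    then have "s \<le> s - \<delta>" unfolding s_def by (rule cInf_lower[OF _ bd])
    then show False using \<delta> by simp
  qed
  define z where "z = (1 - t) * x + t * y"
  have "(1 - t) * g x + t * g y \<le> g z"
  proof (cases "x = y")
    case True
    then have "z = x" by (simp add: z_def algebra_simps)
    then show ?thesis using True by (simp add: algebra_simps)
  next
    case False
    then consider "x < y" | "y < x" by linarith
    then show ?thesis
    proof cases
      case 1
      have zx: "z - x = t * (y - x)" by (simp add: z_def algebra_simps)
      have "0 \<le> t * (y - x)" "t * (y - x) \<le> 1 * (y - x)"
        using t 1 by (auto intro!: mult_nonneg_nonneg mult_right_mono)
      then have "z \<in> {x..y}" using zx by simp
      then have "0 \<le> (y - x) * (g z - g x) - (z - x) * (g y - g x)"
        by (rule chord[OF 1 _ xy refl])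
      also have "\<dots> = (y - x) * (g z - ((1 - t) * g x + t * g y))" unfolding zx by (simp add: algebra_simps)
      finally show ?thesis using 1 by (simp add: zero_le_mult_iff)
    next
      case 2
      have zy: "z - y = (1 - t) * (x - y)" by (simp add: z_def algebra_simps)
      have "0 \<le> (1 - t) * (x - y)" "(1 - t) * (x - y) \<le> 1 * (x - y)"
        using t 2 by (auto intro!: mult_nonneg_nonneg mult_right_mono)
      then have "z \<in> {y..x}" using zy by simp
      then have "0 \<le> (x - y) * (g z - g y) - (z - y) * (g x - g y)"
        by (rule chord[OF 2 _ xy(2,1) refl])
      also have "\<dots> = (x - y) * (g z - ((1 - t) * g x + t * g y))" unfolding zy by (simp add: algebra_simps)
      finally show ?thesis using 2 by (simp add: zero_le_mult_iff)
    qed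
  qed
  then show "- g ((1 - t) *\<^sub>R x + t *\<^sub>R y) \<le> (1 - t) * - g x + t * - g y"
    by (simp add: z_def)
qed simp

lemma geodesic_arc_continuous:
  assumes g: "geodesic_arc M L \<gamma>"
  shows "continuous_on {0..L} \<gamma>"
  unfolding continuous_on_iff
proof (intro ballI allI impI)
  fix t and r :: real assume t: "t \<in> {0..L}" and r: "0 < r"
  obtain \<epsilon> where \<epsilon>: "\<epsilon> > 0" "\<forall>s\<in>{0..L} \<inter> ball t \<epsilon>. \<forall>s'\<in>{0..L} \<inter> ball t \<epsilon>. dist (\<gamma> s) (\<gamma> s') = \<bar>s - s'\<bar>"
    using g t unfolding geodesic_arc_def by blast
  have "dist (\<gamma> s) (\<gamma> t) < r" if s: "s \<in> {0..L}" "dist s t < min r \<epsilon>" for s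
  proof -
    have "s \<in> {0..L} \<inter> ball t \<epsilon>" "t \<in> {0..L} \<inter> ball t \<epsilon>" using s t \<epsilon>(1) by (auto simp: dist_commute)
    then have "dist (\<gamma> s) (\<gamma> t) = \<bar>s - t\<bar>" using \<epsilon>(2) by blast
    then show ?thesis using s by (simp add: dist_real_def)
  qed
  then show "\<exists>d>0. \<forall>s\<in>{0..L}. dist s t < d \<longrightarrow> dist (\<gamma> s) (\<gamma> t) < r"
    using r \<epsilon>(1) by (intro exI[of _ "min r \<epsilon>"]) simp
qed

section \<open>Extending vertex weights over the faces\<close>

context triangulated
begin

text \<open>\<open>cp\<close> and \<open>cb\<close> are determined by the corner values alone. No
  sign of \<open>cb\<close> is built in: its positivity is the condition for a pyramid to
  exist.\<close>

definition cp :: "('a \<Rightarrow> real) \<Rightarrow> 'a set \<Rightarrow> real^2" where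
  "cp q F = fst (SOME pb. \<forall>k<3. Qf (fst pb) (snd pb) (vt F k) = q (ch F (vt F k)))"

definition cb :: "('a \<Rightarrow> real) \<Rightarrow> 'a set \<Rightarrow> real" where
  "cb q F = snd (SOME pb. \<forall>k<3. Qf (fst pb) (snd pb) (vt F k) = q (ch F (vt F k)))"

abbreviation QF :: "('a \<Rightarrow> real) \<Rightarrow> 'a set \<Rightarrow> real^2 \<Rightarrow> real" where
  "QF q F \<equiv> Qf (cp q F) (cb q F)"

lemma QF_vt: assumes F: "F \<in> faces T" and k: "k < 3" shows "QF q F (vt F k) = q (ch F (vt F k))"
proof -
  have nc: "\<not> collinear {vt F 0, vt F 1, vt F 2}" by (rule corner_nc[OF corner_ex[OF F]])
  obtain p b where pb: "Qf p b (vt F 0) = q (ch F (vt F 0))" "Qf p b (vt F 1) = q (ch F (vt F 1))"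
    "Qf p b (vt F 2) = q (ch F (vt F 2))"
    using Qf_exists[OF nc] by blast
  have "\<forall>k<3. Qf (fst (p, b)) (snd (p, b)) (vt F k) = q (ch F (vt F k))"
    using pb unfolding less_3_cases by auto
  then have "\<forall>k<3. QF q F (vt F k) = q (ch F (vt F k))"
    unfolding cp_def cb_def by (rule someI)
  then show ?thesis using k by blast
qed

lemma QF_corner:
  assumes "corner F a b c" shows "QF q F a = q (ch F a)"
proof -
  have "a \<in> {vt F 0, vt F 1, vt F 2}" using assms by (auto simp: corner_def)
  then have "a = vt F 0 \<or> a = vt F 1 \<or> a = vt F 2" by simp
  then show ?thesis by (elim disjE) (simp_all add: QF_vt[OF corner_face[OF assms]])
qed

text \<open>Pulled back by \<open>R\<close>, the Q-function of the neighbour takes the same values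
  at both ends of the side, hence along the side.\<close>

lemma QF_glue:
  assumes adj: "adjacent F a b c F' (R a) (R b) c'" and R: "rigid R"
    and glue: "\<And>y. y \<in> closed_segment a b \<Longrightarrow> ch F' (R y) = ch F y" and y: "y \<in> closed_segment a b"
  shows "QF q F' (R y) = QF q F y"
proof -
  have c: "corner F a b c" and c': "corner F' (R a) (R b) c'" using adj by (auto simp: adjacent_def)
  have inv: "QF q F' (R z) = Qf (inv R (cp q F')) (cb q F') z" for z
    using Qf_rigid[OF R, of "inv R (cp q F')" "cb q F'" z] R by simp
  have "Qf (inv R (cp q F')) (cb q F') a = QF q F a"
    unfolding inv[symmetric] using QF_corner[OF c] QF_corner[OF c'] glue[of a] by simp
  moreover have "Qf (inv R (cp q F')) (cb q F') b = QF q F b"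
    unfolding inv[symmetric] using QF_corner[OF corner_perm(1)[OF c]] QF_corner[OF corner_perm(1)[OF c']] glue[of b] by simp
  ultimately show ?thesis unfolding inv[of y] by (rule Qf_eq_on_segment[OF _ _ y])
qed

text \<open>Well-definedness of the extension: a point of \<open>M\<close> may have several lifts.
  In a face the lift is unique, at a vertex the weight decides, and on an edge another lift is the
  image under the gluing motion.\<close>

lemma QF_consistent:
  assumes F: "F \<in> faces T" "z \<in> tri F" and F': "F' \<in> faces T" "z' \<in> tri F'" and eq: "ch F z = ch F' z'"
  shows "QF q F z = QF q F' z'"
  using F
proof (cases rule: tri_point_cases)
  case face
  from F' show ?thesis
  proof (cases rule: tri_point_cases)
    case face': face
    have FF: "F = F'" using faces_eq[OF F(1) F'(1)] face face' eq by simp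
    then have "z = z'" using ch_bij[OF F(1)] face(1) face'(1) eq by (simp add: bij_betw_def inj_on_def)
    then show ?thesis using FF by simp
  next
    case (edge a b c)
    then have "ch F' z' \<in> ch F' ` open_segment a b" by blast
    moreover have "ch F' z' \<in> F" using face(2) eq by simp
    ultimately have False by (rule edge_face[OF corner_props(1)[OF edge(1)] F(1)])
    then show ?thesis ..
  next
    case vertex then show ?thesis using face_sing[OF F(1)] face eq by simp
  qed
next
  case (edge a b c)
  have e: "ch F ` open_segment a b \<in> edges T" by (rule corner_props(1)[OF edge(1)])
  have "ch F' z' \<in> ch F ` open_segment a b" using edge(2) eq by (metis imageI)
  then obtain a' b' c' where c': "corner F' a' b' c'" "z' \<in> open_segment a' b'"
    "ch F' ` open_segment a' b' = ch F ` open_segment a b"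
    using ch_in_edge[OF F' e] by blast
  obtain F'' c'' R where R: "rigid R" "adjacent F a b c F'' (R a) (R b) c''"
    and glue: "\<And>y. y \<in> closed_segment a b \<Longrightarrow> ch F'' (R y) = ch F y"
    by (rule adjacent_gluing[OF edge(1)]) blast
  have zc: "z \<in> closed_segment a b" using edge(2) segment_open_subset_closed by blast
  have "(F', open_segment a' b') \<in> {(F, open_segment a b), (F'', open_segment (R a) (R b))}"
    by (rule adjacent_unique[OF R(2) c'(1) c'(3)])
  then consider "F' = F" "open_segment a' b' = open_segment a b" |
    "F' = F''" "open_segment a' b' = open_segment (R a) (R b)" by (blast dest: Pair_inject)
  then show ?thesis
  proof cases
    case 1
    have "z' \<in> open_segment a b" using c'(2) unfolding 1(2) .
    then have "z = z'" using inj_onD[OF corner_props(2)[OF edge(1)], of z z'] edge(2) eq 1(1) by simp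
    then show ?thesis using 1 by simp
  next
    case 2
    have z'S: "z' \<in> open_segment (R a) (R b)" using c'(2) unfolding 2(2) .
    have "R z \<in> open_segment (R a) (R b)" using edge(2) rigid_open_segment[OF R(1), of a b] by blast
    moreover have "corner F'' (R a) (R b) c''" using R(2) by (simp add: adjacent_def)
    ultimately have "z' = R z"
      using inj_onD[OF corner_props(2), of F'' "R a" "R b" c'' z' "R z"] z'S glue[OF zc] eq 2(1) by simp
    then show ?thesis using QF_glue[OF R(2,1) glue zc] 2(1) by simp
  qed
next
  case (vertex a b c)
  from F' show ?thesis
  proof (cases rule: tri_point_cases)
    case face then show ?thesis using face_sing[OF F'(1)] vertex eq by simp
  next
    case (edge a' b' c')
    then have "ch F' z' \<in> ch F' ` open_segment a' b'" by blast
    then show ?thesis using edge_sing[OF corner_props(1)[OF edge(1)]] vertex eq by simp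
  next
    case v': (vertex a' b' c')
    then show ?thesis using QF_corner[OF vertex(1)] QF_corner[OF v'(1)] vertex eq by simp
  qed
qed

lemma sing_vertex:
  assumes "i \<in> Sing M" obtains F a b c where "corner F a b c" "ch F a = i"
proof -
  have "i \<in> M" using assms by (simp add: Sing_def)
  then obtain F z where F: "F \<in> faces T" "z \<in> tri F" "ch F z = i" by (rule lift_point)
  from F(1,2) show thesis
  proof (cases rule: tri_point_cases)
    case face then show ?thesis using face_sing[OF F(1)] F(3) assms by simp
  next
    case (edge a b c)
    then have "i \<in> ch F ` open_segment a b" using F(3) by blast
    then show ?thesis using edge_sing[OF corner_props(1)[OF edge(1)]] assms by simp
  next
    case (vertex a b c) then show ?thesis using that F(3) by blast
  qed
qed

lemma PQ_wrt_iff: "PQ_function_wrt M T f \<longleftrightarrow>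
  continuous_on M f \<and> (\<forall>F\<in>faces T. \<exists>p b. \<forall>z\<in>tri F. f (ch F z) = Qf p b z)"
  unfolding PQ_function_wrt_def chart_of_eq prod.case Q_function_iff by (simp add: tri_def)

lemma PQ_unique:
  assumes f: "PQ_function_wrt M T f" "\<forall>i\<in>Sing M. f i = q i" and F: "F \<in> faces T" "z \<in> tri F"
  shows "f (ch F z) = QF q F z"
proof -
  obtain p b where pb: "\<forall>z\<in>tri F. f (ch F z) = Qf p b z" using f(1) F(1) unfolding PQ_wrt_iff by blast
  note c = corner_ex[OF F(1)]
  have v: "Qf p b a = QF q F a" if c: "corner F a a' a''" for a a' a''
    using pb corner_props(3,6)[OF c] QF_corner[OF c, of q] f(2) by metis
  have "Qf p b z = QF q F z"
    using Qf_eq_on_triangle[OF corner_nc[OF c]] v[OF c] v[OF corner_perm(1)[OF c]]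
      v[OF corner_perm(1)[OF corner_perm(2)[OF c]]] by blast
  then show ?thesis using pb F by simp
qed

text \<open>The explicit PQ-extension, read off from any lift of \<open>x\<close>; it is matched
  with the description by \<open>THE\<close> in \<open>PQ_extension_eq\<close>.\<close>

definition ext :: "('a \<Rightarrow> real) \<Rightarrow> 'a \<Rightarrow> real" where
  "ext q = (\<lambda>x\<in>M. (SOME y. \<exists>F z. F \<in> faces T \<and> z \<in> tri F \<and> ch F z = x \<and> y = QF q F z))"

lemma ext_ch: assumes F: "F \<in> faces T" "z \<in> tri F" shows "ext q (ch F z) = QF q F z"
proof -
  define y where "y = (SOME y. \<exists>F' z'. F' \<in> faces T \<and> z' \<in> tri F' \<and> ch F' z' = ch F z \<and> y = QF q F' z')"
  have "\<exists>F' z'. F' \<in> faces T \<and> z' \<in> tri F' \<and> ch F' z' = ch F z \<and> y = QF q F' z'"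
    unfolding y_def by (rule someI[of _ "QF q F z"]) (use F in blast)
  then have "y = QF q F z" using QF_consistent[OF F] by metis
  moreover have "ext q (ch F z) = y" using ch_M[OF F] by (simp add: ext_def y_def)
  ultimately show ?thesis by simp
qed

lemma Qf_continuous: "continuous_on S (Qf p b)"
  unfolding Qf_def by (intro continuous_intros)

lemma ext_PQ: "PQ_function_wrt M T (ext q)"
  unfolding PQ_wrt_iff
proof
  \<comment> \<open>The preimage of a closed set is a finite union of compact images of parts of
    triangles.\<close>
  have "closed (ext q -` B \<inter> M)" if B: "closed B" for B
  proof -
    have "ext q -` B \<inter> M = (\<Union>F\<in>faces T. ch F ` (tri F \<inter> QF q F -` B))"
    proof (intro equalityI subsetI)
      fix x assume x: "x \<in> ext q -` B \<inter> M"
      then obtain F z where "F \<in> faces T" "z \<in> tri F" "ch F z = x" using lift_point by blast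
      then show "x \<in> (\<Union>F\<in>faces T. ch F ` (tri F \<inter> QF q F -` B))" using x ext_ch[of F z q] by auto
    next
      fix x assume "x \<in> (\<Union>F\<in>faces T. ch F ` (tri F \<inter> QF q F -` B))"
      then obtain F z where "F \<in> faces T" "z \<in> tri F" "QF q F z \<in> B" "ch F z = x" by auto
      then show "x \<in> ext q -` B \<inter> M" using ext_ch[of F z q] ch_M[of F z] by auto
    qed
    moreover have "compact (ch F ` (tri F \<inter> QF q F -` B))" if F: "F \<in> faces T" for F
    proof (rule compact_continuous_image)
      show "continuous_on (tri F \<inter> QF q F -` B) (ch F)"
        by (rule continuous_on_subset[OF ch_cont[OF F]]) blast
      have "closed (QF q F -` B)"
      proof (rule continuous_closed_vimage[OF B])
        show "isCont (QF q F) z" for z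
          using Qf_continuous[of UNIV "cp q F" "cb q F"] by (simp add: continuous_on_eq_continuous_at)
      qed
      then show "compact (tri F \<inter> QF q F -` B)" by (rule compact_Int_closed[OF tri_compact[OF F]])
    qed
    ultimately show ?thesis
      using finite_T(2) by (auto intro!: closed_UN compact_imp_closed)
  qed
  then show "continuous_on M (ext q)"
    using continuous_on_closed_vimage[OF compact_imp_closed[OF compact_M]] by blast
  show "\<forall>F\<in>faces T. \<exists>p b. \<forall>z\<in>tri F. ext q (ch F z) = Qf p b z" using ext_ch by blast
qed

lemma ext_sing: "i \<in> Sing M \<Longrightarrow> ext q i = q i"
proof -
  assume "i \<in> Sing M"
  then obtain F a b c where c: "corner F a b c" "ch F a = i" by (rule sing_vertex)
  then show ?thesis using ext_ch[OF corner_face[OF c(1)] corner_props(6)[OF c(1)], of q] QF_corner[OF c(1), of q] by simp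
qed

lemma PQ_extension_eq: "PQ_extension M T q = ext q"
  unfolding PQ_extension_def
proof (rule the_equality)
  show "ext q \<in> extensional M \<and> PQ_function_wrt M T (ext q) \<and> (\<forall>i\<in>Sing M. ext q i = q i)"
    using ext_PQ ext_sing by (simp add: ext_def)
  fix f assume f: "f \<in> extensional M \<and> PQ_function_wrt M T f \<and> (\<forall>i\<in>Sing M. f i = q i)"
  show "f = ext q"
  proof
    fix x
    show "f x = ext q x"
    proof (cases "x \<in> M")
      case True
      then obtain F z where F: "F \<in> faces T" "z \<in> tri F" "ch F z = x" by (rule lift_point)
      then show ?thesis using PQ_unique[of f q F z] f ext_ch[OF F(1,2), of q] by simp
    next
      case False then show ?thesis using f by (simp add: extensional_def ext_def)
    qed
  qed
qed

lemma ext_continuous: "continuous_on M (ext q)"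
  using ext_PQ by (simp add: PQ_wrt_iff)

section \<open>The local form of a PQ-extension\<close>

text \<open>Signed distance of the center from the line \<open>ab\<close>; on the edge it is minus
  half the derivative of the Q-function along the inward normal.\<close>

definition slope :: "('a \<Rightarrow> real) \<Rightarrow> 'a set \<Rightarrow> real^2 \<Rightarrow> real^2 \<Rightarrow> real^2 \<Rightarrow> real" where
  "slope q F a b c = hgt a b c (cp q F)"

lemma ext_near_face:
  assumes x: "F \<in> faces T" "x \<in> F" and h: "disc_chart M x d h"
  obtains e P b where "0 < e" "e \<le> d" "\<And>y. y \<in> M \<Longrightarrow> dist x y < e \<Longrightarrow> ext q y = Qf P b (h y)"
proof -
  have "x \<in> ch F ` interior (tri F)" using ch_bij[OF x(1)] x(2) by (simp add: bij_betw_def)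
  then obtain z where z: "z \<in> interior (tri F)" "x = ch F z" by blast
  have zt: "z \<in> tri F" using z interior_subset by blast
  obtain e1 A where e1: "0 < e1" "e1 \<le> d" and A: "rigid A" and w: "\<And>w. w \<in> tri F \<Longrightarrow> dist z w < e1 \<Longrightarrow>
     dist (ch F z) (ch F w) = dist z w \<and> h (ch F w) = A w"
    using in_disc_chart[OF x(1) zt] h z(2) by blast
  obtain e2 where e2: "0 < e2" "ball z e2 \<subseteq> interior (tri F)" using z open_interior openE by blast
  define e where "e = min e1 e2"
  have e: "0 < e" "e \<le> d" "e \<le> e1" "e \<le> e2" using e1 e2 by (auto simp: e_def)
  have Az: "A z = h x" using w[OF zt] e1 z(2) by simp
  show thesis
  proof (rule that[OF e(1,2)])
    fix y assume y: "y \<in> M" "dist x y < e"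
    define v where "v = inv A (h y)"
    have Av: "A v = h y" using A by (simp add: v_def)
    have "dist z v = dist (h x) (h y)" using rigidD[OF A, of z v] Av Az by simp
    also have "\<dots> = dist x y" using disc_chart_dist[OF h, of x y] disc_chart_pos[OF h] y e by simp
    finally have dv: "dist z v = dist x y" .
    then have vt: "v \<in> tri F" using e2(2) y e interior_subset[of "tri F"] by (auto simp: subset_iff)
    have v: "dist (ch F z) (ch F v) = dist z v" "h (ch F v) = A v" using w[OF vt] dv y e by auto
    have "ch F v = y"
    proof (rule disc_chart_inj[OF h])
      show "ch F v \<in> M" by (rule ch_M[OF x(1) vt])
      show "dist x (ch F v) < d" using v dv y e z(2) by simp
      show "dist x y < d" using y e by simp
    qed (use v Av y in auto)
    then have "ext q y = QF q F v" using ext_ch[OF x(1) vt] by simp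
    also have "\<dots> = Qf (A (cp q F)) (cb q F) (h y)" using Qf_rigid[OF A, of "cp q F" "cb q F" v] Av by simp
    finally show "ext q y = Qf (A (cp q F)) (cb q F) (h y)" .
  qed
qed

lemma ext_near_side:
  assumes s: "side_chart F a b c y h e A" and p: "p \<in> M" "dist (ch F y) p < e"
    and u: "0 \<le> (h p - h (ch F y)) \<bullet> lin A (inn a b c)"
  shows "ext q p = Qf (A (cp q F)) (cb q F) (h p)"
proof -
  note b = side_chart_basic[OF s]
  have d: "dist (h (ch F y)) (h p) = dist (ch F y) p"
    using disc_chart_dist[OF b(7), of "ch F y" p] disc_chart_pos[OF b(7)] p by simp
  then have "dist (h (ch F y)) (h p) < e" using p by simp
  note w = side_chart_point[OF s this u]
  have "ch F (inv A (h p)) = p"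
    by (rule disc_chart_inj[OF b(7)]) (use w p d in auto)
  then have "ext q p = QF q F (inv A (h p))" using ext_ch[OF corner_face[OF b(3)] w(1), of q] by simp
  also have "\<dots> = Qf (A (cp q F)) (cb q F) (h p)"
    using Qf_rigid[OF b(2), of "cp q F" "cb q F" "inv A (h p)"] b(2) by simp
  finally show ?thesis .
qed

lemma edge_point_side:
  assumes s: "side_chart F a b c y h e A" and p: "p \<in> M" "dist (ch F y) p < e" "p \<in> E" "E \<in> edges T"
  shows "(h p - h (ch F y)) \<bullet> lin A (inn a b c) \<le> 0"
proof (rule ccontr)
  assume "\<not> ?thesis"
  then have u: "0 < (h p - h (ch F y)) \<bullet> lin A (inn a b c)" by simp
  note b = side_chart_basic[OF s]
  have d: "dist (h (ch F y)) (h p) = dist (ch F y) p"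
    using disc_chart_dist[OF b(7), of "ch F y" p] disc_chart_pos[OF b(7)] p by simp
  then have "dist (h (ch F y)) (h p) < e" using p by simp
  note w = side_chart_point[OF s this less_imp_le[OF u]]
  have "ch F (inv A (h p)) = p"
    by (rule disc_chart_inj[OF b(7)]) (use w p d in auto)
  then have "p \<in> F" using w(5)[OF u] by simp
  then show False by (rule edge_face[OF p(4) corner_face[OF b(3)] p(3)])
qed

text \<open>Both centers are carried into the plane of one disc chart, where the two faces fill
  opposite half-discs. Their Q-functions agree on the dividing line, and \<open>Qf_halves\<close>
  gives the relations between them.\<close>

lemma ext_near_edge:
  assumes adj: "adjacent F a b c F' a' b' c'" and x: "x \<in> ch F ` open_segment a b"
    and h: "disc_chart M x d h"
  obtains e N P P' where "0 < e" "e \<le> d" "norm N = 1"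
    "\<forall>p\<in>M. dist x p < e \<longrightarrow> 0 \<le> (h p - h x) \<bullet> N \<longrightarrow> ext q p = Qf P (cb q F) (h p)"
    "\<forall>p\<in>M. dist x p < e \<longrightarrow> (h p - h x) \<bullet> N \<le> 0 \<longrightarrow> ext q p = Qf P' (cb q F') (h p)"
    "(P - h x) \<bullet> N = slope q F a b c" "(P' - h x) \<bullet> N = - slope q F' a' b' c'"
    "P - P' = (slope q F a b c + slope q F' a' b' c') *\<^sub>R N"
    "\<forall>z. Qf P (cb q F) z - Qf P' (cb q F') z =
       - 2 * (slope q F a b c + slope q F' a' b' c') * ((z - h x) \<bullet> N)"
    "(slope q F a b c)\<^sup>2 + cb q F = (slope q F' a' b' c')\<^sup>2 + cb q F'"
    "\<forall>p\<in>M. dist x p < e \<longrightarrow> p \<in> ch F ` open_segment a b \<longrightarrow> (h p - h x) \<bullet> N = 0"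
proof -
  have c: "corner F a b c" and c': "corner F' a' b' c'" and im: "ch F ` open_segment a b = ch F' ` open_segment a' b'"
    and ne: "(F, open_segment a b) \<noteq> (F', open_segment a' b')" using adj by (auto simp: adjacent_def)
  obtain y where y: "y \<in> open_segment a b" "x = ch F y" using x by blast
  obtain y' where y': "y' \<in> open_segment a' b'" "x = ch F' y'" using x im by blast
  have eq: "ch F y = ch F' y'" using y y' by simp
  obtain e A A' where e: "0 < e" "e \<le> d" and s: "side_chart F a b c y h e A" "side_chart F' a' b' c' y' h e A'"
    by (rule common_side_chart[OF c y(1) c' y'(1) eq h[unfolded y(2)]])
  note b = side_chart_basic[OF s(1)] and b' = side_chart_basic[OF s(2)]
  define N where "N = lin A (inn a b c)"
  have N': "lin A' (inn a' b' c') = - N" unfolding N_def by (rule sides_opposite[OF s eq ne])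
  define P where "P = A (cp q F)"
  define P' where "P' = A' (cp q F')"
  have N1: "norm N = 1" using b(6) by (simp add: N_def)
  have up: "ext q p = Qf P (cb q F) (h p)" if "p \<in> M" "dist x p < e" "0 \<le> (h p - h x) \<bullet> N" for p
    unfolding P_def using that y by (intro ext_near_side[OF s(1)]) (simp_all add: N_def)
  have dn: "ext q p = Qf P' (cb q F') (h p)" if "p \<in> M" "dist x p < e" "(h p - h x) \<bullet> N \<le> 0" for p
    unfolding P'_def using that y' by (intro ext_near_side[OF s(2)]) (simp_all add: N')
  have sl: "(P - h x) \<bullet> N = slope q F a b c" "(P' - h x) \<bullet> N = - slope q F' a' b' c'"
    using b(8)[of "cp q F"] b'(8)[of "cp q F'"] y(2) y'(2) by (simp_all add: slope_def P_def P'_def N' N_def)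
  have he: "disc_chart M x e h" by (rule disc_chart_shrink[OF h e])
  \<comment> \<open>Points of the dividing line belong to both half-discs.\<close>
  have on: "Qf P (cb q F) z = Qf P' (cb q F') z" if z: "z \<in> ball (h x) e" "(z - h x) \<bullet> N = 0" for z
  proof -
    obtain p where p: "p \<in> M" "dist x p = dist (h x) z" "dist x p < e" "h p = z"
      by (rule disc_chart_surj[OF he z(1) order_refl])
    then show ?thesis using up[of p] dn[of p] z by simp
  qed
  note hv = Qf_halves[where x = "h x" and e = e and p = P and p' = P' and b = "cb q F" and b' = "cb q F'",
      OF N1 e(1) on]
  have PN: "(P - P') \<bullet> N = slope q F a b c + slope q F' a' b' c'"
  proof -
    have "(P - P') \<bullet> N = (P - h x) \<bullet> N - (P' - h x) \<bullet> N" by (simp add: inner_diff_left)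
    then show ?thesis using sl by simp
  qed
  show thesis
  proof (rule that[OF e N1 _ _ sl])
    show "\<forall>p\<in>M. dist x p < e \<longrightarrow> 0 \<le> (h p - h x) \<bullet> N \<longrightarrow> ext q p = Qf P (cb q F) (h p)"
      using up by blast
    show "\<forall>p\<in>M. dist x p < e \<longrightarrow> (h p - h x) \<bullet> N \<le> 0 \<longrightarrow> ext q p = Qf P' (cb q F') (h p)"
      using dn by blast
    show "P - P' = (slope q F a b c + slope q F' a' b' c') *\<^sub>R N" using hv(1) PN by simp
    show "\<forall>z. Qf P (cb q F) z - Qf P' (cb q F') z =
       - 2 * (slope q F a b c + slope q F' a' b' c') * ((z - h x) \<bullet> N)" using hv(2) PN by simp
    show "(slope q F a b c)\<^sup>2 + cb q F = (slope q F' a' b' c')\<^sup>2 + cb q F'" using hv(3) sl by simp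
    show "\<forall>p\<in>M. dist x p < e \<longrightarrow> p \<in> ch F ` open_segment a b \<longrightarrow> (h p - h x) \<bullet> N = 0"
    proof (intro ballI impI)
      fix p assume p: "p \<in> M" "dist x p < e" "p \<in> ch F ` open_segment a b"
      have "(h p - h x) \<bullet> N \<le> 0"
        using edge_point_side[OF s(1) p(1) _ p(3) corner_props(1)[OF c]] p(2) y(2) by (simp add: N_def)
      moreover have "(h p - h x) \<bullet> (- N) \<le> 0"
        using edge_point_side[OF s(2) p(1) _ p(3) corner_props(1)[OF c]] p(2) y'(2) by (simp add: N'[symmetric])
      ultimately show "(h p - h x) \<bullet> N = 0" by simp
    qed
  qed
qed

lemma Q_near_face:
  assumes "F \<in> faces T" "x \<in> F" shows "Q_near M (ext q) x"
proof -
  obtain d h where h: "disc_chart M x d h" using face_sing[OF assms] disc_chart_ex by blast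
  obtain e P b where e: "0 < e" "e \<le> d" "\<And>y. y \<in> M \<Longrightarrow> dist x y < e \<Longrightarrow> ext q y = Qf P b (h y)"
    by (rule ext_near_face[OF assms h, of q]) blast
  show ?thesis by (rule Q_near_disc_chart[OF disc_chart_shrink[OF h e(1,2)] e(3)])
qed

lemma Q_near_edge:
  assumes adj: "adjacent F a b c F' a' b' c'" and x: "x \<in> ch F ` open_segment a b"
  shows "Q_near M (ext q) x \<longleftrightarrow> slope q F a b c + slope q F' a' b' c' = 0"
proof
  assume 0: "slope q F a b c + slope q F' a' b' c' = 0"
  have "corner F a b c" using adj by (simp add: adjacent_def)
  then have "x \<in> M \<and> x \<notin> Sing M" using edge_sing[OF corner_props(1) x] by blast
  then obtain d h where h: "disc_chart M x d h" using disc_chart_ex by blast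
  obtain e N P P' where e: "0 < e" "e \<le> d" and N: "norm N = 1"
    and up0: "\<forall>p\<in>M. dist x p < e \<longrightarrow> 0 \<le> (h p - h x) \<bullet> N \<longrightarrow> ext q p = Qf P (cb q F) (h p)"
    and dn0: "\<forall>p\<in>M. dist x p < e \<longrightarrow> (h p - h x) \<bullet> N \<le> 0 \<longrightarrow> ext q p = Qf P' (cb q F') (h p)"
    and df: "\<forall>z. Qf P (cb q F) z - Qf P' (cb q F') z =
       - 2 * (slope q F a b c + slope q F' a' b' c') * ((z - h x) \<bullet> N)"
    by (rule ext_near_edge[OF adj x h, of q]) (rule that; assumption)
  note up = up0[rule_format] and dn = dn0[rule_format]
  show "Q_near M (ext q) x"
  proof (rule Q_near_disc_chart[OF disc_chart_shrink[OF h e]])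
    fix p assume p: "p \<in> M" "dist x p < e"
    show "ext q p = Qf P (cb q F) (h p)"
    proof (cases "0 \<le> (h p - h x) \<bullet> N")
      case True then show ?thesis using up p by blast
    next
      case False
      then have "ext q p = Qf P' (cb q F') (h p)" using dn p by simp
      then show ?thesis using df[rule_format, of "h p"] 0 by simp
    qed
  qed
next
  assume "Q_near M (ext q) x"
  then obtain d h p0 b0 where h: "disc_chart M x d h" and f: "\<And>y. y \<in> M \<Longrightarrow> dist x y < d \<Longrightarrow> ext q y = Qf p0 b0 (h y)"
    by (rule Q_near_obtain) blast
  obtain e N P P' where e: "0 < e" "e \<le> d" and N: "norm N = 1"
    and up0: "\<forall>p\<in>M. dist x p < e \<longrightarrow> 0 \<le> (h p - h x) \<bullet> N \<longrightarrow> ext q p = Qf P (cb q F) (h p)"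
    and dn0: "\<forall>p\<in>M. dist x p < e \<longrightarrow> (h p - h x) \<bullet> N \<le> 0 \<longrightarrow> ext q p = Qf P' (cb q F') (h p)"
    and PP: "P - P' = (slope q F a b c + slope q F' a' b' c') *\<^sub>R N"
    by (rule ext_near_edge[OF adj x h, of q]) (rule that; assumption)
  note up = up0[rule_format] and dn = dn0[rule_format]
  have NN: "N \<bullet> N = 1" using N by (simp add: norm_eq_sqrt_inner)
  \<comment> \<open>The balls of radius \<open>e/2\<close> centered at distance \<open>e/2\<close>
    from \<open>h x\<close> along the normal lie in one half-disc each; \<sigma> is the sign of the
    side. A single Q-function valid near \<open>x\<close> must have the center \<open>P\<close> by
    the first ball and \<open>P'\<close> by the second.\<close>
  have half: "dist (h x) z < e \<and> 0 \<le> (\<sigma> * ((z - h x) \<bullet> N))"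
    if z: "z \<in> ball (h x + (\<sigma> * e/2) *\<^sub>R N) (e/2)" and s: "\<bar>\<sigma>\<bar> = 1" for z \<sigma>
  proof -
    define v where "v = z - (h x + (\<sigma> * e/2) *\<^sub>R N)"
    have v: "norm v < e/2" using z by (simp add: v_def dist_norm norm_minus_commute)
    have zx: "z - h x = v + (\<sigma> * e/2) *\<^sub>R N" by (simp add: v_def)
    have "norm (z - h x) \<le> norm v + norm ((\<sigma> * e/2) *\<^sub>R N)" unfolding zx by (rule norm_triangle_ineq)
    also have "norm ((\<sigma> * e/2) *\<^sub>R N) = e/2" using N s e by (simp add: abs_mult)
    finally have 1: "dist (h x) z < e" using v by (simp add: dist_norm norm_minus_commute)
    have ss: "\<sigma> * \<sigma> = 1" using s by (metis abs_mult_self_eq mult_1)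
    have "\<bar>v \<bullet> N\<bar> \<le> norm v * norm N" by (rule Cauchy_Schwarz_ineq2)
    then have "\<bar>\<sigma> * (v \<bullet> N)\<bar> < e/2" using v N s by (simp add: abs_mult)
    moreover have "\<sigma> * ((z - h x) \<bullet> N) = \<sigma> * (v \<bullet> N) + \<sigma> * \<sigma> * e/2"
      unfolding zx by (simp add: inner_add_left NN algebra_simps)
    ultimately have "0 \<le> \<sigma> * ((z - h x) \<bullet> N)" using ss by (simp add: abs_less_iff)
    then show ?thesis using 1 by blast
  qed
  have he: "disc_chart M x e h" by (rule disc_chart_shrink[OF h e])
  have "p0 = P"
  proof (rule Qf_unique(1))
    fix z assume "z \<in> ball (h x + (1 * e/2) *\<^sub>R N) (e/2)"
    then have z: "dist (h x) z < e" "0 \<le> (z - h x) \<bullet> N" using half[of z 1] by auto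
    then obtain p where p: "p \<in> M" "dist x p = dist (h x) z" "dist x p < e" "h p = z"
      using disc_chart_surj[OF he _ order_refl, of z] by auto
    then show "Qf p0 b0 z = Qf P (cb q F) z" using f[of p] up[of p] z e by simp
  qed (use e in simp)
  moreover have "p0 = P'"
  proof (rule Qf_unique(1))
    fix z assume "z \<in> ball (h x + (-1 * e/2) *\<^sub>R N) (e/2)"
    then have z: "dist (h x) z < e" "(z - h x) \<bullet> N \<le> 0" using half[of z "-1"] by auto
    then obtain p where p: "p \<in> M" "dist x p = dist (h x) z" "dist x p < e" "h p = z"
      using disc_chart_surj[OF he _ order_refl, of z] by auto
    then show "Qf p0 b0 z = Qf P' (cb q F') z" using f[of p] dn[of p] z e by simp
  qed (use e in simp)
  ultimately have "(slope q F a b c + slope q F' a' b' c') *\<^sub>R N = 0" using PP by simp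
  then show "slope q F a b c + slope q F' a' b' c' = 0" using N by auto
qed

text \<open>Cross the edge perpendicularly by an arc of length \<open>2 * s\<close> and use
  concavity at its midpoint. The quadratic terms cancel, and the second difference left is
  \<open>- 2 * s\<close> times the sum of the slopes.\<close>

lemma Q_concave_imp_slope:
  assumes conc: "Q_concave M (ext q)" and adj: "adjacent F a b c F' a' b' c'"
  shows "0 \<le> slope q F a b c + slope q F' a' b' c'"
proof -
  have c: "corner F a b c" using adj by (simp add: adjacent_def)
  have "a \<noteq> b" using corner_distinct[OF c] by blast
  then obtain y where "y \<in> open_segment a b" using open_segment_eq_empty[of a b] by blast
  then have x: "ch F y \<in> ch F ` open_segment a b" by blast
  define x where "x = ch F y"
  note x = x[folded x_def]
  have "x \<in> M \<and> x \<notin> Sing M" using edge_sing[OF corner_props(1)[OF c] x] by blast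
  then obtain d h where h: "disc_chart M x d h" using disc_chart_ex by blast
  obtain e N P P' where e: "0 < e" "e \<le> d" and N: "norm N = 1"
    and up0: "\<forall>p\<in>M. dist x p < e \<longrightarrow> 0 \<le> (h p - h x) \<bullet> N \<longrightarrow> ext q p = Qf P (cb q F) (h p)"
    and dn0: "\<forall>p\<in>M. dist x p < e \<longrightarrow> (h p - h x) \<bullet> N \<le> 0 \<longrightarrow> ext q p = Qf P' (cb q F') (h p)"
    and sl: "(P - h x) \<bullet> N = slope q F a b c" "(P' - h x) \<bullet> N = - slope q F' a' b' c'"
    by (rule ext_near_edge[OF adj x h, of q]) (rule that; assumption)
  note up = up0[rule_format] and dn = dn0[rule_format]
  have he: "disc_chart M x e h" by (rule disc_chart_shrink[OF h e])
  have NN: "N \<bullet> N = 1" using N by (simp add: norm_eq_sqrt_inner)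
  define s where "s = e / 2"
  have s: "0 < s" "s < e" using e by (auto simp: s_def)
  have "\<exists>p. t \<in> {0..2 * s} \<longrightarrow> p \<in> M \<and> dist x p < e \<and> h p = h x + (t - s) *\<^sub>R N" for t
  proof (cases "t \<in> {0..2 * s}")
    case True
    then have "h x + (t - s) *\<^sub>R N \<in> ball (h x) e" using N s by (auto simp: dist_norm)
    then obtain p where "p \<in> M" "dist x p = dist (h x) (h x + (t - s) *\<^sub>R N)" "dist x p < e" "h p = h x + (t - s) *\<^sub>R N"
      by (rule disc_chart_surj[OF he _ order_refl])
    then show ?thesis by blast
  next
    case False then show ?thesis by blast
  qed
  then obtain \<gamma> where \<gamma>: "\<And>t. t \<in> {0..2 * s} \<Longrightarrow> \<gamma> t \<in> M \<and> dist x (\<gamma> t) < e \<and> h (\<gamma> t) = h x + (t - s) *\<^sub>R N"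
    by metis
  have iso: "dist (\<gamma> t) (\<gamma> t') = \<bar>t - t'\<bar>" if t: "t \<in> {0..2 * s}" "t' \<in> {0..2 * s}" for t t'
  proof -
    have "dist (\<gamma> t) (\<gamma> t') = dist (h (\<gamma> t)) (h (\<gamma> t'))"
      using disc_chart_dist[OF he, of "\<gamma> t" "\<gamma> t'"] \<gamma>[OF t(1)] \<gamma>[OF t(2)] by simp
    moreover have ht: "h (\<gamma> t) = h x + (t - s) *\<^sub>R N" "h (\<gamma> t') = h x + (t' - s) *\<^sub>R N"
      using \<gamma>[OF t(1)] \<gamma>[OF t(2)] by blast+
    have "h (\<gamma> t) - h (\<gamma> t') = (t - t') *\<^sub>R N" unfolding ht by (simp add: algebra_simps)
    then have "dist (h (\<gamma> t)) (h (\<gamma> t')) = \<bar>t - t'\<bar>" using N by (simp add: dist_norm)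
    ultimately show ?thesis by simp
  qed
  have "geodesic_arc M (2 * s) \<gamma>"
    unfolding geodesic_arc_def
  proof (intro conjI ballI)
    show "\<gamma> ` {0..2 * s} \<subseteq> M" using \<gamma> by blast
    show "\<gamma> t \<notin> Sing M" if "t \<in> {0<..<2 * s}" for t
      using disc_chart_nonsing[OF he, of "\<gamma> t"] \<gamma>[of t] that by simp
    show "\<exists>\<epsilon>>0. \<forall>r\<in>{0..2 * s} \<inter> ball t \<epsilon>. \<forall>r'\<in>{0..2 * s} \<inter> ball t \<epsilon>. dist (\<gamma> r) (\<gamma> r') = \<bar>r - r'\<bar>" for t
      using iso by (intro exI[of _ 1]) auto
  qed (use s in simp)
  then have cc: "concave_on {0..2 * s} (\<lambda>t. ext q (\<gamma> t) - t\<^sup>2)" using conc unfolding Q_concave_def by blast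
  have xg: "\<gamma> s = x"
    by (rule disc_chart_inj[OF he]) (use \<gamma>[of s] s disc_chart_pos[OF he] in auto)
  have g2: "h (\<gamma> (2 * s)) - h x = s *\<^sub>R N" "\<gamma> (2 * s) \<in> M" "dist x (\<gamma> (2 * s)) < e"
    using \<gamma>[of "2 * s"] s by auto
  have g0: "h (\<gamma> 0) - h x = - (s *\<^sub>R N)" "\<gamma> 0 \<in> M" "dist x (\<gamma> 0) < e"
    using \<gamma>[of 0] s by auto
  have fx: "ext q x = Qf P (cb q F) (h x)" "ext q x = Qf P' (cb q F') (h x)"
    using up[of x] dn[of x] disc_chart_pos[OF he] by auto
  have "ext q (\<gamma> (2 * s)) = Qf P (cb q F) (h x + s *\<^sub>R N)"
    using up[of "\<gamma> (2 * s)"] g2 NN s by (simp add: algebra_simps)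
  also have "\<dots> = ext q x + s\<^sup>2 - 2 * s * slope q F a b c"
    unfolding Qf_expand fx(1) using sl(1) NN by (simp add: power2_eq_square inner_commute[of N "P - h x"])
  finally have f2: "ext q (\<gamma> (2 * s)) = ext q x + s\<^sup>2 - 2 * s * slope q F a b c" .
  have h0: "h (\<gamma> 0) = h x + (- s) *\<^sub>R N" using \<gamma>[of 0] s by auto
  have "ext q (\<gamma> 0) = Qf P' (cb q F') (h (\<gamma> 0))"
    using dn[of "\<gamma> 0"] g0 NN s by simp
  then have "ext q (\<gamma> 0) = Qf P' (cb q F') (h x + (- s) *\<^sub>R N)" unfolding h0 .
  also have "\<dots> = ext q x + s\<^sup>2 - 2 * s * slope q F' a' b' c'"
    unfolding Qf_expand fx(2) using sl(2) NN by (simp add: power2_eq_square inner_commute[of N "P' - h x"])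
  finally have f0: "ext q (\<gamma> 0) = ext q x + s\<^sup>2 - 2 * s * slope q F' a' b' c'" .
  have "convex_on {0..2 * s} (\<lambda>t. - (ext q (\<gamma> t) - t\<^sup>2))" using cc by (simp add: concave_on_def)
  then have "- (ext q (\<gamma> ((1 - 1/2) *\<^sub>R 0 + (1/2) *\<^sub>R (2 * s))) - ((1 - 1/2) *\<^sub>R 0 + (1/2) *\<^sub>R (2 * s))\<^sup>2)
     \<le> (1 - 1/2) * - (ext q (\<gamma> 0) - 0\<^sup>2) + (1/2) * - (ext q (\<gamma> (2 * s)) - (2 * s)\<^sup>2)"
    using s by (intro convex_onD) auto
  moreover have "(1 - 1/2) *\<^sub>R (0::real) + (1/2) *\<^sub>R (2 * s) = s" by simp
  ultimately have "- (ext q x - s\<^sup>2) \<le> (1 - 1/2) * - (ext q (\<gamma> 0) - 0) + (1/2) * - (ext q (\<gamma> (2 * s)) - 4 * s\<^sup>2)"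
    by (simp only: xg power_mult_distrib zero_power2) simp
  moreover have "0 \<le> A + B" if "- (X - S) \<le> (1 - 1/2) * - (g - 0) + (1/2) * - (g' - 4 * S)"
    "g' = X + S - 2 * A" "g = X + S - 2 * B" for X S A B g g' :: real
    using that by (simp add: field_simps)
  ultimately have "0 \<le> s * slope q F a b c + s * slope q F' a' b' c'"
    using f2[unfolded mult.assoc] f0[unfolded mult.assoc] by blast
  then have "0 \<le> s * (slope q F a b c + slope q F' a' b' c')" by (simp only: distrib_left)
  then show ?thesis using s by (simp add: zero_le_mult_iff)
qed

text \<open>With a nonnegative slope sum, the difference of the two Q-functions at an edge is
  nonpositive on the half-disc where the first one is valid, and nonnegative on the other one; so
  the extension is their minimum.\<close>

lemma ext_near_min:
  assumes sl: "\<And>F a b c F' a' b' c'. adjacent F a b c F' a' b' c' \<Longrightarrow> 0 \<le> slope q F a b c + slope q F' a' b' c'"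
    and x: "x \<in> M" "x \<notin> Sing M"
  obtains d h P \<beta> P' \<beta>' where "disc_chart M x d h"
    "\<And>p. p \<in> M \<Longrightarrow> dist x p < d \<Longrightarrow> ext q p = min (Qf P \<beta> (h p)) (Qf P' \<beta>' (h p))"
proof -
  obtain d h where h: "disc_chart M x d h" using disc_chart_ex x by blast
  have "x \<in> \<Union>(faces T) \<or> x \<in> \<Union>(edges T)" using M_eq x by blast
  then show thesis
  proof
    assume "x \<in> \<Union>(faces T)"
    then obtain F where F: "F \<in> faces T" "x \<in> F" by blast
    obtain e P b where e: "0 < e" "e \<le> d" "\<And>y. y \<in> M \<Longrightarrow> dist x y < e \<Longrightarrow> ext q y = Qf P b (h y)"
      by (rule ext_near_face[OF F h, of q]) blast
    show thesis
      by (rule that[OF disc_chart_shrink[OF h e(1,2)], of P b P b]) (simp add: e(3))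
  next
    assume "x \<in> \<Union>(edges T)"
    then obtain E where E: "E \<in> edges T" "x \<in> E" by blast
    then obtain F a b c F' a' b' c' where adj: "adjacent F a b c F' a' b' c'" "ch F ` open_segment a b = E"
      by (rule edge_adjacent)
    have xE: "x \<in> ch F ` open_segment a b" using adj(2) E(2) by simp
    obtain e N P P' where e: "0 < e" "e \<le> d" and N: "norm N = 1"
      and up0: "\<forall>p\<in>M. dist x p < e \<longrightarrow> 0 \<le> (h p - h x) \<bullet> N \<longrightarrow> ext q p = Qf P (cb q F) (h p)"
      and dn0: "\<forall>p\<in>M. dist x p < e \<longrightarrow> (h p - h x) \<bullet> N \<le> 0 \<longrightarrow> ext q p = Qf P' (cb q F') (h p)"
      and df: "\<forall>z. Qf P (cb q F) z - Qf P' (cb q F') z =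
         - 2 * (slope q F a b c + slope q F' a' b' c') * ((z - h x) \<bullet> N)"
      by (rule ext_near_edge[OF adj(1) xE h, of q]) (rule that; assumption)
    note up = up0[rule_format] and dn = dn0[rule_format]
    show thesis
    proof (rule that[OF disc_chart_shrink[OF h e], of P "cb q F" P' "cb q F'"])
      fix p assume p: "p \<in> M" "dist x p < e"
      define l where "l = slope q F a b c + slope q F' a' b' c'"
      have l: "0 \<le> l" unfolding l_def by (rule sl[OF adj(1)])
      have df': "Qf P (cb q F) (h p) - Qf P' (cb q F') (h p) = - 2 * (l * ((h p - h x) \<bullet> N))"
        using df[rule_format, of "h p"] unfolding l_def by (simp only: mult.assoc)
      show "ext q p = min (Qf P (cb q F) (h p)) (Qf P' (cb q F') (h p))"
      proof (cases "0 \<le> (h p - h x) \<bullet> N")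
        case True
        then have "0 \<le> l * ((h p - h x) \<bullet> N)" using l by (rule mult_nonneg_nonneg[rotated])
        then show ?thesis using up[OF p True] df' by simp
      next
        case False
        then have "l * ((h p - h x) \<bullet> N) \<le> 0" using l by (intro mult_nonneg_nonpos) auto
        then show ?thesis using dn[OF p] False df' by simp
      qed
    qed
  qed
qed

text \<open>Along an arc, a Q-function minus the squared arc length is affine. The interior of the
  arc avoids singular points, so the restricted function is locally a minimum of two affine
  ones.\<close>

lemma slope_imp_Q_concave:
  assumes sl: "\<And>F a b c F' a' b' c'. adjacent F a b c F' a' b' c' \<Longrightarrow> 0 \<le> slope q F a b c + slope q F' a' b' c'"
  shows "Q_concave M (ext q)"
  unfolding Q_concave_def
proof (intro conjI allI impI)
  show "PQ_function M (ext q)" unfolding PQ_function_def using geod ext_PQ by blast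
  fix L \<gamma> assume g: "geodesic_arc M L \<gamma>"
  have gM: "\<gamma> t \<in> M" if "t \<in> {0..L}" for t using g that unfolding geodesic_arc_def by blast
  have loc: "\<exists>\<epsilon>>0. \<forall>s\<in>{0..L} \<inter> ball t \<epsilon>. \<forall>s'\<in>{0..L} \<inter> ball t \<epsilon>. dist (\<gamma> s) (\<gamma> s') = \<bar>s - s'\<bar>"
    if "t \<in> {0..L}" for t using g that unfolding geodesic_arc_def by blast
  show "concave_on {0..L} (\<lambda>t. ext q (\<gamma> t) - t\<^sup>2)"
  proof (rule concave_on_local)
    note geodesic_arc_continuous[OF g]
    then have "continuous_on {0..L} (\<lambda>t. ext q (\<gamma> t))"
      by (rule continuous_on_compose2[OF ext_continuous]) (use gM in blast)
    then show "continuous_on {0..L} (\<lambda>t. ext q (\<gamma> t) - t\<^sup>2)" by (intro continuous_intros)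
  next
    fix t0 assume t0: "0 < t0" "t0 < L"
    define x where "x = \<gamma> t0"
    have "t0 \<in> {0..L}" "t0 \<in> {0<..<L}" using t0 by auto
    then have x: "x \<in> M" "x \<notin> Sing M" using g unfolding geodesic_arc_def x_def by blast+
    obtain d h P \<beta> P' \<beta>' where h: "disc_chart M x d h" and
      mn: "\<And>p. p \<in> M \<Longrightarrow> dist x p < d \<Longrightarrow> ext q p = min (Qf P \<beta> (h p)) (Qf P' \<beta>' (h p))"
      by (rule ext_near_min[OF sl x]) blast+
    obtain \<epsilon> where \<epsilon>: "\<epsilon> > 0" "\<forall>s\<in>{0..L} \<inter> ball t0 \<epsilon>. \<forall>s'\<in>{0..L} \<inter> ball t0 \<epsilon>. dist (\<gamma> s) (\<gamma> s') = \<bar>s - s'\<bar>"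
      using loc[OF \<open>t0 \<in> {0..L}\<close>] by blast
    define e where "e = min (min \<epsilon> d) (min t0 (L - t0))"
    have e: "e > 0" "e \<le> \<epsilon>" "e \<le> d" "e \<le> t0" "e \<le> L - t0"
      using \<epsilon> t0 disc_chart_pos[OF h] by (auto simp: e_def)
    have near: "s \<in> {0..L} \<inter> ball t0 \<epsilon>" if "\<bar>s - t0\<bar> < e" for s
      using that e by (auto simp: dist_real_def)
    have dg: "dist (\<gamma> s) (\<gamma> s') = \<bar>s - s'\<bar>" if "\<bar>s - t0\<bar> < e" "\<bar>s' - t0\<bar> < e" for s s'
      using \<epsilon>(2) near[OF that(1)] near[OF that(2)] by blast
    have inb: "\<gamma> s \<in> M \<and> dist x (\<gamma> s) < d" if "\<bar>s - t0\<bar> < e" for s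
      using gM[of s] near[OF that] dg[of t0 s] that e by (auto simp: x_def abs_minus_commute)
    have "dist (h (\<gamma> s)) (h (\<gamma> s')) = \<bar>s - s'\<bar>" if "\<bar>s - t0\<bar> < e" "\<bar>s' - t0\<bar> < e" for s s'
      using disc_chart_dist[OF h, of "\<gamma> s" "\<gamma> s'"] inb[OF that(1)] inb[OF that(2)] dg[OF that] by simp
    then obtain u where u: "norm u = 1" "\<And>s. \<bar>s - t0\<bar> < e \<Longrightarrow> h (\<gamma> s) = h (\<gamma> t0) + (s - t0) *\<^sub>R u"
      using segment_isometry[OF e(1), of t0 "\<lambda>s. h (\<gamma> s)"] by blast
    have uu: "u \<bullet> u = 1" using u by (simp add: norm_eq_sqrt_inner)
    have Q: "Qf p b (h x + (s - t0) *\<^sub>R u) - s\<^sup>2 =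
       (Qf p b (h x) + t0\<^sup>2 + 2 * t0 * (u \<bullet> (p - h x))) + (- 2 * t0 - 2 * (u \<bullet> (p - h x))) * s" for p b s
      unfolding Qf_expand using uu by (simp add: power2_eq_square algebra_simps)
    have "ext q (\<gamma> s) - s\<^sup>2 =
        min ((Qf P \<beta> (h x) + t0\<^sup>2 + 2 * t0 * (u \<bullet> (P - h x))) + (- 2 * t0 - 2 * (u \<bullet> (P - h x))) * s)
          ((Qf P' \<beta>' (h x) + t0\<^sup>2 + 2 * t0 * (u \<bullet> (P' - h x))) + (- 2 * t0 - 2 * (u \<bullet> (P' - h x))) * s)"
      if s: "\<bar>s - t0\<bar> < e" for s
    proof -
      have "ext q (\<gamma> s) = min (Qf P \<beta> (h x + (s - t0) *\<^sub>R u)) (Qf P' \<beta>' (h x + (s - t0) *\<^sub>R u))"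
        using mn[of "\<gamma> s"] inb[OF s] u(2)[OF s] by (simp add: x_def)
      then have "ext q (\<gamma> s) - s\<^sup>2 = min (Qf P \<beta> (h x + (s - t0) *\<^sub>R u) - s\<^sup>2) (Qf P' \<beta>' (h x + (s - t0) *\<^sub>R u) - s\<^sup>2)"
        by (simp add: min_def)
      then show ?thesis unfolding Q .
    qed
    then show "\<exists>e>0. \<exists>A B A' B'. \<forall>s. \<bar>s - t0\<bar> < e \<longrightarrow> ext q (\<gamma> s) - s\<^sup>2 = min (A + B * s) (A' + B' * s)"
      using e(1) by blast
  qed
qed

end

section \<open>Positive Q-concave functions come from pyramids\<close>

text \<open>At a nearest corner \<open>a\<close>, \<open>u\<close> and \<open>v\<close> are the
  directions of the two sides and \<open>n\<close> is the inward normal of the first. If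
  \<open>s\<close> were nonnegative, then \<open>(p - a) \<bullet> v = k * \<alpha> + d * s\<close>
  would be at least \<alpha>, with equality only for \<open>p = a\<close>. So the better of the two
  sides has \<open>p\<close> strictly outside it.\<close>

lemma closest_vertex_direction:
  assumes ab: "p - a = \<alpha> *\<^sub>R u + s *\<^sub>R n" and un: "norm u = 1" "norm n = 1" "u \<bullet> n = 0"
    and v: "v = k *\<^sub>R u + d *\<^sub>R n" "norm v = 1" "0 < d"
    and pa: "p \<noteq> a" "\<alpha> \<le> 0" "(p - a) \<bullet> v \<le> \<alpha>"
  shows "s < 0"
proof (rule ccontr)
  assume "\<not> s < 0"
  then have s: "0 \<le> s" by simp
  have uu: "u \<bullet> u = 1" "n \<bullet> n = 1" "n \<bullet> u = 0" using un by (simp_all add: norm_eq_sqrt_inner inner_commute)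
  have "v \<bullet> v = 1" using v(2) by (simp add: norm_eq_sqrt_inner)
  then have kd: "k * k + d * d = 1" unfolding v(1) using uu un(3) by (simp add: inner_add_left inner_add_right)
  have "k < 1"
  proof (rule ccontr)
    assume "\<not> k < 1"
    then have "1 \<le> k * k" using mult_mono[of 1 k 1 k] by simp
    moreover have "0 < d * d" using v(3) by simp
    ultimately show False using kd by linarith
  qed
  have "(p - a) \<bullet> v = k * \<alpha> + d * s" unfolding ab v(1) using uu un(3) by (simp add: inner_add_left inner_add_right mult.commute)
  then have le: "d * s \<le> \<alpha> * (1 - k)" using pa(3) by (simp add: algebra_simps)
  have "\<alpha> * (1 - k) \<le> 0" using pa(2) \<open>k < 1\<close> by (intro mult_nonpos_nonneg) auto
  moreover have "0 \<le> d * s" using v(3) s by simp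
  ultimately have "d * s = 0" "\<alpha> * (1 - k) = 0" using le by linarith+
  then have "s = 0" "\<alpha> = 0" using v(3) \<open>k < 1\<close> by auto
  then show False using ab pa(1) by simp
qed

text \<open>The situation after crossing: \<open>w\<close> now points to the inner side of
  \<open>u\<close>, and turning from \<open>u\<close> to the other side \<open>v\<close> strictly
  increases the product with \<open>w\<close>.\<close>

lemma next_direction_better:
  assumes w: "w = \<alpha> *\<^sub>R u + s *\<^sub>R n" and un: "norm u = 1" "norm n = 1" "u \<bullet> n = 0"
    and v: "v = k *\<^sub>R u + d *\<^sub>R n" "norm v = 1" "0 < d" and "\<alpha> \<le> 0" "0 < s"
  shows "\<alpha> < w \<bullet> v"
proof -
  have uu: "u \<bullet> u = 1" "n \<bullet> n = 1" "n \<bullet> u = 0" using un by (simp_all add: norm_eq_sqrt_inner inner_commute)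
  have "v \<bullet> v = 1" using v(2) by (simp add: norm_eq_sqrt_inner)
  then have kd: "k * k + d * d = 1" unfolding v(1) using uu un(3) by (simp add: inner_add_left inner_add_right)
  have "k \<le> 1"
  proof (rule ccontr)
    assume "\<not> k \<le> 1"
    then have "1 \<le> k * k" using mult_mono[of 1 k 1 k] by simp
    moreover have "0 < d * d" using v(3) by simp
    ultimately show False using kd by linarith
  qed
  have "w \<bullet> v = k * \<alpha> + d * s" unfolding w v(1) using uu un(3) by (simp add: inner_add_left inner_add_right mult.commute)
  moreover have "0 \<le> (- \<alpha>) * (1 - k)" using assms \<open>k \<le> 1\<close> by (intro mult_nonneg_nonneg) auto
  then have "\<alpha> \<le> k * \<alpha>" by (simp add: algebra_simps)
  moreover have "0 < d * s" using assms by simp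
  ultimately show ?thesis by linarith
qed

context triangulated
begin

lemma vertex_frame:
  assumes c: "corner F a b c"
  defines "u \<equiv> (1 / norm (b - a)) *\<^sub>R (b - a)" and "v \<equiv> (1 / norm (c - a)) *\<^sub>R (c - a)" and "n \<equiv> inn a b c"
  shows "norm u = 1" "norm n = 1" "u \<bullet> n = 0" "norm v = 1" "0 < v \<bullet> n"
    "w = (w \<bullet> u) *\<^sub>R u + (w \<bullet> n) *\<^sub>R n"
proof -
  have ab: "a \<noteq> b" "a \<noteq> c" using corner_distinct[OF c] by blast+
  show u: "norm u = 1" and "norm v = 1" using ab by (simp_all add: u_def v_def)
  show n: "norm n = 1" using inn_norm[OF corner_nc[OF c]] by (simp add: n_def)
  show un: "u \<bullet> n = 0" using inn_orth[of a b c] by (simp add: u_def n_def inner_commute)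
  show "w = (w \<bullet> u) *\<^sub>R u + (w \<bullet> n) *\<^sub>R n" by (rule orthonormal_expansion[OF u n un])
  show "0 < v \<bullet> n" using hgt_c[OF corner_nc[OF c]] ab by (simp add: v_def n_def hgt_def)
qed

lemma tri_convex: "F \<in> faces T \<Longrightarrow> convex (tri F)"
  by (simp add: tri_def triangle_def)

text \<open>The neighbour's slope is at least \<open>- slope\<close>, which is positive, so its
  square is at least as large; as \<open>slope\<^sup>2 + cb\<close> agrees, its \<open>cb\<close> is
  at most that of \<open>F\<close>. Minimality forces equality, the slopes are opposite, and the
  unfolded Q-functions have the same center.\<close>

lemma cross_edge:
  assumes conc: "Q_concave M (ext q)" and c: "corner F a b c" and s: "slope q F a b c < 0"
    and mn: "\<And>F'. F' \<in> faces T \<Longrightarrow> cb q F \<le> cb q F'"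
  obtains F' c' R where "rigid R" "corner F' (R a) (R b) c'" "cb q F' = cb q F" "R (cp q F) = cp q F'"
    "lin R (inn a b c) = - inn (R a) (R b) c'"
proof -
  obtain F' c' R where R: "rigid R" and adj: "adjacent F a b c F' (R a) (R b) c'"
    and n: "lin R (inn a b c) = - inn (R a) (R b) c'"
    and glue: "\<And>y. y \<in> closed_segment a b \<Longrightarrow> ch F' (R y) = ch F y"
    by (rule adjacent_gluing[OF c]) blast
  have c': "corner F' (R a) (R b) c'" using adj by (simp add: adjacent_def)
  have "a \<noteq> b" using corner_distinct[OF c] by blast
  then obtain y where "y \<in> open_segment a b" using open_segment_eq_empty[of a b] by blast
  then have x: "ch F y \<in> ch F ` open_segment a b" by blast
  have "ch F y \<in> M \<and> ch F y \<notin> Sing M" using edge_sing[OF corner_props(1)[OF c] x] by blast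
  then obtain d h where h: "disc_chart M (ch F y) d h" using disc_chart_ex by blast
  have sq: "(slope q F a b c)\<^sup>2 + cb q F = (slope q F' (R a) (R b) c')\<^sup>2 + cb q F'"
    by (rule ext_near_edge[OF adj x h, of q])
  define s1 where "s1 = slope q F a b c"
  define s2 where "s2 = slope q F' (R a) (R b) c'"
  have ge: "0 \<le> s1 + s2" unfolding s1_def s2_def by (rule Q_concave_imp_slope[OF conc adj])
  have s1: "s1 < 0" using s by (simp add: s1_def)
  have le: "(- s1)\<^sup>2 \<le> s2\<^sup>2" using ge s1 by (intro power_mono) auto
  have cbF: "cb q F \<le> cb q F'" by (rule mn[OF corner_face[OF c']])
  have sq': "s1\<^sup>2 + cb q F = s2\<^sup>2 + cb q F'" using sq by (simp add: s1_def s2_def)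
  have le': "s1\<^sup>2 \<le> s2\<^sup>2" using le by simp
  have cbe: "cb q F' = cb q F" using sq' le' cbF by linarith
  then have "(- s1)\<^sup>2 = s2\<^sup>2" using sq' by simp
  then have s2: "s2 = - s1" using ge s1 by (simp add: power2_eq_iff)
  define p' where "p' = inv R (cp q F')"
  have Rp': "R p' = cp q F'" using R by (simp add: p'_def)
  have Q: "Qf p' (cb q F) z = Qf (cp q F) (cb q F) z" if z: "z \<in> closed_segment a b" for z
    using QF_glue[OF adj R glue z, of q] Qf_rigid[OF R, of p' "cb q F" z] Rp' cbe by simp
  define w where "w = p' - cp q F"
  have "Qf p' (cb q F) b - Qf (cp q F) (cb q F) b = 2 * ((cp q F - p') \<bullet> (b - a)) + (Qf p' (cb q F) a - Qf (cp q F) (cb q F) a)"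
    by (rule Qf_diff)
  then have "(cp q F - p') \<bullet> (b - a) = 0" using Q[of a] Q[of b] by simp
  then have w1: "w \<bullet> (b - a) = 0" by (simp add: w_def inner_diff_left)
  have "(p' - a) \<bullet> inn a b c = lin R (p' - a) \<bullet> lin R (inn a b c)" by (simp only: lin_inner[OF R])
  also have "\<dots> = (cp q F' - R a) \<bullet> (- inn (R a) (R b) c')" by (simp only: n lin_diff[OF R, symmetric] Rp')
  also have "\<dots> = s1" using s2 by (simp add: s2_def slope_def hgt_def)
  finally have "w \<bullet> inn a b c = 0" by (simp add: w_def s1_def slope_def hgt_def inner_diff_left)
  then have "w = 0" using orthogonal_to_side[OF corner_nc[OF c] w1] by simp
  then have "R (cp q F) = cp q F'" using Rp' by (simp add: w_def)
  then show thesis using that[OF R c' cbe _ n] by blast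
qed

lemma closer_point:
  assumes c: "corner F a b c" and y: "y \<in> open_segment a b" and p: "p = y + s *\<^sub>R inn a b c" "0 < s"
  shows "\<exists>z\<in>tri F. dist p z < s"
proof -
  note nc = corner_nc[OF c]
  obtain e where e: "e > 0" "\<forall>z\<in>ball y e. (z \<in> convex hull {a, b, c} \<longleftrightarrow> 0 \<le> hgt a b c z)"
    using triangle_near_side[OF nc y] by blast
  define t where "t = min (e/2) (s/2)"
  have t: "0 < t" "t < e" "t < s" using e p by (auto simp: t_def)
  define z where "z = y + t *\<^sub>R inn a b c"
  have n: "norm (inn a b c) = 1" "inn a b c \<bullet> inn a b c = 1"
    using inn_norm[OF nc] by (simp_all add: norm_eq_sqrt_inner)
  have "hgt a b c z = t" unfolding hgt_on_side(2)[OF nc y] using n by (simp add: z_def)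
  moreover have "z \<in> ball y e" using t n by (simp add: z_def dist_norm)
  ultimately have "z \<in> tri F" unfolding corner_tri[OF c] using e(2) t by simp
  moreover have "p - z = (s - t) *\<^sub>R inn a b c" by (simp add: p z_def algebra_simps)
  then have "dist p z < s" using t n by (simp add: dist_norm)
  ultimately show ?thesis by blast
qed

text \<open>
  Lexicographic descent: a face with minimal \<open>cb \<le> 0\<close>, then with minimal distance from \<open>cp\<close> to the
  triangle.  The nearest point is not inside a side, since crossing this side
  decreases the distance.  At a vertex, choose the edge direction making the smallest angle with the
  direction to \<open>cp\<close>; crossing this edge gives a better one.
\<close>

lemma positive_imp_cb_pos:
  assumes conc: "Q_concave M (ext q)" and pos: "\<And>x. x \<in> M \<Longrightarrow> 0 < ext q x" and G: "G \<in> faces T"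
  shows "0 < cb q G"
proof (rule ccontr)
  assume G0: "\<not> 0 < cb q G"
  define \<beta> where "\<beta> = Min (cb q ` faces T)"
  define B where "B = {F \<in> faces T. cb q F = \<beta>}"
  have fin: "finite (faces T)" "finite B" using finite_T by (simp_all add: B_def)
  have \<beta>_le: "\<beta> \<le> cb q F" if "F \<in> faces T" for F
    unfolding \<beta>_def using fin that by simp
  have \<beta>0: "\<beta> \<le> 0" using \<beta>_le[OF G] G0 by simp
  have "\<beta> \<in> cb q ` faces T" unfolding \<beta>_def using fin G by (intro Min_in) auto
  then have Bne: "B \<noteq> {}" by (auto simp: B_def)
  define \<delta> where "\<delta> F = infdist (cp q F) (tri F)" for F
  define m where "m = Min (\<delta> ` B)"
  have m_le: "m \<le> dist (cp q F) z" if "F \<in> B" "z \<in> tri F" for F z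
  proof -
    have "m \<le> \<delta> F" unfolding m_def using fin that by simp
    also have "\<dots> \<le> dist (cp q F) z" unfolding \<delta>_def by (rule infdist_le[OF that(2)])
    finally show ?thesis .
  qed
  have mn: "cb q F \<le> cb q F'" if "F \<in> B" "F' \<in> faces T" for F F'
    using \<beta>_le[OF that(2)] that(1) by (simp add: B_def)
  have cross: "\<exists>F' c' R. rigid R \<and> corner F' (R a) (R b) c' \<and> F' \<in> B \<and> R (cp q F) = cp q F' \<and>
      lin R (inn a b c) = - inn (R a) (R b) c'"
    if c: "corner F a b c" "F \<in> B" "slope q F a b c < 0" for F a b c
  proof -
    obtain F' c' R where "rigid R" "corner F' (R a) (R b) c'" "cb q F' = cb q F" "R (cp q F) = cp q F'"
      "lin R (inn a b c) = - inn (R a) (R b) c'"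
      by (rule cross_edge[OF conc c(1,3) mn[OF c(2)]])
    moreover have "F' \<in> B" using calculation c(2) corner_face by (simp add: B_def)
    ultimately show ?thesis by blast
  qed
  have "m \<in> \<delta> ` B" unfolding m_def using fin Bne by (intro Min_in) auto
  then obtain F0 where F0: "F0 \<in> B" "\<delta> F0 = m" by auto
  have F0f: "F0 \<in> faces T" using F0 by (simp add: B_def)
  have tne: "tri F0 \<noteq> {}" using corner_props(6)[OF corner_ex[OF F0f]] by blast
  obtain y where y: "y \<in> tri F0" "\<delta> F0 = dist (cp q F0) y"
    using infdist_attains_inf[OF compact_imp_closed[OF tri_compact[OF F0f]] tne] unfolding \<delta>_def by blast
  have ym: "dist (cp q F0) y = m" using y F0 by simp
  \<comment> \<open>At its center the Q-function takes the value \<open>cb q F\<close>, which here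
    is \<open>\<beta> \<le> 0\<close>.\<close>
  have outside: "cp q F \<notin> tri F" if "F \<in> B" for F
  proof
    assume in_t: "cp q F \<in> tri F"
    have F: "F \<in> faces T" using that by (simp add: B_def)
    have "ext q (ch F (cp q F)) = cb q F" using ext_ch[OF F in_t, of q] by (simp add: Qf_def)
    then show False using pos[OF ch_M[OF F in_t]] that \<beta>0 by (simp add: B_def)
  qed
  have m0: "0 < m"
  proof -
    have "cp q F0 \<noteq> y" using outside[OF F0(1)] y(1) by blast
    then show ?thesis using ym zero_less_dist_iff[of "cp q F0" y] by simp
  qed
  \<comment> \<open>The obtuse angle criterion for a nearest point of a convex set.\<close>
  have dot: "(cp q F - v) \<bullet> (z - v) \<le> 0" if "F \<in> B" "v \<in> tri F" "dist (cp q F) v = m" "z \<in> tri F" for F v z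
  proof -
    have F: "F \<in> faces T" using that by (simp add: B_def)
    show ?thesis
      by (rule any_closest_point_dot[OF tri_convex[OF F] compact_imp_closed[OF tri_compact[OF F]] that(2,4)])
        (use m_le[OF that(1)] that(3) in simp)
  qed
  from F0f y(1) obtain a0 b0 c0 where y0: "corner F0 a0 b0 c0" "y = a0"
  proof (cases rule: tri_point_cases)
    case face
    define w where "w = cp q F0 - y"
    obtain e where e: "e > 0" "ball y e \<subseteq> interior (tri F0)" using face(1) open_interior openE by blast
    obtain t where t: "t > 0" "norm (t *\<^sub>R w) < e" using small_multiple[OF e(1), of w] by blast
    have "y + t *\<^sub>R w \<in> ball y e" using t by (simp add: dist_norm)
    then have "y + t *\<^sub>R w \<in> tri F0" using e(2) interior_subset by blast
    then have "w \<bullet> (t *\<^sub>R w) \<le> 0" using dot[OF F0(1) y(1) ym, of "y + t *\<^sub>R w"] by (simp add: w_def)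
    then have "w \<bullet> w \<le> 0" using t(1) by (simp add: mult_le_0_iff)
    then have "w = 0" using inner_ge_zero[of w] by simp
    then show ?thesis using m0 ym by (simp add: w_def)
  next
    case (edge a b c)
    \<comment> \<open>With the nearest point inside a side, the center lies perpendicularly outside,
      at height \<open>- m\<close>. Seen from the neighbouring face it lies at height
      \<open>m\<close> on the inner side, so this triangle has points closer than
      \<open>m\<close>.\<close>
    note nc = corner_nc[OF edge(1)]
    define w where "w = cp q F0 - y"
    obtain u where u: "0 < u" "u < 1" "y = (1 - u) *\<^sub>R a + u *\<^sub>R b" using edge(2) by (auto simp: in_segment)
    have verts: "a \<in> tri F0" "b \<in> tri F0" "c \<in> tri F0"
      using corner_props(6)[OF edge(1)] corner_props(6)[OF corner_perm(1)[OF edge(1)]]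
        corner_props(6)[OF corner_perm(1)[OF corner_perm(2)[OF edge(1)]]] by blast+
    have "a - y = (- u) *\<^sub>R (b - a)" "b - y = (1 - u) *\<^sub>R (b - a)" by (simp_all add: u(3) algebra_simps)
    then have "(- u) * (w \<bullet> (b - a)) \<le> 0" "(1 - u) * (w \<bullet> (b - a)) \<le> 0"
      using dot[OF F0(1) y(1) ym verts(1)] dot[OF F0(1) y(1) ym verts(2)] by (simp_all only: w_def inner_scaleR_right)
    then have "w \<bullet> (b - a) = 0" using u by (simp add: mult_le_0_iff zero_le_mult_iff)
    then have w: "w = (w \<bullet> inn a b c) *\<^sub>R inn a b c" by (rule orthogonal_to_side[OF nc])
    define s where "s = w \<bullet> inn a b c"
    have ws: "w = s *\<^sub>R inn a b c" using w by (simp add: s_def)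
    have "s * hgt a b c c = w \<bullet> (c - y)"
      by (subst ws) (simp add: hgt_on_side(2)[OF nc edge(2)] inner_commute)
    then have "s * hgt a b c c \<le> 0" using dot[OF F0(1) y(1) ym verts(3)] by (simp add: w_def)
    then have "s \<le> 0" using hgt_c[OF nc] by (simp add: mult_le_0_iff)
    moreover have nw: "norm w = m" using ym by (simp add: w_def dist_norm)
    then have sm: "\<bar>s\<bar> = m" using ws inn_norm[OF nc] by simp
    ultimately have s: "s = - m" using m0 by linarith
    have "slope q F0 a b c = s"
      unfolding slope_def hgt_on_side(2)[OF nc edge(2)] by (simp add: s_def w_def)
    then have "slope q F0 a b c < 0" using s m0 by simp
    then obtain F' c' R where R: "rigid R" "corner F' (R a) (R b) c'" "F' \<in> B" "R (cp q F0) = cp q F'"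
      "lin R (inn a b c) = - inn (R a) (R b) c'" using cross[OF edge(1) F0(1)] by blast
    have "R y \<in> open_segment (R a) (R b)" using edge(2) rigid_open_segment[OF R(1), of a b] by blast
    moreover have "cp q F' = R y + m *\<^sub>R inn (R a) (R b) c'"
      using rigid_eq[OF R(1), of "cp q F0" y] ws lin_scaleR[OF R(1), of s "inn a b c"] R(4,5) s by (simp add: w_def)
    ultimately obtain z where "z \<in> tri F'" "dist (cp q F') z < m"
      using closer_point[OF R(2) _ _ m0] by blast
    then show ?thesis using m_le[OF R(3)] by fastforce
  next
    case (vertex a b c) then show ?thesis using that by blast
  qed
  \<comment> \<open>Flags at a nearest corner \<open>a\<close>; the pair \<open>b\<close>,
    \<open>c\<close> is ordered, \<open>ab\<close> being the side to be tested. There are finitely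
    many, so a maximum of \<open>val\<close> exists.\<close>
  define X where "X = {(F, a, b, c). corner F a b c \<and> F \<in> B \<and> dist (cp q F) a = m}"
  define V where "V = (\<Union>F\<in>faces T. {vt F 0, vt F 1, vt F 2})"
  have "finite V" using fin by (simp add: V_def)
  have "X \<subseteq> faces T \<times> V \<times> V \<times> V"
    by (auto simp: X_def corner_def V_def)
  then have finX: "finite X" by (rule finite_subset) (intro finite_cartesian_product fin(1) \<open>finite V\<close>)
  have "(F0, a0, b0, c0) \<in> X" using y0 F0(1) ym by (simp add: X_def)
  then have Xne: "X \<noteq> {}" by blast
  \<comment> \<open>On \<open>X\<close> this is \<open>m\<close> times the cosine of the angle
    between the side \<open>ab\<close> and the direction from \<open>a\<close> to the
    center.\<close>
  define val where "val = (\<lambda>(F, a, b, c :: real^2). (cp q F - a) \<bullet> ((1 / norm (b - a)) *\<^sub>R (b - a)))"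
  have "Max (val ` X) \<in> val ` X" using finX Xne by (intro Max_in) auto
  then obtain F a b c where X1: "(F, a, b, c) \<in> X" "val (F, a, b, c) = Max (val ` X)" by auto
  have best: "val t \<le> val (F, a, b, c)" if "t \<in> X" for t
    unfolding X1(2) using finX that by simp
  have c: "corner F a b c" and FB: "F \<in> B" and da: "dist (cp q F) a = m" using X1 by (auto simp: X_def)
  define u where "u = (1 / norm (b - a)) *\<^sub>R (b - a)"
  define v where "v = (1 / norm (c - a)) *\<^sub>R (c - a)"
  define n where "n = inn a b c"
  note fr = vertex_frame[OF c, folded u_def v_def n_def]
  define \<alpha> where "\<alpha> = (cp q F - a) \<bullet> u"
  have v\<alpha>: "val (F, a, b, c) = \<alpha>" by (simp add: val_def \<alpha>_def u_def)
  have c2: "corner F a c b" using corner_perm(2)[OF c] .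
  have "(F, a, c, b) \<in> X" using c2 FB da by (simp add: X_def)
  then have "(cp q F - a) \<bullet> v \<le> \<alpha>" using best[of "(F, a, c, b)"] v\<alpha> by (simp add: val_def v_def)
  moreover have "\<alpha> \<le> 0"
  proof -
    have "(cp q F - a) \<bullet> (b - a) \<le> 0"
      by (rule dot[OF FB corner_props(6)[OF c] da corner_props(6)[OF corner_perm(1)[OF c]]])
    then show ?thesis by (simp add: \<alpha>_def u_def divide_nonpos_nonneg)
  qed
  moreover have "cp q F \<noteq> a" using da m0 by auto
  ultimately have "(cp q F - a) \<bullet> n < 0"
    using closest_vertex_direction[of "cp q F" a \<alpha> u "(cp q F - a) \<bullet> n" n v "v \<bullet> u" "v \<bullet> n"] fr(1-5)
      fr(6)[of "cp q F - a"] fr(6)[of v] by (simp add: \<alpha>_def)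
  then have "slope q F a b c < 0" by (simp add: slope_def hgt_def n_def)
  then obtain F' c' R where R: "rigid R" and c': "corner F' (R a) (R b) c'" and F'B: "F' \<in> B"
    and Rp: "R (cp q F) = cp q F'" and Rn: "lin R (inn a b c) = - inn (R a) (R b) c'"
    using cross[OF c FB] by blast
  define u' where "u' = (1 / norm (R b - R a)) *\<^sub>R (R b - R a)"
  define v' where "v' = (1 / norm (c' - R a)) *\<^sub>R (c' - R a)"
  define n' where "n' = inn (R a) (R b) c'"
  note fr' = vertex_frame[OF c', folded u'_def v'_def n'_def]
  have u': "u' = lin R u"
    using lin_norm[OF R, of "b - a"] lin_diff[OF R, of b a] by (simp add: u'_def u_def lin_scaleR[OF R])
  have w': "cp q F' - R a = lin R (cp q F - a)" unfolding Rp[symmetric] by (rule lin_diff[OF R])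
  have \<alpha>': "(cp q F' - R a) \<bullet> u' = \<alpha>" unfolding w' u' lin_inner[OF R] by (simp add: \<alpha>_def)
  have "(cp q F' - R a) \<bullet> (- n') = (cp q F - a) \<bullet> n"
    unfolding w' n'_def Rn[symmetric] lin_inner[OF R] by (simp add: n_def)
  then have s': "0 < (cp q F' - R a) \<bullet> n'" using \<open>(cp q F - a) \<bullet> n < 0\<close> by simp
  \<comment> \<open>After crossing \<open>ab\<close> the center lies on its inner side, so the other
    side of \<open>F'\<close> at the same corner makes a smaller angle with it; its flag contradicts
    the maximality.\<close>
  have "\<alpha> < (cp q F' - R a) \<bullet> v'"
    using next_direction_better[of "cp q F' - R a" \<alpha> u' "(cp q F' - R a) \<bullet> n'" n' v' "v' \<bullet> u'" "v' \<bullet> n'"]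
      fr'(1-5) fr'(6)[of "cp q F' - R a"] fr'(6)[of v'] \<alpha>' s' \<open>\<alpha> \<le> 0\<close> by simp
  moreover have "(F', R a, c', R b) \<in> X"
    using corner_perm(2)[OF c'] F'B da rigidD[OF R, of "cp q F" a] Rp by (simp add: X_def)
  ultimately show False using best[of "(F', R a, c', R b)"] v\<alpha> by (simp add: val_def v'_def)
qed

section \<open>Dihedral angles of the pyramids\<close>

definition sq :: "('a \<Rightarrow> real) \<Rightarrow> 'a \<Rightarrow> real" where
  "sq r = (\<lambda>i\<in>Sing M. (r i)\<^sup>2)"

text \<open>The squared distance from \<open>(p, \<eta>)\<close> to a base point
  \<open>(x, 0)\<close> is \<open>Qf p (\<eta>\<^sup>2) x\<close>. So an apex with the given edge
  lengths is a Q-function with corner values \<open>sq r\<close> whose constant is a positive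
  square.\<close>

lemma face_apex_iff:
  assumes r: "\<forall>i\<in>Sing M. 0 < r i" and F: "F \<in> faces T"
  shows "face_apex M r F A \<longleftrightarrow> 0 < cb (sq r) F \<and> A = (cp (sq r) F, sqrt (cb (sq r) F))"
proof -
  obtain p \<eta> where A: "A = (p, \<eta>)" by (cases A) auto
  have vS: "ch F (vt F k) \<in> Sing M" if "k < 3" for k
    using chart_props(1)[OF F] that by (simp add: face_chart_def)
  have dist_iff: "dist A (vt F k, 0) = r (ch F (vt F k)) \<longleftrightarrow> Qf p (\<eta>\<^sup>2) (vt F k) = QF (sq r) F (vt F k)"
    if k: "k < 3" for k
  proof -
    have "dist A (vt F k, 0) = sqrt (Qf p (\<eta>\<^sup>2) (vt F k))"
      by (simp add: A dist_Pair_Pair Qf_def dist_norm norm_minus_commute norm_Pair)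
    moreover have "r (ch F (vt F k)) = sqrt (QF (sq r) F (vt F k))"
      using QF_vt[OF F k, of "sq r"] bspec[OF r vS[OF k]] vS[OF k] by (simp add: sq_def)
    ultimately show ?thesis by simp
  qed
  have nc: "\<not> collinear {vt F 0, vt F 1, vt F 2}" by (rule corner_nc[OF corner_ex[OF F]])
  have "face_apex M r F A \<longleftrightarrow> 0 < \<eta> \<and> (\<forall>k<3. dist A (vt F k, 0) = r (ch F (vt F k)))"
    by (simp add: face_apex_def chart_of_eq pyramid_apex_def A)
  also have "\<dots> \<longleftrightarrow> 0 < \<eta> \<and> (\<forall>k<3. Qf p (\<eta>\<^sup>2) (vt F k) = QF (sq r) F (vt F k))"
    using dist_iff by blast
  also have "\<dots> \<longleftrightarrow> 0 < \<eta> \<and> p = cp (sq r) F \<and> \<eta>\<^sup>2 = cb (sq r) F"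
  proof
    assume *: "0 < \<eta> \<and> (\<forall>k<3. Qf p (\<eta>\<^sup>2) (vt F k) = QF (sq r) F (vt F k))"
    then have v: "Qf p (\<eta>\<^sup>2) (vt F k) = QF (sq r) F (vt F k)" if "k < 3" for k using that by blast
    have "Qf p (\<eta>\<^sup>2) z = QF (sq r) F z" for z
      by (rule Qf_eq_on_triangle[OF nc v v v]) simp_all
    then show "0 < \<eta> \<and> p = cp (sq r) F \<and> \<eta>\<^sup>2 = cb (sq r) F"
      using Qf_unique[of 0 1 p "\<eta>\<^sup>2" "cp (sq r) F" "cb (sq r) F"] * by simp
  qed simp
  also have "\<dots> \<longleftrightarrow> 0 < cb (sq r) F \<and> A = (cp (sq r) F, sqrt (cb (sq r) F))"
  proof
    assume *: "0 < \<eta> \<and> p = cp (sq r) F \<and> \<eta>\<^sup>2 = cb (sq r) F"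
    then have h: "0 < \<eta>" "p = cp (sq r) F" "\<eta>\<^sup>2 = cb (sq r) F" by blast+
    have "0 < cb (sq r) F" unfolding h(3)[symmetric] using h(1) by (rule zero_less_power)
    moreover have "sqrt (cb (sq r) F) = \<eta>" unfolding h(3)[symmetric] using h(1) by simp
    ultimately show "0 < cb (sq r) F \<and> A = (cp (sq r) F, sqrt (cb (sq r) F))" using h(2) by (simp add: A)
  next
    assume "0 < cb (sq r) F \<and> A = (cp (sq r) F, sqrt (cb (sq r) F))"
    then show "0 < \<eta> \<and> p = cp (sq r) F \<and> \<eta>\<^sup>2 = cb (sq r) F" by (simp add: A)
  qed
  finally show ?thesis .
qed

lemma apex_of_eq:
  assumes r: "\<forall>i\<in>Sing M. 0 < r i" and F: "F \<in> faces T" and cb: "0 < cb (sq r) F"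
  shows "apex_of M r F = (cp (sq r) F, sqrt (cb (sq r) F))"
  unfolding apex_of_def
  by (rule the_equality) (use face_apex_iff[OF r F] cb in blast)+

lemma couple_iff:
  "(T, r) \<in> polytope_couples M \<longleftrightarrow> r \<in> extensional (Sing M) \<and> (\<forall>i\<in>Sing M. 0 < r i) \<and>
     (\<forall>F\<in>faces T. 0 < cb (sq r) F)"
proof -
  have "(\<forall>F\<in>faces T. \<exists>A. face_apex M r F A) \<longleftrightarrow> (\<forall>F\<in>faces T. 0 < cb (sq r) F)" if "\<forall>i\<in>Sing M. 0 < r i"
    using face_apex_iff[OF that] by blast
  then show ?thesis using geod unfolding polytope_couples_def by blast
qed

lemma slope_swap: "slope q F b a c = slope q F a b c"
proof -
  have "(b - a) \<bullet> inn a b c = 0" using inn_orth[of a b c] by (simp add: inner_commute)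
  then have "(cp q F - b) \<bullet> inn a b c = (cp q F - a) \<bullet> inn a b c"
    by (simp add: inner_diff_left)
  then show ?thesis by (simp add: slope_def hgt_def inn_sym[of b a])
qed

lemma slope_side:
  assumes c: "corner F a b c" and c': "corner F a' b' c'" and eq: "open_segment a b = open_segment a' b'"
  shows "slope q F a' b' c' = slope q F a b c"
proof -
  have d: "a \<noteq> b" "a' \<noteq> b'" "c \<noteq> a" "c \<noteq> b" "c' \<noteq> a'" "c' \<noteq> b'"
    using corner_distinct[OF c] corner_distinct[OF c'] by blast+
  have s: "{a, b} = {a', b'}" using eq d by (simp add: open_segment_eq)
  have "{a, b, c} = {a', b', c'}" using c c' by (simp add: corner_def)
  then have "c' = c" using s d by blast
  moreover have "a' = a \<and> b' = b \<or> a' = b \<and> b' = a" using s by (auto simp: doubleton_eq_iff)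
  ultimately show ?thesis using slope_swap by auto
qed

text \<open>By \<open>adjacent_unique\<close> precisely two pairs of a face and a side index are
  glued to the edge. This holds also for \<open>F = F'\<close>, where the two indices
  differ.\<close>

lemma theta_eq:
  assumes r: "\<forall>i\<in>Sing M. 0 < r i" and cb: "\<forall>F\<in>faces T. 0 < cb (sq r) F"
    and adj: "adjacent F a b c F' a' b' c'"
  shows "theta M T r (ch F ` open_segment a b) =
    arccos (slope (sq r) F a b c / sqrt ((slope (sq r) F a b c)\<^sup>2 + cb (sq r) F)) +
    arccos (slope (sq r) F' a' b' c' / sqrt ((slope (sq r) F' a' b' c')\<^sup>2 + cb (sq r) F'))"
proof -
  define e where "e = ch F ` open_segment a b"
  define g where "g G k = dihedral_angle (vt G k, 0) (vt G ((k + 1) mod 3), 0) (vt G ((k + 2) mod 3), 0)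
    (apex_of M r G)" for G and k :: nat
  have gs: "g G k = arccos (slope (sq r) G x y z / sqrt ((slope (sq r) G x y z)\<^sup>2 + cb (sq r) G))"
    if G: "corner G x y z" "k < 3" "side (vt G) k = open_segment x y" for G k x y z
  proof -
    note F = corner_face[OF G(1)]
    define v0 v1 v2 where "v0 = vt G k" and "v1 = vt G ((k + 1) mod 3)" and "v2 = vt G ((k + 2) mod 3)"
    have c: "corner G v0 v1 v2" unfolding v0_def v1_def v2_def by (rule corner_side[OF F G(2)])
    have "open_segment v0 v1 = open_segment x y" using G(3) by (simp add: side_def v0_def v1_def)
    then have sl: "slope (sq r) G x y z = slope (sq r) G v0 v1 v2" by (rule slope_side[OF c G(1)])
    have "g G k = arccos (hgt v0 v1 v2 (cp (sq r) G) / sqrt ((hgt v0 v1 v2 (cp (sq r) G))\<^sup>2 + (sqrt (cb (sq r) G))\<^sup>2))"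
      unfolding g_def v0_def[symmetric] v1_def[symmetric] v2_def[symmetric] apex_of_eq[OF r F bspec[OF cb F]]
      using bspec[OF cb F] by (intro dihedral_angle_pyramid[OF corner_nc[OF c]]) simp
    then show ?thesis using bspec[OF cb F] sl by (simp add: slope_def)
  qed
  have c: "corner F a b c" and c': "corner F' a' b' c'" and im: "ch F' ` open_segment a' b' = e"
    and ne: "(F, open_segment a b) \<noteq> (F', open_segment a' b')" using adj by (auto simp: adjacent_def e_def)
  have kex: "\<exists>k<3. open_segment x y = side (vt G) k" if co: "corner G x y z" for G x y z
  proof -
    have "x \<in> {vt G 0, vt G 1, vt G 2}" "y \<in> {vt G 0, vt G 1, vt G 2}" using co by (auto simp: corner_def)
    moreover have "x \<noteq> y" using corner_distinct[OF co] by blast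
    ultimately obtain k where "k < 3" "open_segment x y = side (vt G) k" by (rule side_of_vertices[of x "vt G" y])
    then show ?thesis by blast
  qed
  obtain k where k: "k < 3" "open_segment a b = side (vt F) k" using kex[OF c] by blast
  obtain k' where k': "k' < 3" "open_segment a' b' = side (vt F') k'" using kex[OF c'] by blast
  \<comment> \<open>The double sum in \<open>theta\<close> becomes a sum over these pairs.\<close>
  define K where "K = (SIGMA G:faces T. {k. k < 3 \<and> ch G ` side (vt G) k = e})"
  have side_inj: "l = l'" if G: "G \<in> faces T" "l < 3" "l' < 3" "side (vt G) l = side (vt G) l'" for G l l'
  proof -
    have d: "vt G 0 \<noteq> vt G 1" "vt G 1 \<noteq> vt G 2" "vt G 0 \<noteq> vt G 2"
      using corner_distinct[OF corner_ex[OF G(1)]] by blast+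
    have s: "side (vt G) 0 \<noteq> side (vt G) 1" "side (vt G) 1 \<noteq> side (vt G) 2" "side (vt G) 0 \<noteq> side (vt G) 2"
      using d by (auto simp: side_simps open_segment_eq doubleton_eq_iff)
    then show ?thesis using G(2-4) unfolding less_3_cases by metis
  qed
  have K: "K = {(F, k), (F', k')}"
  proof (intro equalityI subsetI)
    fix t assume "t \<in> K"
    then obtain G l where t: "t = (G, l)" "G \<in> faces T" "l < 3" "ch G ` side (vt G) l = e" by (auto simp: K_def)
    have co: "corner G (vt G l) (vt G ((l + 1) mod 3)) (vt G ((l + 2) mod 3))" by (rule corner_side[OF t(2,3)])
    have "(G, side (vt G) l) \<in> {(F, open_segment a b), (F', open_segment a' b')}"
      using adjacent_unique[OF adj co] t(4) unfolding side_def e_def by blast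
    then have "G = F \<and> side (vt F) l = side (vt F) k \<or> G = F' \<and> side (vt F') l = side (vt F') k'"
      using k(2) k'(2) by (auto dest: Pair_inject)
    then show "t \<in> {(F, k), (F', k')}"
      using side_inj[OF corner_face[OF c] t(3) k(1)] side_inj[OF corner_face[OF c'] t(3) k'(1)] t(1) by blast
  next
    fix t assume "t \<in> {(F, k), (F', k')}"
    moreover have "(F, k) \<in> K" using corner_face[OF c] k by (simp add: K_def e_def)
    moreover have "(F', k') \<in> K" using corner_face[OF c'] k' im by (simp add: K_def)
    ultimately show "t \<in> K" by blast
  qed
  have neK: "(F, k) \<noteq> (F', k')" using ne k(2) k'(2) by auto
  have "theta M T r e = (\<Sum>G\<in>faces T. \<Sum>k\<in>{k. k < 3 \<and> ch G ` side (vt G) k = e}. g G k)"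
    by (simp add: theta_def chart_of_eq g_def)
  also have "\<dots> = (\<Sum>(G, k)\<in>K. g G k)"
    unfolding K_def using finite_T(2) by (intro sum.Sigma) auto
  also have "\<dots> = g F k + g F' k'" unfolding K using neK by simp
  finally show ?thesis
    using gs[OF c k(1) k(2)[symmetric]] gs[OF c' k'(1) k'(2)[symmetric]] by (simp add: e_def)
qed

lemma slopes_sq:
  assumes adj: "adjacent F a b c F' a' b' c'"
  shows "(slope q F a b c)\<^sup>2 + cb q F = (slope q F' a' b' c')\<^sup>2 + cb q F'"
proof -
  have c: "corner F a b c" using adj by (simp add: adjacent_def)
  have "a \<noteq> b" using corner_distinct[OF c] by blast
  then obtain y where "y \<in> open_segment a b" using open_segment_eq_empty[of a b] by blast
  then have x: "ch F y \<in> ch F ` open_segment a b" by blast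
  have "ch F y \<in> M \<and> ch F y \<notin> Sing M" using edge_sing[OF corner_props(1)[OF c] x] by blast
  then obtain d h where h: "disc_chart M (ch F y) d h" using disc_chart_ex by blast
  show ?thesis by (rule ext_near_edge[OF adj x h, of q])
qed

lemma theta_le_pi_iff:
  assumes r: "\<forall>i\<in>Sing M. 0 < r i" and cb: "\<forall>F\<in>faces T. 0 < cb (sq r) F"
    and adj: "adjacent F a b c F' a' b' c'"
  shows "theta M T r (ch F ` open_segment a b) \<le> pi \<longleftrightarrow> 0 \<le> slope (sq r) F a b c + slope (sq r) F' a' b' c'"
proof -
  have F: "F \<in> faces T" "F' \<in> faces T" using adj corner_face by (auto simp: adjacent_def)
  define h h' where "h = sqrt (cb (sq r) F)" and "h' = sqrt (cb (sq r) F')"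
  have h: "h\<^sup>2 = cb (sq r) F" "h'\<^sup>2 = cb (sq r) F'" "h \<noteq> 0"
    using bspec[OF cb F(1)] bspec[OF cb F(2)] by (auto simp: h_def h'_def)
  show ?thesis
    unfolding theta_eq[OF r cb adj] h(1,2)[symmetric]
    by (rule dihedral_sum_iff) (use slopes_sq[OF adj, of "sq r"] h in auto)
qed

lemma convex_couple_iff:
  "(T, r) \<in> convex_couples M \<longleftrightarrow> (T, r) \<in> polytope_couples M \<and> Q_concave M (ext (sq r))"
proof (cases "(T, r) \<in> polytope_couples M")
  case True
  then have r: "\<forall>i\<in>Sing M. 0 < r i" and cb: "\<forall>F\<in>faces T. 0 < cb (sq r) F"
    unfolding couple_iff by blast+
  have "(T, r) \<in> convex_couples M \<longleftrightarrow> (\<forall>e\<in>edges T. theta M T r e \<le> pi)"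
    using True by (simp add: convex_couples_def)
  also have "\<dots> \<longleftrightarrow> (\<forall>F a b c F' a' b' c'. adjacent F a b c F' a' b' c' \<longrightarrow>
      0 \<le> slope (sq r) F a b c + slope (sq r) F' a' b' c')"
  proof (intro iffI allI impI ballI)
    fix F a b c F' a' b' c' assume *: "\<forall>e\<in>edges T. theta M T r e \<le> pi" and adj: "adjacent F a b c F' a' b' c'"
    have "ch F ` open_segment a b \<in> edges T" using adj corner_props(1) by (auto simp: adjacent_def)
    then show "0 \<le> slope (sq r) F a b c + slope (sq r) F' a' b' c'"
      using * theta_le_pi_iff[OF r cb adj] by blast
  next
    fix e assume *: "\<forall>F a b c F' a' b' c'. adjacent F a b c F' a' b' c' \<longrightarrow>
      0 \<le> slope (sq r) F a b c + slope (sq r) F' a' b' c'" and e: "e \<in> edges T"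
    have "e \<noteq> {}" using partition_onD3[OF part] e by blast
    then obtain x where "x \<in> e" by blast
    then obtain F a b c F' a' b' c' where adj: "adjacent F a b c F' a' b' c'" "ch F ` open_segment a b = e"
      by (rule edge_adjacent[OF e])
    then show "theta M T r e \<le> pi" using * theta_le_pi_iff[OF r cb adj(1)] by metis
  qed
  also have "\<dots> \<longleftrightarrow> Q_concave M (ext (sq r))"
    using slope_imp_Q_concave[of "sq r"] Q_concave_imp_slope[of "sq r"] by blast
  finally show ?thesis using True by simp
next
  case False then show ?thesis by (simp add: convex_couples_def)
qed

end

section \<open>Tesselations and their associated functions\<close>

text \<open>\<open>Q_near\<close> comes with a chart of its own; the transition to the given chart
  is rigid near \<open>x\<close> and only moves the center.\<close>

lemma Q_near_chart:
  assumes f: "Q_near M f x" and h: "disc_chart M x d h"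
  obtains e P b where "0 < e" "e \<le> d" "\<forall>y\<in>M. dist x y < e \<longrightarrow> f y = Qf P b (h y)"
proof -
  obtain d0 h0 p0 b0 where h0: "disc_chart M x d0 h0" and f0: "\<And>y. y \<in> M \<Longrightarrow> dist x y < d0 \<Longrightarrow> f y = Qf p0 b0 (h0 y)"
    by (rule Q_near_obtain[OF f]) blast
  define e where "e = min d d0"
  have e: "0 < e" "e \<le> d" "e \<le> d0" using disc_chart_pos[OF h] disc_chart_pos[OF h0] by (auto simp: e_def)
  have he: "disc_chart M x e h" by (rule disc_chart_shrink[OF h e(1,2)])
  have "\<forall>z. \<exists>y. z \<in> ball (h x) e \<longrightarrow> y \<in> M \<and> dist x y < e \<and> h y = z"
  proof
    fix z show "\<exists>y. z \<in> ball (h x) e \<longrightarrow> y \<in> M \<and> dist x y < e \<and> h y = z"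
    proof (cases "z \<in> ball (h x) e")
      case True
      then obtain y where "y \<in> M" "dist x y = dist (h x) z" "dist x y < e" "h y = z"
        by (rule disc_chart_surj[OF he _ order_refl])
      then show ?thesis by blast
    qed blast
  qed
  then obtain g where g: "\<And>z. z \<in> ball (h x) e \<Longrightarrow> g z \<in> M \<and> dist x (g z) < e \<and> h (g z) = z" by metis
  have "dist (h0 (g z)) (h0 (g w)) = dist z w" if z: "z \<in> ball (h x) e" and w: "w \<in> ball (h x) e" for z w
  proof -
    have "dist (h0 (g z)) (h0 (g w)) = dist (g z) (g w)"
      using disc_chart_dist[OF h0, of "g z" "g w"] g[OF z] g[OF w] e by simp
    also have "\<dots> = dist (h (g z)) (h (g w))"
      using disc_chart_dist[OF he, of "g z" "g w"] g[OF z] g[OF w] by simp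
    finally show ?thesis using g[OF z] g[OF w] by simp
  qed
  moreover have "interior (ball (h x) e) \<noteq> {}" using e by simp
  ultimately obtain R where R: "rigid R" "\<forall>z\<in>ball (h x) e. h0 (g z) = R z"
    using rigid_extension[of "ball (h x) e" "\<lambda>z. h0 (g z)"] by blast
  have "f y = Qf (inv R p0) b0 (h y)" if y: "y \<in> M" "dist x y < e" for y
  proof -
    have "dist (h x) (h y) = dist x y" using disc_chart_dist[OF he, of x y] disc_chart_pos[OF he] y by simp
    then have hy: "h y \<in> ball (h x) e" using y by simp
    have "g (h y) = y"
      using disc_chart_inj[OF he, of "g (h y)" y] g[OF hy] y by simp
    then have "h0 y = R (h y)" using R(2) hy by force
    then have "f y = Qf p0 b0 (R (h y))" using f0[of y] y e by simp
    then show ?thesis using Qf_rigid[OF R(1), of "inv R p0" b0 "h y"] R(1) by simp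
  qed
  then show thesis using that e by blast
qed

context triangulated
begin

definition ess :: "('a \<Rightarrow> real) \<Rightarrow> 'a set set" where
  "ess q = {e \<in> edges T. \<exists>x\<in>e. \<not> Q_near M (ext q) x}"

lemma Delaunay_eq: "Delaunay_tesselation M T q =
    (\<lparr>edges = ess q, faces = components (M - Sing M - \<Union>(ess q))\<rparr>, q)"
proof -
  have "inessential M T q e \<longleftrightarrow> (\<forall>x\<in>e. Q_near M (ext q) x)" for e
    by (simp only: inessential_def Q_near_def PQ_extension_eq)
  then show ?thesis by (simp add: Delaunay_tesselation_def ess_def Let_def)
qed

text \<open>The criterion of \<open>Q_near_edge\<close> is the same at all points of an edge. So
  this union is determined by the extension alone, whichever triangulation it came from.\<close>

lemma Union_ess: "\<Union>(ess q) = {x \<in> M. x \<notin> Sing M \<and> \<not> Q_near M (ext q) x}"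
proof (intro equalityI subsetI)
  fix x assume "x \<in> \<Union>(ess q)"
  then obtain e x0 where e: "e \<in> edges T" "x \<in> e" "x0 \<in> e" "\<not> Q_near M (ext q) x0" by (auto simp: ess_def)
  obtain F a b c F' a' b' c' where adj: "adjacent F a b c F' a' b' c'" "ch F ` open_segment a b = e"
    by (rule edge_adjacent[OF e(1,2)])
  have "\<not> Q_near M (ext q) x"
    using Q_near_edge[OF adj(1), of x q] Q_near_edge[OF adj(1), of x0 q] adj(2) e by blast
  then show "x \<in> {x \<in> M. x \<notin> Sing M \<and> \<not> Q_near M (ext q) x}" using edge_sing[OF e(1,2)] by blast
next
  fix x assume x: "x \<in> {x \<in> M. x \<notin> Sing M \<and> \<not> Q_near M (ext q) x}"
  then have "x \<notin> \<Union>(faces T)" using Q_near_face by blast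
  then have "x \<in> \<Union>(edges T)" using x M_eq by blast
  then show "x \<in> \<Union>(ess q)" using x by (auto simp: ess_def)
qed

lemma edge_curve:
  assumes "e \<in> edges T"
  obtains L \<gamma> where "geodesic_arc M L \<gamma>" "bij_betw \<gamma> {0<..<L} e" "\<gamma> 0 \<in> Sing M" "\<gamma> L \<in> Sing M"
proof -
  have "\<exists>L \<gamma>. geodesic_arc M L \<gamma> \<and> bij_betw \<gamma> {0<..<L} e \<and> \<gamma> 0 \<in> Sing M \<and> \<gamma> L \<in> Sing M"
    using geod assms unfolding geodesic_triangulation_def by blast
  then show thesis using that by blast
qed

lemma edge_connected: "e \<in> edges T \<Longrightarrow> connected e"
proof -
  assume "e \<in> edges T"
  then obtain L \<gamma> where g: "geodesic_arc M L \<gamma>" "bij_betw \<gamma> {0<..<L} e" by (rule edge_curve)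
  have "continuous_on {0<..<L} \<gamma>"
    by (rule continuous_on_subset[OF geodesic_arc_continuous[OF g(1)]]) auto
  then have "connected (\<gamma> ` {0<..<L})" by (intro connected_continuous_image) auto
  then show ?thesis using g(2) by (simp add: bij_betw_def)
qed

lemma edge_closed:
  assumes "e \<in> edges T"
  obtains K where "closed K" "e \<subseteq> K" "K \<subseteq> e \<union> Sing M"
proof -
  obtain L \<gamma> where g: "geodesic_arc M L \<gamma>" "bij_betw \<gamma> {0<..<L} e" "\<gamma> 0 \<in> Sing M" "\<gamma> L \<in> Sing M"
    by (rule edge_curve[OF assms])
  have im: "e = \<gamma> ` {0<..<L}" using g(2) by (simp add: bij_betw_def)
  have "closed (\<gamma> ` {0..L})"
    by (intro compact_imp_closed compact_continuous_image geodesic_arc_continuous[OF g(1)]) simp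
  moreover have "e \<subseteq> \<gamma> ` {0..L}" unfolding im by (intro image_mono) auto
  moreover have "\<gamma> ` {0..L} \<subseteq> e \<union> Sing M"
  proof
    fix x assume "x \<in> \<gamma> ` {0..L}"
    then obtain t where t: "0 \<le> t" "t \<le> L" "x = \<gamma> t" by auto
    then consider "t = 0" | "t = L" | "t \<in> {0<..<L}" by fastforce
    then show "x \<in> e \<union> Sing M" using g(3,4) t im by cases auto
  qed
  ultimately show thesis by (rule that)
qed

text \<open>The parametrization \<open>c\<close> is given from outside, since the edge is shared by
  two triangulations and their extensions are compared along the same curve.\<close>

lemma ext_along_edge:
  assumes E: "E \<in> edges T" and e0: "0 < e0" and c: "\<forall>t. \<bar>t - t0\<bar> < e0 \<longrightarrow> c t \<in> E"
    and iso: "\<forall>s t. \<bar>s - t0\<bar> < e0 \<longrightarrow> \<bar>t - t0\<bar> < e0 \<longrightarrow> dist (c s) (c t) = \<bar>s - t\<bar>"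
  obtains e A B where "0 < e" "e \<le> e0" "\<forall>t. \<bar>t - t0\<bar> < e \<longrightarrow> ext q (c t) = t\<^sup>2 + A + B * t"
proof -
  define x where "x = c t0"
  have xE: "x \<in> E" using c e0 by (simp add: x_def)
  obtain F a b c' F' a' b' c'' where adj: "adjacent F a b c' F' a' b' c''" "ch F ` open_segment a b = E"
    by (rule edge_adjacent[OF E xE])
  have xF: "x \<in> ch F ` open_segment a b" using xE adj by simp
  obtain d h where h: "disc_chart M x d h" using edge_sing[OF E xE] disc_chart_ex by blast
  obtain e1 N P P' where e1: "0 < e1" "e1 \<le> d" and
    up: "\<forall>p\<in>M. dist x p < e1 \<longrightarrow> 0 \<le> (h p - h x) \<bullet> N \<longrightarrow> ext q p = Qf P (cb q F) (h p)" and
    on: "\<forall>p\<in>M. dist x p < e1 \<longrightarrow> p \<in> ch F ` open_segment a b \<longrightarrow> (h p - h x) \<bullet> N = 0"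
    by (rule ext_near_edge[OF adj(1) xF h, of q]) (rule that; assumption)
  define e where "e = min e0 e1"
  have e: "0 < e" "e \<le> e0" "e \<le> e1" using e0 e1 by (auto simp: e_def)
  have cM: "c t \<in> M \<and> dist x (c t) < e1 \<and> c t \<in> ch F ` open_segment a b" if t: "\<bar>t - t0\<bar> < e" for t
  proof -
    have "c t \<in> E" using c t e by simp
    moreover have "dist x (c t) = \<bar>t0 - t\<bar>" unfolding x_def using t e e0 iso by simp
    then have "dist x (c t) < e1" using t e by linarith
    ultimately show ?thesis using edge_sing[OF E] adj(2) by blast
  qed
  have "dist (h (c s)) (h (c t)) = \<bar>s - t\<bar>" if st: "\<bar>s - t0\<bar> < e" "\<bar>t - t0\<bar> < e" for s t
  proof -
    have "dist (h (c s)) (h (c t)) = dist (c s) (c t)"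
      using disc_chart_dist[OF h, of "c s" "c t"] cM[OF st(1)] cM[OF st(2)] e1 by simp
    also have "\<dots> = \<bar>s - t\<bar>" using st e iso by simp
    finally show ?thesis .
  qed
  then obtain u where u: "norm u = 1" "\<And>t. \<bar>t - t0\<bar> < e \<Longrightarrow> h (c t) = h (c t0) + (t - t0) *\<^sub>R u"
    using segment_isometry[OF e(1), of t0 "\<lambda>t. h (c t)"] by blast
  have uu: "u \<bullet> u = 1" using u by (simp add: norm_eq_sqrt_inner)
  define B where "B = - 2 * t0 - 2 * (u \<bullet> (P - h x))"
  define A where "A = Qf P (cb q F) (h x) + t0\<^sup>2 + 2 * t0 * (u \<bullet> (P - h x))"
  have "ext q (c t) = t\<^sup>2 + A + B * t" if t: "\<bar>t - t0\<bar> < e" for t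
  proof -
    have "(h (c t) - h x) \<bullet> N = 0" using on cM[OF t] by blast
    then have "ext q (c t) = Qf P (cb q F) (h (c t))" using up cM[OF t] by simp
    also have "h (c t) = h x + (t - t0) *\<^sub>R u" using u(2)[OF t] by (simp add: x_def)
    also have "Qf P (cb q F) (h x + (t - t0) *\<^sub>R u) = t\<^sup>2 + A + B * t"
      unfolding Qf_expand A_def B_def using uu by (simp add: power2_eq_square algebra_simps)
    finally show ?thesis .
  qed
  then show thesis using that e by blast
qed

lemma Sing_nonempty: "M \<noteq> {} \<Longrightarrow> Sing M \<noteq> {}"
proof -
  assume "M \<noteq> {}"
  then obtain x where "x \<in> M" by blast
  then obtain F z where "F \<in> faces T" by (rule lift_point)
  then show ?thesis using corner_props(3)[OF corner_ex] by blast
qed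

end

lemma concave_zero_ends:
  fixes k :: "real \<Rightarrow> real"
  assumes "concave_on {0..L} k" "k 0 = 0" "k L = 0" "t \<in> {0..L}" "0 < L"
  shows "0 \<le> k t"
proof -
  have "convex_on {0..L} (\<lambda>x. - k x)" using assms(1) by (simp add: concave_on_def)
  then have "- k ((1 - t / L) *\<^sub>R 0 + (t / L) *\<^sub>R L) \<le> (1 - t / L) * - k 0 + (t / L) * - k L"
    using assms(4,5) by (intro convex_onD) (auto simp: divide_le_eq)
  then show ?thesis using assms by simp
qed

text \<open>
  The difference of the two functions vanishes on \<open>Sing M\<close> and on the essential edges, and it is
  affine near all other points, so a positive maximum is impossible.
\<close>

lemma ext_le_if_same_edges:
  assumes T: "triangulated M T" and T': "triangulated M T'" and M: "connected M"
    and q: "\<And>i. i \<in> Sing M \<Longrightarrow> q i = q' i"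
    and ess: "triangulated.ess M T q = triangulated.ess M T' q'" and x: "x \<in> M"
  shows "triangulated.ext M T q x \<le> triangulated.ext M T' q' x"
proof -
  interpret A: triangulated M T by (rule T)
  interpret B: triangulated M T' by (rule T')
  define f where "f = A.ext q"
  define f' where "f' = B.ext q'"
  define g where "g x = f x - f' x" for x
  have cont: "continuous_on M f" "continuous_on M f'"
    unfolding f_def f'_def by (rule A.ext_continuous, rule B.ext_continuous)
  have contg: "continuous_on M g" unfolding g_def[abs_def] by (intro continuous_intros cont)
  have gS: "g i = 0" if "i \<in> Sing M" for i
    using A.ext_sing[OF that] B.ext_sing[OF that] q[OF that] by (simp add: g_def f_def f'_def)
  \<comment> \<open>Along a common edge the difference is locally affine, so it and its negative are
    both concave; both vanish at the singular end points.\<close>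
  have gE: "g y = 0" if e: "e \<in> A.ess q" "y \<in> e" for e y
  proof -
    have eT: "e \<in> edges T" "e \<in> edges T'" using e ess by (auto simp: A.ess_def B.ess_def)
    obtain L \<gamma> where \<gamma>: "geodesic_arc M L \<gamma>" "bij_betw \<gamma> {0<..<L} e" "\<gamma> 0 \<in> Sing M" "\<gamma> L \<in> Sing M"
      by (rule A.edge_curve[OF eT(1)])
    have L: "0 < L" and gM: "\<gamma> ` {0..L} \<subseteq> M" using \<gamma>(1) by (auto simp: geodesic_arc_def)
    define k where "k t = g (\<gamma> t)" for t
    have kc: "continuous_on {0..L} k" unfolding k_def
      by (rule continuous_on_compose2[OF contg geodesic_arc_continuous[OF \<gamma>(1)] gM])
    have loc: "\<exists>e>0. \<exists>A B. \<forall>s. \<bar>s - t\<bar> < e \<longrightarrow> k s = A + B * s" if t: "0 < t" "t < L" for t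
    proof -
      have "t \<in> {0..L}" using t by simp
      then obtain \<epsilon> where \<epsilon>: "\<epsilon> > 0" "\<forall>s\<in>{0..L} \<inter> ball t \<epsilon>. \<forall>s'\<in>{0..L} \<inter> ball t \<epsilon>. dist (\<gamma> s) (\<gamma> s') = \<bar>s - s'\<bar>"
        using \<gamma>(1) unfolding geodesic_arc_def by blast
      define e0 where "e0 = min \<epsilon> (min t (L - t))"
      have e0: "0 < e0" "e0 \<le> \<epsilon>" "e0 \<le> t" "e0 \<le> L - t" using \<epsilon> t by (auto simp: e0_def)
      have near: "s \<in> {0..L} \<inter> ball t \<epsilon>" "s \<in> {0<..<L}" if "\<bar>s - t\<bar> < e0" for s
        using that e0 by (auto simp: dist_real_def)
      have ce: "\<forall>s. \<bar>s - t\<bar> < e0 \<longrightarrow> \<gamma> s \<in> e" using near(2) \<gamma>(2) by (auto simp: bij_betw_def)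
      have iso: "\<forall>s s'. \<bar>s - t\<bar> < e0 \<longrightarrow> \<bar>s' - t\<bar> < e0 \<longrightarrow> dist (\<gamma> s) (\<gamma> s') = \<bar>s - s'\<bar>"
        using \<epsilon>(2) near(1) by blast
      obtain e1 A1 B1 where 1: "0 < e1" "e1 \<le> e0" "\<forall>s. \<bar>s - t\<bar> < e1 \<longrightarrow> A.ext q (\<gamma> s) = s\<^sup>2 + A1 + B1 * s"
        by (rule A.ext_along_edge[where q = q, OF eT(1) e0(1) ce iso])
      obtain e2 A2 B2 where 2: "0 < e2" "e2 \<le> e0" "\<forall>s. \<bar>s - t\<bar> < e2 \<longrightarrow> B.ext q' (\<gamma> s) = s\<^sup>2 + A2 + B2 * s"
        by (rule B.ext_along_edge[where q = q', OF eT(2) e0(1) ce iso])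
      have "k s = (A1 - A2) + (B1 - B2) * s" if "\<bar>s - t\<bar> < min e1 e2" for s
        using 1(3) 2(3) that by (simp add: k_def g_def f_def f'_def algebra_simps)
      moreover have "0 < min e1 e2" using 1 2 by simp
      ultimately show ?thesis by blast
    qed
    have "concave_on {0..L} k"
    proof (rule concave_on_local[OF kc])
      fix t assume "0 < t" "t < L"
      then obtain e A B where "e > 0" "\<forall>s. \<bar>s - t\<bar> < e \<longrightarrow> k s = A + B * s" using loc by blast
      then show "\<exists>e>0. \<exists>A B A' B'. \<forall>s. \<bar>s - t\<bar> < e \<longrightarrow> k s = min (A + B * s) (A' + B' * s)"
        by (metis min.idem)
    qed
    moreover have "concave_on {0..L} (\<lambda>t. - k t)"
    proof (rule concave_on_local)
      show "continuous_on {0..L} (\<lambda>t. - k t)" by (intro continuous_intros kc)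
      fix t assume "0 < t" "t < L"
      then obtain e A B where e: "e > 0" "\<forall>s. \<bar>s - t\<bar> < e \<longrightarrow> k s = A + B * s" using loc by blast
      have "\<forall>s. \<bar>s - t\<bar> < e \<longrightarrow> - k s = min (- A + - B * s) (- A + - B * s)" using e(2) by simp
      then show "\<exists>e>0. \<exists>A B A' B'. \<forall>s. \<bar>s - t\<bar> < e \<longrightarrow> - k s = min (A + B * s) (A' + B' * s)"
        using e(1) by blast
    qed
    moreover have ends: "k 0 = 0" "k L = 0" using gS \<gamma>(3,4) by (simp_all add: k_def)
    ultimately have "0 \<le> k t" "0 \<le> - k t" if "t \<in> {0..L}" for t
      using concave_zero_ends[of L k t] concave_zero_ends[of L "\<lambda>t. - k t" t] L that by simp_all
    then have "k t = 0" if "t \<in> {0..L}" for t using that by (meson antisym neg_0_le_iff_le)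
    moreover obtain t where "t \<in> {0<..<L}" "y = \<gamma> t" using e(2) \<gamma>(2) by (auto simp: bij_betw_def)
    ultimately show ?thesis by (simp add: k_def)
  qed
  obtain x0 where x0: "x0 \<in> M" "\<forall>y\<in>M. g y \<le> g x0"
    using continuous_attains_sup[OF A.compact_M _ contg] x by blast
  have "g x0 \<le> 0"
  proof (rule ccontr)
    assume "\<not> g x0 \<le> 0"
    then have pos: "0 < g x0" by simp
    \<comment> \<open>The set of maximum points is closed; it is open because \<open>g\<close> is
      affine in a disc around each of them. By connectedness it would contain a singular point,
      where \<open>g\<close> is 0.\<close>
    define S where "S = {y \<in> M. g y = g x0}"
    have "closedin (top_of_set M) S" unfolding S_def by (rule continuous_closedin_preimage_constant[OF contg])
    moreover have "openin (top_of_set M) S"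
      unfolding openin_euclidean_subtopology_iff
    proof (intro conjI ballI)
      show "S \<subseteq> M" by (auto simp: S_def)
      fix y assume y: "y \<in> S"
      then have yM: "y \<in> M" and gy: "g y = g x0" by (auto simp: S_def)
      have ynS: "y \<notin> Sing M" using gS[of y] gy pos by auto
      have "y \<notin> \<Union>(A.ess q)" using gE[of _ y] gy pos by auto
      then have near: "Q_near M f y" "Q_near M f' y"
        using yM ynS A.Union_ess[of q] B.Union_ess[of q'] ess by (auto simp: f_def f'_def)
      obtain d h where h: "disc_chart M y d h" using A.disc_chart_ex yM ynS by blast
      obtain e1 P b where 1: "0 < e1" "e1 \<le> d" "\<forall>z\<in>M. dist y z < e1 \<longrightarrow> f z = Qf P b (h z)"
        by (rule Q_near_chart[OF near(1) h])
      obtain e2 P' b' where 2: "0 < e2" "e2 \<le> d" "\<forall>z\<in>M. dist y z < e2 \<longrightarrow> f' z = Qf P' b' (h z)"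
        by (rule Q_near_chart[OF near(2) h])
      define e where "e = min e1 e2"
      have e: "0 < e" "e \<le> e1" "e \<le> e2" "e \<le> d" using 1 2 by (auto simp: e_def)
      have gz: "g z = 2 * ((P' - P) \<bullet> (h z - h y)) + g y" if z: "z \<in> M" "dist y z < e" for z
      proof -
        have "g z = Qf P b (h z) - Qf P' b' (h z)" "g y = Qf P b (h y) - Qf P' b' (h y)"
          using 1(3) 2(3) z yM e by (simp_all add: g_def)
        then show ?thesis using Qf_diff[of P b "h z" P' b' "h y"] by simp
      qed
      \<comment> \<open>Twice this vector is the gradient of \<open>g\<close> in the chart; moving
        along it would exceed the maximum.\<close>
      have "P' - P = 0"
      proof (rule ccontr)
        assume ne: "P' - P \<noteq> 0"
        obtain t where t: "t > 0" "norm (t *\<^sub>R (P' - P)) < e" using small_multiple[OF e(1)] by blast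
        have "h y + t *\<^sub>R (P' - P) \<in> ball (h y) e" using t by (simp add: dist_norm)
        then obtain z where z: "z \<in> M" "dist y z = dist (h y) (h y + t *\<^sub>R (P' - P))" "dist y z < e" "h z = h y + t *\<^sub>R (P' - P)"
          by (rule disc_chart_surj[OF h _ e(4)])
        have "g z = 2 * (t * ((P' - P) \<bullet> (P' - P))) + g y" using gz[OF z(1,3)] z(4) by simp
        moreover have "0 < t * ((P' - P) \<bullet> (P' - P))" using t(1) ne by (intro mult_pos_pos) simp_all
        ultimately show False using x0(2) z(1) gy by force
      qed
      then have "z \<in> S" if "z \<in> M" "dist z y < e" for z
        using gz[of z] that gy by (simp add: S_def dist_commute)
      then show "\<exists>e>0. \<forall>z\<in>M. dist z y < e \<longrightarrow> z \<in> S" using e(1) by blast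
    qed
    ultimately have "S = {} \<or> S = M" using M unfolding connected_clopen by blast
    then have "S = M" using x0(1) by (auto simp: S_def)
    moreover obtain i where i: "i \<in> Sing M" using A.Sing_nonempty x by blast
    moreover have "i \<in> M" using i by (simp add: Sing_def)
    ultimately have "g i = g x0" by (auto simp: S_def)
    then show False using gS[OF i] pos by simp
  qed
  then have "g x \<le> 0" using x0(2) x by force
  then show ?thesis by (simp add: g_def f_def f'_def)
qed

text \<open>By \<open>Union_ess\<close> the unions of essential edges agree. What remains is to
  recover the single edges from their union, by connectedness.\<close>

lemma ess_subset_if_ext_eq:
  assumes T: "triangulated M T" and T': "triangulated M T'"
    and eq: "triangulated.ext M T q = triangulated.ext M T' q'"
  shows "triangulated.ess M T q \<subseteq> triangulated.ess M T' q'"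
proof
  interpret A: triangulated M T by (rule T)
  interpret B: triangulated M T' by (rule T')
  have U: "\<Union>(A.ess q) = \<Union>(B.ess q')" unfolding A.Union_ess B.Union_ess using eq by simp
  \<comment> \<open>Adding end points in \<open>Sing M\<close> makes every edge closed, and
    \<open>e\<close> avoids \<open>Sing M\<close>. So finitely many relatively closed disjoint sets
    cover the connected set \<open>e\<close>, and one of them contains it.\<close>
  have sub: "\<exists>e'\<in>A2. e \<subseteq> e'"
    if t: "triangulated M T1" "triangulated M T2" and e: "e \<in> edges T1" "e \<noteq> {}"
      and A2: "A2 \<subseteq> edges T2" "e \<subseteq> \<Union>A2" for T1 T2 :: "'a decomposition" and A2 e
  proof -
    interpret C: triangulated M T1 by (rule t(1))
    interpret D: triangulated M T2 by (rule t(2))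
    obtain x where x: "x \<in> e" using e by blast
    then obtain e' where e': "e' \<in> A2" "x \<in> e'" using A2 by blast
    have "\<forall>e''\<in>edges T2. \<exists>K. closed K \<and> e'' \<subseteq> K \<and> K \<subseteq> e'' \<union> Sing M" using D.edge_closed by metis
    then obtain K where K: "\<And>e''. e'' \<in> edges T2 \<Longrightarrow> closed (K e'') \<and> e'' \<subseteq> K e'' \<and> K e'' \<subseteq> e'' \<union> Sing M" by metis
    define K2 where "K2 = \<Union>(K ` (A2 - {e'}))"
    have fin: "finite (A2 - {e'})" using finite_subset[OF A2(1) D.finite_T(1)] by simp
    have eS: "e \<inter> Sing M = {}" using C.edge_sing[OF e(1)] by blast
    have e'T: "e' \<in> edges T2" using e' A2 by blast
    have clo: "closed (K e')" "closed K2"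
      using K[OF e'T] K A2(1) fin unfolding K2_def by (auto intro!: closed_UN)
    have cov: "e \<subseteq> K e' \<union> K2"
    proof
      fix y assume "y \<in> e"
      then obtain e3 where e3: "e3 \<in> A2" "y \<in> e3" using A2(2) by blast
      then have "y \<in> K e3" using K[of e3] A2(1) by blast
      then show "y \<in> K e' \<union> K2" using e3(1) unfolding K2_def by (cases "e3 = e'") blast+
    qed
    have inK: "y \<in> e''" if "y \<in> e" "y \<in> K e''" "e'' \<in> edges T2" for y e''
      using K[OF that(3)] that eS by blast
    have disj: "K e' \<inter> K2 \<inter> e = {}"
    proof (rule ccontr)
      assume "K e' \<inter> K2 \<inter> e \<noteq> {}"
      then obtain y e'' where y: "y \<in> K e'" "y \<in> e" "e'' \<in> A2" "e'' \<noteq> e'" "y \<in> K e''" unfolding K2_def by blast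
      have "e'' \<in> edges T2" using y A2 by blast
      then show False using D.edges_eq[of e'' e' y] inK y e'T by blast
    qed
    have "K e' \<inter> e = {} \<or> K2 \<inter> e = {}"
      by (rule connected_closedD[OF C.edge_connected[OF e(1)] disj cov clo])
    then have "K2 \<inter> e = {}" using x e'(2) K[OF e'T] by blast
    then have "e \<subseteq> e'" using cov inK[OF _ _ e'T] by blast
    then show ?thesis using e'(1) by blast
  qed
  fix e assume e: "e \<in> A.ess q"
  have eT: "e \<in> edges T" using e by (simp add: A.ess_def)
  have ne: "e \<noteq> {}" using partition_onD3[OF A.part] eT by blast
  have BT: "B.ess q' \<subseteq> edges T'" "A.ess q \<subseteq> edges T" by (auto simp: A.ess_def B.ess_def)
  have "e \<subseteq> \<Union>(B.ess q')" using e U by blast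
  then obtain e' where e': "e' \<in> B.ess q'" "e \<subseteq> e'" using sub[OF T T' eT ne BT(1)] by blast
  have e'T: "e' \<in> edges T'" "e' \<noteq> {}" using e' BT ne by blast+
  have "e' \<subseteq> \<Union>(A.ess q)" using e' U by blast
  \<comment> \<open>\<open>e\<close> and \<open>e''\<close> are edges of the same triangulation and
    intersect, so the inclusions of \<open>e\<close> in \<open>e'\<close> in \<open>e''\<close> are
    equalities.\<close>
  then obtain e'' where e'': "e'' \<in> A.ess q" "e' \<subseteq> e''" using sub[OF T' T e'T BT(2)] by blast
  have "e'' \<in> edges T" using e'' BT by blast
  then have "e = e''" using A.edges_eq[OF eT] ne e' e'' by blast
  then have "e = e'" using e' e'' by blast
  then show "e \<in> B.ess q'" using e' by simp
qed

lemma Delaunay_eq_iff: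
  assumes T: "triangulated M T" and T': "triangulated M T'" and M: "connected M"
    and q: "q \<in> extensional (Sing M)" "q' \<in> extensional (Sing M)"
  shows "Delaunay_tesselation M T q = Delaunay_tesselation M T' q' \<longleftrightarrow>
    PQ_extension M T q = PQ_extension M T' q'"
proof -
  interpret A: triangulated M T by (rule T)
  interpret B: triangulated M T' by (rule T')
  show ?thesis
    unfolding A.PQ_extension_eq B.PQ_extension_eq A.Delaunay_eq B.Delaunay_eq
  proof
    assume tess: "(\<lparr>edges = A.ess q, faces = components (M - Sing M - \<Union>(A.ess q))\<rparr>, q) =
      (\<lparr>edges = B.ess q', faces = components (M - Sing M - \<Union>(B.ess q'))\<rparr>, q')"
    from arg_cong[OF tess, of "\<lambda>t. edges (fst t)"] have ess: "A.ess q = B.ess q'" by simp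
    from arg_cong[OF tess, of snd] have qq: "q = q'" by simp
    show "A.ext q = B.ext q'"
    proof
      fix x
      show "A.ext q x = B.ext q' x"
      proof (cases "x \<in> M")
        case True
        then show ?thesis
          using ext_le_if_same_edges[OF T T' M _ ess True] ext_le_if_same_edges[OF T' T M _ ess[symmetric] True] qq
          by (simp add: order_antisym)
      next
        case False then show ?thesis by (simp add: A.ext_def B.ext_def)
      qed
    qed
  next
    assume ext: "A.ext q = B.ext q'"
    have ess: "A.ess q = B.ess q'"
      using ess_subset_if_ext_eq[OF T T' ext] ess_subset_if_ext_eq[OF T' T ext[symmetric]] by (rule equalityI)
    have "q i = q' i" for i
    proof (cases "i \<in> Sing M")
      case True
      then show ?thesis using A.ext_sing[OF True, of q] B.ext_sing[OF True, of q'] ext by simp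
    next
      case False then show ?thesis using q by (simp add: extensional_def)
    qed
    then have "q = q'" by blast
    then show "(\<lparr>edges = A.ess q, faces = components (M - Sing M - \<Union>(A.ess q))\<rparr>, q) =
      (\<lparr>edges = B.ess q', faces = components (M - Sing M - \<Union>(B.ess q'))\<rparr>, q')"
      using ess by simp
  qed
qed

section \<open>The metric of a generalized polytope\<close>

definition chains :: "'a::metric_space set \<Rightarrow> 'a decomposition \<Rightarrow> ('a \<Rightarrow> real) \<Rightarrow>
    'a polytope_point \<Rightarrow> 'a polytope_point \<Rightarrow> real set" where
  "chains M T r P Q = {\<Sum>i<n. d i |n p d. p 0 = P \<and> p n = Q \<and>
     (\<forall>i<n. pyramid_dist M T r (p i) (p (Suc i)) (d i))}"

lemma glued_dist_chains: "glued_dist M T r P Q = Inf (chains M T r P Q)"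
  by (simp add: glued_dist_def chains_def)

lemma chain_refl: "0 \<in> chains M T r P P"
  unfolding chains_def by (intro CollectI exI[of _ 0] exI[of _ "\<lambda>_. P"] exI[of _ "\<lambda>_. 0"]) simp

lemma chain_step:
  assumes c: "c \<in> chains M T r P Q" and d: "pyramid_dist M T r Q R d"
  shows "c + d \<in> chains M T r P R"
proof -
  obtain n p e where *: "c = (\<Sum>i<n. e i)" "p 0 = P" "p n = Q" "\<forall>i<n. pyramid_dist M T r (p i) (p (Suc i)) (e i)"
    using c unfolding chains_def by blast
  define p' where "p' i = (if i \<le> n then p i else R)" for i
  define e' where "e' i = (if i < n then e i else d)" for i
  have "c + d = (\<Sum>i<Suc n. e' i)" by (simp add: *(1) e'_def)
  moreover have "p' 0 = P" "p' (Suc n) = R" using * by (simp_all add: p'_def)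
  moreover have "\<forall>i<Suc n. pyramid_dist M T r (p' i) (p' (Suc i)) (e' i)"
    using * d by (auto simp: p'_def e'_def less_Suc_eq)
  ultimately show ?thesis unfolding chains_def by blast
qed

lemma chain_single: "pyramid_dist M T r P Q d \<Longrightarrow> d \<in> chains M T r P Q"
  using chain_step[OF chain_refl, of M T r P Q d] by simp

lemma chain_induct [consumes 1, case_names refl step]:
  assumes c: "c \<in> chains M T r P Q"
    and "X P 0" and step: "\<And>Q c R d. c \<in> chains M T r P Q \<Longrightarrow> X Q c \<Longrightarrow> pyramid_dist M T r Q R d \<Longrightarrow> X R (c + d)"
  shows "X Q c"
proof -
  obtain n p e where *: "c = (\<Sum>i<n. e i)" "p 0 = P" "p n = Q" "\<forall>i<n. pyramid_dist M T r (p i) (p (Suc i)) (e i)"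
    using c unfolding chains_def by blast
  have "m \<le> n \<Longrightarrow> (\<Sum>i<m. e i) \<in> chains M T r P (p m) \<and> X (p m) (\<Sum>i<m. e i)" for m
  proof (induction m)
    case 0 then show ?case using chain_refl *(2) assms(2) by simp
  next
    case (Suc m)
    then have IH: "(\<Sum>i<m. e i) \<in> chains M T r P (p m)" "X (p m) (\<Sum>i<m. e i)" by simp_all
    have "pyramid_dist M T r (p m) (p (Suc m)) (e m)" using *(4) Suc.prems by simp
    then show ?case using chain_step[OF IH(1)] step[OF IH] by simp
  qed
  from this[of n] show ?thesis using * by simp
qed

lemma chain_append:
  assumes "c' \<in> chains M T r Q R" "c \<in> chains M T r P Q"
  shows "c + c' \<in> chains M T r P R"
  using assms(1)
proof (induction rule: chain_induct)
  case refl then show ?case using assms(2) by simp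
next
  case (step S c' R d)
  then show ?case using chain_step[of "c + c'" M T r P S R d] by (simp add: add.assoc)
qed

section \<open>Distances in one pyramid and along chains\<close>

locale pyramids = triangulated M T for M :: "'a::metric_space set" and T +
  fixes r :: "'a \<Rightarrow> real"
  assumes couple: "(T, r) \<in> polytope_couples M"
begin

abbreviation f :: "'a \<Rightarrow> real" where "f \<equiv> ext (sq r)"

definition emb :: "'a set \<Rightarrow> real \<Rightarrow> real^2 \<Rightarrow> (real^2) \<times> real" where
  "emb F s x = (1 - s) *\<^sub>R apex_of M r F + s *\<^sub>R (x, 0)"

lemma pyramid_dist_iff: "pyramid_dist M T r P Q d \<longleftrightarrow>
  (\<exists>F\<in>faces T. \<exists>x\<in>tri F. \<exists>y\<in>tri F. \<exists>s\<in>{0..1}. \<exists>t\<in>{0..1}.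
     P = cone_pt (ch F x) s \<and> Q = cone_pt (ch F y) t \<and> d = dist (emb F s x) (emb F t y))"
  unfolding pyramid_dist_def chart_of_eq prod.case emb_def tri_def ..

lemma cb_pos: "F \<in> faces T \<Longrightarrow> 0 < cb (sq r) F"
  using couple unfolding couple_iff by blast

lemma apex: "F \<in> faces T \<Longrightarrow> apex_of M r F = (cp (sq r) F, sqrt (cb (sq r) F))"
  using couple cb_pos unfolding couple_iff by (intro apex_of_eq) blast+

lemma f_apex: "F \<in> faces T \<Longrightarrow> x \<in> tri F \<Longrightarrow> f (ch F x) = (norm ((x, 0) - apex_of M r F))\<^sup>2"
  using cb_pos[of F] by (simp add: ext_ch apex norm_Pair Qf_def)

lemma f_pos: "x \<in> M \<Longrightarrow> 0 < f x"
proof -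
  assume "x \<in> M"
  then obtain F z where F: "F \<in> faces T" "z \<in> tri F" "ch F z = x" by (rule lift_point)
  have "f x = (norm (z - cp (sq r) F))\<^sup>2 + cb (sq r) F" using ext_ch[OF F(1,2)] F(3) by (simp add: Qf_def)
  then show ?thesis using cb_pos[OF F(1)] by (simp add: add_nonneg_pos)
qed

text \<open>Law of cosines with center at the apex: \<open>a\<close> and \<open>b\<close> are the
  squared distances of two base points from it, \<open>d\<close> is the distance between them, and
  \<open>s\<close>, \<open>t\<close> are the fractions taken. Distances in a pyramid thus depend
  only on \<open>f\<close> and on distances in the base.\<close>

definition law :: "real \<Rightarrow> real \<Rightarrow> real \<Rightarrow> real \<Rightarrow> real \<Rightarrow> real" where
  "law s t a b d = sqrt (s\<^sup>2 * a + t\<^sup>2 * b - s * t * (a + b - d\<^sup>2))"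

lemma dist_emb:
  assumes F: "F \<in> faces T" and x: "x \<in> tri F" and y: "y \<in> tri F"
  shows "dist (emb F s x) (emb F t y) = law s t (f (ch F x)) (f (ch F y)) (dist x y)"
proof -
  define X where "X = (x, 0) - apex_of M r F"
  define Y where "Y = (y, 0) - apex_of M r F"
  have e: "emb F s x - emb F t y = s *\<^sub>R X - t *\<^sub>R Y" by (simp add: emb_def X_def Y_def algebra_simps)
  have "X - Y = (x - y, 0)" by (simp add: X_def Y_def)
  then have "(dist x y)\<^sup>2 = (X - Y) \<bullet> (X - Y)" by (simp add: dist_norm power2_norm_eq_inner)
  then have d: "(dist x y)\<^sup>2 = X \<bullet> X + Y \<bullet> Y - 2 * (X \<bullet> Y)"
    by (simp add: inner_diff_left inner_diff_right inner_commute[of Y X])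
  have fX: "f (ch F x) = X \<bullet> X" "f (ch F y) = Y \<bullet> Y"
    using f_apex[OF F x] f_apex[OF F y] by (simp_all add: X_def Y_def power2_norm_eq_inner)
  have "(s *\<^sub>R X - t *\<^sub>R Y) \<bullet> (s *\<^sub>R X - t *\<^sub>R Y) = s\<^sup>2 * (X \<bullet> X) + t\<^sup>2 * (Y \<bullet> Y) - s * t * (2 * (X \<bullet> Y))"
    by (simp add: inner_diff_left inner_diff_right inner_commute[of Y X] power2_eq_square algebra_simps)
  also have "2 * (X \<bullet> Y) = f (ch F x) + f (ch F y) - (dist x y)\<^sup>2" using d fX by simp
  finally show ?thesis unfolding dist_norm[of "emb F s x"] e norm_eq_sqrt_inner law_def fX by simp
qed

lemma cone_pt_carrier: "x \<in> M \<Longrightarrow> t \<in> {0..1} \<Longrightarrow> cone_pt x t \<in> polytope_carrier M"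
  unfolding polytope_carrier_def by blast

lemma carrier_cases:
  assumes "P \<in> polytope_carrier M"
  obtains F x t where "F \<in> faces T" "x \<in> tri F" "t \<in> {0..1}" "P = cone_pt (ch F x) t"
proof -
  obtain x t where "x \<in> M" "t \<in> {0..1}" "P = cone_pt x t" using assms unfolding polytope_carrier_def by blast
  then show thesis using lift_point that by metis
qed

lemma pyramid_dist_carrier:
  assumes "pyramid_dist M T r P Q d" shows "P \<in> polytope_carrier M \<and> Q \<in> polytope_carrier M"
  using assms cone_pt_carrier ch_M unfolding pyramid_dist_iff by blast

lemma pyramid_dist_nonneg: "pyramid_dist M T r P Q d \<Longrightarrow> 0 \<le> d"
  unfolding pyramid_dist_iff by auto

lemma pyramid_dist_sym: "pyramid_dist M T r P Q d \<Longrightarrow> pyramid_dist M T r Q P d"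
  unfolding pyramid_dist_iff by (metis dist_commute)

lemma chains_nonneg: "c \<in> chains M T r P Q \<Longrightarrow> 0 \<le> c"
  by (induction rule: chain_induct) (auto dest: pyramid_dist_nonneg)

lemma chains_bdd: "bdd_below (chains M T r P Q)"
  using chains_nonneg by (rule bdd_belowI)

lemma glued_le: "pyramid_dist M T r P Q d \<Longrightarrow> glued_dist M T r P Q \<le> d"
  unfolding glued_dist_chains by (rule cInf_lower[OF chain_single chains_bdd])

lemma glued_self: "glued_dist M T r P P \<le> 0"
  unfolding glued_dist_chains by (rule cInf_lower[OF chain_refl chains_bdd])

text \<open>Any two points are joined through the apex. Nonemptiness matters because
  \<open>Inf\<close> has no useful value on the empty set.\<close>

lemma chains_nonempty:
  assumes P: "P \<in> polytope_carrier M" and Q: "Q \<in> polytope_carrier M"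
  shows "chains M T r P Q \<noteq> {}"
proof -
  have apex: "\<exists>d. pyramid_dist M T r P Apex d" if P: "P \<in> polytope_carrier M" for P
  proof -
    obtain F x t where F: "F \<in> faces T" "x \<in> tri F" "t \<in> {0..1}" "P = cone_pt (ch F x) t" by (rule carrier_cases[OF P])
    have "Apex = cone_pt (ch F x) 0" "(0::real) \<in> {0..1}" by (simp_all add: cone_pt_def)
    then have "pyramid_dist M T r P Apex (dist (emb F t x) (emb F 0 x))" unfolding pyramid_dist_iff using F by blast
    then show ?thesis by blast
  qed
  obtain d d' where "pyramid_dist M T r P Apex d" "pyramid_dist M T r Q Apex d'" using apex P Q by blast
  then have "d + d' \<in> chains M T r P Q" by (rule chain_step[OF chain_single pyramid_dist_sym])
  then show ?thesis by blast
qed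

lemma glued_triangle:
  assumes "P \<in> polytope_carrier M" "Q \<in> polytope_carrier M" "R \<in> polytope_carrier M"
  shows "glued_dist M T r P R \<le> glued_dist M T r P Q + glued_dist M T r Q R"
proof -
  have le: "glued_dist M T r P R \<le> c + c'" if "c \<in> chains M T r P Q" "c' \<in> chains M T r Q R" for c c'
    unfolding glued_dist_chains by (rule cInf_lower[OF chain_append[OF that(2,1)] chains_bdd])
  have "glued_dist M T r P R - c \<le> glued_dist M T r Q R" if c: "c \<in> chains M T r P Q" for c
    unfolding glued_dist_chains[of M T r Q R]
  proof (rule cInf_greatest)
    show "chains M T r Q R \<noteq> {}" using assms by (intro chains_nonempty)
    fix c' assume "c' \<in> chains M T r Q R"
    then show "glued_dist M T r P R - c \<le> c'" using le[OF c] by (simp add: diff_le_eq add.commute)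
  qed
  then have "glued_dist M T r P R - glued_dist M T r Q R \<le> c" if c: "c \<in> chains M T r P Q" for c
    using c by (simp add: diff_le_eq add.commute)
  then have "glued_dist M T r P R - glued_dist M T r Q R \<le> glued_dist M T r P Q"
    unfolding glued_dist_chains[of M T r P Q] using assms chains_nonempty by (intro cInf_greatest)
  then show ?thesis by simp
qed

text \<open>
  The distance from the apex in each pyramid; being 1-Lipschitz along chains, it is also the distance
  from the apex in the complex.
\<close>

definition height :: "'a polytope_point \<Rightarrow> real" where
  "height P = (case P of Apex \<Rightarrow> 0 | Pt x t \<Rightarrow> t * sqrt (f x))"

lemma height_emb:
  assumes "F \<in> faces T" "x \<in> tri F" "0 \<le> s"
  shows "height (cone_pt (ch F x) s) = dist (apex_of M r F) (emb F s x)"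
proof -
  have "apex_of M r F - emb F s x = (- s) *\<^sub>R ((x, 0) - apex_of M r F)"
    by (simp add: emb_def scaleR_left_diff_distrib scaleR_right_diff_distrib del: scaleR_Pair)
  then have "dist (apex_of M r F) (emb F s x) = s * norm ((x, 0) - apex_of M r F)"
    using assms(3) by (simp add: dist_norm del: scaleR_minus_left)
  moreover have "height (cone_pt (ch F x) s) = s * sqrt (f (ch F x))" by (simp add: height_def cone_pt_def)
  ultimately show ?thesis using f_apex[OF assms(1,2)] by simp
qed

lemma height_Lipschitz: "pyramid_dist M T r P Q d \<Longrightarrow> height Q \<le> height P + d"
proof -
  assume "pyramid_dist M T r P Q d"
  then obtain F x y s t where F: "F \<in> faces T" "x \<in> tri F" "y \<in> tri F" "s \<in> {0..1}" "t \<in> {0..1}"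
    "P = cone_pt (ch F x) s" "Q = cone_pt (ch F y) t" "d = dist (emb F s x) (emb F t y)"
    unfolding pyramid_dist_iff by blast
  show ?thesis
    using height_emb[OF F(1,2), of s] height_emb[OF F(1,3), of t] F(4-8)
      dist_triangle[of "apex_of M r F" "emb F t y" "emb F s x"] by simp
qed

lemma glued_apex: "x \<in> M \<Longrightarrow> glued_dist M T r Apex (Pt x 1) = sqrt (f x)"
proof -
  assume "x \<in> M"
  then obtain F z where F: "F \<in> faces T" "z \<in> tri F" "ch F z = x" by (rule lift_point)
  have hx: "height (Pt x 1) = sqrt (f x)" by (simp add: height_def)
  have pts: "Apex = cone_pt (ch F z) 0" "Pt x 1 = cone_pt (ch F z) 1" using F(3) by (simp_all add: cone_pt_def)
  have "pyramid_dist M T r Apex (Pt x 1) (dist (emb F 0 z) (emb F 1 z))"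
    unfolding pyramid_dist_iff pts using F(1,2) by (intro bexI[of _ F] bexI[of _ z] bexI[of _ 0] bexI[of _ 1]) auto
  moreover have "dist (emb F 0 z) (emb F 1 z) = height (Pt x 1)"
    unfolding pts(2) using height_emb[OF F(1,2), of 1] by (simp add: emb_def flip: zero_prod_def)
  ultimately have mem: "sqrt (f x) \<in> chains M T r Apex (Pt x 1)" using chain_single hx by metis
  have low: "height Q \<le> c" if "c \<in> chains M T r Apex Q" for c Q
    using that
  proof (induction rule: chain_induct)
    case refl show ?case by (simp add: height_def)
  next
    case (step Q c R d) then show ?case using height_Lipschitz[OF step.hyps(2)] by simp
  qed
  show ?thesis
    unfolding glued_dist_chains
    by (rule cInf_eq_minimum[OF mem]) (use low[of _ "Pt x 1"] hx in simp)
qed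

lemma vertex_not_between:
  assumes c: "corner F a b c" and xy: "x \<in> tri F" "y \<in> tri F"
  shows "a \<notin> open_segment x y"
proof -
  have "\<not> affine_dependent {a, b, c}"
    using corner_nc[OF c] by (auto simp: collinear_3_eq_affine_dependent)
  then have "a extreme_point_of (convex hull {a, b, c})"
    by (simp add: extreme_point_of_convex_hull_affine_independent)
  then show ?thesis using xy unfolding corner_tri[OF c] extreme_point_of_def by blast
qed

end

text \<open>
  A segment in a pyramid of \<open>(T, r)\<close> is divided into finitely many segments in pyramids of
  \<open>(T', r')\<close>: this is possible near all points of the segment \<open>xy\<close> but its end points, where
  continuity suffices.  The lengths agree since they only depend on the function \<open>f\<close> and on distances
  in \<open>M\<close>.
\<close>

lemma glued_dist_segment:
  assumes A: "pyramids M T r" and B: "pyramids M T' r'"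
    and eq: "triangulated.ext M T (triangulated.sq M r) = triangulated.ext M T' (triangulated.sq M r')"
    and pd: "pyramid_dist M T r P Q d"
  shows "glued_dist M T' r' P Q \<le> d"
proof -
  interpret A: pyramids M T r by (rule A)
  interpret B: pyramids M T' r' by (rule B)
  define D where "D = glued_dist M T' r'"
  have law: "B.law s t (B.f p) (B.f q) e = A.law s t (A.f p) (A.f q) e" for s t p q e
    using eq by (simp add: A.law_def B.law_def)
  have B_pd: "pyramid_dist M T' r' (cone_pt (B.ch G z) s) (cone_pt (B.ch G w) t)
      (A.law s t (A.f (B.ch G z)) (A.f (B.ch G w)) (dist z w))"
    if "G \<in> faces T'" "z \<in> B.tri G" "w \<in> B.tri G" "s \<in> {0..1}" "t \<in> {0..1}" for G z w s t
    unfolding B.pyramid_dist_iff B.dist_emb[OF that(1,2,3), of s t, unfolded law, symmetric]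
    using that by (intro bexI[of _ G] bexI[of _ z] bexI[of _ w] bexI[of _ s] bexI[of _ t]) auto
  obtain F x y s t where F: "F \<in> faces T" "x \<in> A.tri F" "y \<in> A.tri F" "s \<in> {0..1}" "t \<in> {0..1}"
    "P = cone_pt (A.ch F x) s" "Q = cone_pt (A.ch F y) t" "d = dist (A.emb F s x) (A.emb F t y)"
    using pd unfolding A.pyramid_dist_iff by blast
  \<comment> \<open>Two points on one ray from the apex. This covers segments with an end at the
    apex and segments over a single base point.\<close>
  have same: "glued_dist M T' r' (cone_pt p s') (cone_pt p t') \<le> A.law s' t' (A.f p) (A.f p) 0"
    if p: "p \<in> M" and st: "s' \<in> {0..1}" "t' \<in> {0..1}" for p s' t'
  proof -
    obtain G z where G: "G \<in> faces T'" "z \<in> B.tri G" "B.ch G z = p" by (rule B.lift_point[OF p])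
    show ?thesis using B.glued_le[OF B_pd[OF G(1,2,2) st]] G(3) by simp
  qed
  have chM: "A.ch F x \<in> M" "A.ch F y \<in> M" using A.ch_M F(1-3) by blast+
  have dl: "d = A.law s t (A.f (A.ch F x)) (A.f (A.ch F y)) (dist x y)" unfolding F(8) by (rule A.dist_emb[OF F(1,2,3)])
  consider "s = 0" | "t = 0" | "x = y" | "0 < s" "0 < t" "x \<noteq> y" using F(4,5) by fastforce
  then show ?thesis
  proof cases
    case 1
    then have "P = cone_pt (A.ch F y) 0" using F(6) by (simp add: cone_pt_def)
    then show ?thesis using same[OF chM(2), of 0 t] F(5,7) dl 1 by (simp add: A.law_def)
  next
    case 2
    then have "Q = cone_pt (A.ch F x) 0" using F(7) by (simp add: cone_pt_def)
    then show ?thesis using same[OF chM(1), of s 0] F(4,6) dl 2 by (simp add: A.law_def)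
  next
    case 3
    then show ?thesis using same[OF chM(1) F(4,5)] F(6,7) dl by simp
  next
    case 4
    \<comment> \<open>At time \<open>u\<close> the segment is at parameter \<open>\<tau> u\<close>
      over the base point \<open>\<xi> u\<close>; the weight \<open>w u\<close> comes from
      projecting the segment from the apex to the base.\<close>
    define \<tau> where "\<tau> u = (1 - u) * s + u * t" for u
    define w where "w u = u * t / \<tau> u" for u
    define \<xi> where "\<xi> u = (1 - w u) *\<^sub>R x + w u *\<^sub>R y" for u
    define Z where "Z u = cone_pt (A.ch F (\<xi> u)) (\<tau> u)" for u
    have \<tau>: "0 < \<tau> u" "\<tau> u \<in> {0..1}" if u: "u \<in> {0..1}" for u
    proof -
      have "0 \<le> (1 - u) * s" "0 \<le> u * t" using u 4 by simp_all
      moreover have "0 < (1 - u) * s \<or> 0 < u * t" using u 4 by (cases "u = 0") simp_all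
      ultimately show pos: "0 < \<tau> u" unfolding \<tau>_def by linarith
      have "(1 - u) * s \<le> (1 - u) * 1" "u * t \<le> u * 1" using u F(4,5) by (intro mult_left_mono; simp)+
      then show "\<tau> u \<in> {0..1}" using pos unfolding \<tau>_def by simp
    qed
    have w1: "1 - w u = (1 - u) * s / \<tau> u" if u: "u \<in> {0..1}" for u
      using \<tau>(1)[OF u] by (simp add: w_def \<tau>_def field_simps)
    have w01: "0 \<le> w u" "w u \<le> 1" if u: "u \<in> {0..1}" for u
    proof -
      show "0 \<le> w u" using \<tau>(1)[OF u] u 4 by (simp add: w_def)
      have "0 \<le> 1 - w u" unfolding w1[OF u] using \<tau>(1)[OF u] u 4 by simp
      then show "w u \<le> 1" by simp
    qed
    have \<xi>t: "\<xi> u \<in> A.tri F" if u: "u \<in> {0..1}" for u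
    proof -
      have "\<xi> u \<in> closed_segment x y" using w01[OF u] by (auto simp: \<xi>_def in_segment)
      then show ?thesis using closed_segment_subset[OF F(2,3) A.tri_convex[OF F(1)]] by blast
    qed
    have emb: "A.emb F (\<tau> u) (\<xi> u) = (1 - u) *\<^sub>R A.emb F s x + u *\<^sub>R A.emb F t y" if u: "u \<in> {0..1}" for u
    proof -
      have "\<tau> u * (1 - w u) = (1 - u) * s" "\<tau> u * w u = u * t"
        using \<tau>(1)[OF u] by (simp add: w1[OF u], simp add: w_def)
      then have tx: "\<tau> u *\<^sub>R \<xi> u = ((1 - u) * s) *\<^sub>R x + (u * t) *\<^sub>R y"
        by (simp add: \<xi>_def scaleR_add_right)
      have "\<tau> u *\<^sub>R (\<xi> u, 0::real) = ((1 - u) * s) *\<^sub>R (x, 0) + (u * t) *\<^sub>R (y, 0)"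
        by (simp add: tx)
      moreover have "1 - \<tau> u = (1 - u) * (1 - s) + u * (1 - t)" by (simp add: \<tau>_def algebra_simps)
      ultimately show ?thesis
        unfolding A.emb_def by (simp add: scaleR_add_right scaleR_add_left del: scaleR_Pair)
    qed
    have dist_emb: "A.law (\<tau> u) (\<tau> v) (A.f (A.ch F (\<xi> u))) (A.f (A.ch F (\<xi> v))) (dist (\<xi> u) (\<xi> v)) = \<bar>u - v\<bar> * d"
      if uv: "u \<in> {0..1}" "v \<in> {0..1}" for u v
    proof -
      have "A.emb F (\<tau> u) (\<xi> u) - A.emb F (\<tau> v) (\<xi> v) = (v - u) *\<^sub>R (A.emb F s x - A.emb F t y)"
        unfolding emb[OF uv(1)] emb[OF uv(2)] by (simp add: algebra_simps)
      then have "dist (A.emb F (\<tau> u) (\<xi> u)) (A.emb F (\<tau> v) (\<xi> v)) = \<bar>v - u\<bar> * d"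
        by (simp add: dist_norm F(8))
      then show ?thesis using A.dist_emb[OF F(1) \<xi>t[OF uv(1)] \<xi>t[OF uv(2)]] by (simp add: abs_minus_commute)
    qed
    have d0: "0 \<le> d" by (simp add: F(8))
    have ZC: "Z u \<in> polytope_carrier M" if "u \<in> {0..1}" for u
      unfolding Z_def using A.ch_M[OF F(1) \<xi>t[OF that]] \<tau>(2)[OF that] by (rule A.cone_pt_carrier)
    have cont: "continuous_on {0..1} \<xi>"
    proof -
      have "\<tau> u \<noteq> 0" if "u \<in> {0..1}" for u using \<tau>(1)[OF that] by simp
      then show ?thesis unfolding \<xi>_def w_def \<tau>_def by (intro continuous_intros) auto
    qed
    have ends: "\<xi> 0 = x" "\<xi> 1 = y" "\<tau> 0 = s" "\<tau> 1 = t"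
      using 4 by (simp_all add: \<xi>_def w_def \<tau>_def)
    have PQ: "P = Z 0" "Q = Z 1" by (simp_all add: Z_def ends F(6,7))
    \<comment> \<open>Near an inner point the chart of \<open>F\<close> is isometric and, by
      \<open>star\<close>, nearby points share a face of \<open>T'\<close> with it at the same
      distance. So a short piece of the segment is a single link in \<open>T'\<close> as
      well.\<close>
    have local: "\<exists>e>0. \<forall>v\<in>{0..1}. \<bar>u - v\<bar> < e \<longrightarrow> D (Z u) (Z v) \<le> \<bar>u - v\<bar> * d \<and> D (Z v) (Z u) \<le> \<bar>u - v\<bar> * d"
      if u: "0 < u" "u < 1" for u
    proof -
      have u01: "u \<in> {0..1}" using u by simp
      have wu: "0 < w u" "w u < 1"
      proof -
        show "0 < w u" using \<tau>(1)[OF u01] u 4 by (simp add: w_def)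
        have "0 < 1 - w u" unfolding w1[OF u01] using \<tau>(1)[OF u01] u 4 by simp
        then show "w u < 1" by simp
      qed
      \<comment> \<open>An inner point of a segment in a triangle is not a corner, hence does not
        map to a singular point.\<close>
      have os: "\<xi> u \<in> open_segment x y" using wu 4(3) by (auto simp: \<xi>_def in_segment)
      have nS: "A.ch F (\<xi> u) \<notin> Sing M"
        using F(1) \<xi>t[OF u01]
      proof (cases rule: A.tri_point_cases)
        case face then show ?thesis using A.face_sing[OF F(1)] by blast
      next
        case (edge a b c)
        then have "A.ch F (\<xi> u) \<in> A.ch F ` open_segment a b" by blast
        then show ?thesis using A.edge_sing[OF A.corner_props(1)[OF edge(1)]] by blast
      next
        case (vertex a b c) then show ?thesis using A.vertex_not_between[OF vertex(1) F(2,3)] os by simp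
      qed
      obtain e1 where e1: "e1 > 0" "\<And>y w. y \<in> A.tri F \<Longrightarrow> w \<in> A.tri F \<Longrightarrow> dist (\<xi> u) y < e1 \<Longrightarrow> dist (\<xi> u) w < e1 \<Longrightarrow>
          dist (A.ch F y) (A.ch F w) = dist y w"
        by (rule A.local_isometry[OF F(1) \<xi>t[OF u01] nS]) blast
      obtain e2 where e2: "e2 > 0" "\<And>y. y \<in> M \<Longrightarrow> dist (A.ch F (\<xi> u)) y < e2 \<Longrightarrow>
          \<exists>G z w. G \<in> faces T' \<and> z \<in> B.tri G \<and> w \<in> B.tri G \<and> B.ch G z = A.ch F (\<xi> u) \<and> B.ch G w = y \<and>
            dist z w = dist (A.ch F (\<xi> u)) y"
        by (rule B.star[OF A.ch_M[OF F(1) \<xi>t[OF u01]] nS]) blast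
      obtain e where e: "e > 0" "\<forall>v\<in>{0..1}. dist v u < e \<longrightarrow> dist (\<xi> v) (\<xi> u) < min e1 e2"
        using cont u01 e1(1) e2(1) unfolding continuous_on_iff by (metis min_less_iff_conj)
      have "D (Z u) (Z v) \<le> \<bar>u - v\<bar> * d \<and> D (Z v) (Z u) \<le> \<bar>u - v\<bar> * d"
        if v: "v \<in> {0..1}" "\<bar>u - v\<bar> < e" for v
      proof -
        have "dist v u < e" using v(2) by (simp add: dist_real_def abs_minus_commute)
        then have dv: "dist (\<xi> u) (\<xi> v) < e1" "dist (\<xi> u) (\<xi> v) < e2" using e(2) v(1) by (auto simp: dist_commute)
        have dd: "dist (A.ch F (\<xi> u)) (A.ch F (\<xi> v)) = dist (\<xi> u) (\<xi> v)"
          using e1(2)[OF \<xi>t[OF u01] \<xi>t[OF v(1)]] dv(1) e1(1) by simp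
        obtain G z z' where G: "G \<in> faces T'" "z \<in> B.tri G" "z' \<in> B.tri G" "B.ch G z = A.ch F (\<xi> u)"
          "B.ch G z' = A.ch F (\<xi> v)" "dist z z' = dist (A.ch F (\<xi> u)) (A.ch F (\<xi> v))"
          using e2(2)[OF A.ch_M[OF F(1) \<xi>t[OF v(1)]]] dd dv(2) by auto
        have "pyramid_dist M T' r' (Z u) (Z v) (\<bar>u - v\<bar> * d)"
          using B_pd[OF G(1,2,3) \<tau>(2)[OF u01] \<tau>(2)[OF v(1)]] dist_emb[OF u01 v(1)] G(4,5,6) dd
          by (simp add: Z_def)
        then show ?thesis unfolding D_def using B.glued_le B.pyramid_dist_sym by blast
      qed
      then show ?thesis using e(1) by blast
    qed
    have tri: "D (Z a) (Z c) \<le> D (Z a) (Z b) + D (Z b) (Z c)" if "a \<in> {0..1}" "b \<in> {0..1}" "c \<in> {0..1}" for a b c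
      unfolding D_def using that by (intro B.glued_triangle ZC)
    \<comment> \<open>The bound is additive over adjacent intervals and holds on short ones, which
      is what \<open>Bolzano\<close> asks for.\<close>
    have inner: "D (Z a) (Z b) \<le> (b - a) * d" if ab: "a \<le> b" "0 < a" "b < 1" for a b
    proof -
      define X where "X p q \<longleftrightarrow> (a \<le> p \<longrightarrow> p \<le> q \<longrightarrow> q \<le> b \<longrightarrow> D (Z p) (Z q) \<le> (q - p) * d)" for p q
      have "X a b"
      proof (rule Bolzano[OF ab(1)])
        fix p u q assume X: "X p u" "X u q" and le: "p \<le> u" "u \<le> q"
        show "X p q"
          unfolding X_def
        proof (intro impI)
          assume pq: "a \<le> p" "p \<le> q" "q \<le> b"
          have "D (Z p) (Z u) \<le> (u - p) * d" "D (Z u) (Z q) \<le> (q - u) * d"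
            using X le pq unfolding X_def by auto
          moreover have "D (Z p) (Z q) \<le> D (Z p) (Z u) + D (Z u) (Z q)" using le pq ab by (intro tri) auto
          moreover have "(u - p) * d + (q - u) * d = (q - p) * d" by (simp add: algebra_simps)
          ultimately show "D (Z p) (Z q) \<le> (q - p) * d" by linarith
        qed
      next
        fix u assume u: "a \<le> u" "u \<le> b"
        have u1: "0 < u" "u < 1" using u ab by auto
        obtain e where e: "e > 0" "\<forall>v\<in>{0..1}. \<bar>u - v\<bar> < e \<longrightarrow> D (Z u) (Z v) \<le> \<bar>u - v\<bar> * d \<and> D (Z v) (Z u) \<le> \<bar>u - v\<bar> * d"
          using local[OF u1] by blast
        have "X p q" if pq: "p \<le> u" "u \<le> q" "q - p < e" for p q
          unfolding X_def
        proof (intro impI)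
          assume pq': "a \<le> p" "p \<le> q" "q \<le> b"
          have m: "p \<in> {0..1}" "q \<in> {0..1}" "u \<in> {0..1}" using pq' ab u by auto
          have "\<bar>u - p\<bar> = u - p" "\<bar>u - q\<bar> = q - u" "u - p < e" "q - u < e" using pq by auto
          then have "D (Z p) (Z u) \<le> (u - p) * d" "D (Z u) (Z q) \<le> (q - u) * d"
            using e(2)[rule_format, OF m(1)] e(2)[rule_format, OF m(2)] by simp_all
          moreover have "D (Z p) (Z q) \<le> D (Z p) (Z u) + D (Z u) (Z q)" by (rule tri[OF m(1,3,2)])
          moreover have "(u - p) * d + (q - u) * d = (q - p) * d" by (simp add: algebra_simps)
          ultimately show "D (Z p) (Z q) \<le> (q - p) * d" by linarith
        qed
        then show "\<exists>e>0. \<forall>p q. p \<le> u \<and> u \<le> q \<and> q - p < e \<longrightarrow> X p q" using e(1) by blast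
      qed
      then show ?thesis using ab(1) by (simp add: X_def)
    qed
    \<comment> \<open>At an end the base point may be a vertex, where charts are merely continuous.
      A sequence of inner points tending to the end still lifts to one triangle of
      \<open>T'\<close>, and there the distances tend to 0.\<close>
    have approach: "\<exists>u. 0 < u \<and> u < 1 \<and> \<bar>u - v\<bar> < \<eta> \<and> D (Z v) (Z u) < \<epsilon> \<and> D (Z u) (Z v) < \<epsilon>"
      if v: "v = 0 \<or> v = 1" and \<eta>: "0 < \<eta>" and \<epsilon>: "0 < \<epsilon>" for v \<eta> \<epsilon> :: real
    proof -
      have v01: "v \<in> {0..1}" using v by auto
      \<comment> \<open>The double \<open>Suc\<close> keeps the points strictly between 0 and 1 from
        the start.\<close>
      define un where "un n = (if v = 0 then inverse (real (Suc (Suc n))) else 1 - inverse (real (Suc (Suc n))))" for n :: nat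
      have inv: "0 < inverse (real (Suc (Suc n)))" "inverse (real (Suc (Suc n))) < 1" for n
        by (simp_all add: inverse_less_1_iff)
      have un: "0 < un n" "un n < 1" "un n \<in> {0..1}" for n
        using inv[of n] by (auto simp: un_def)
      have "(\<lambda>n. inverse (real (Suc (Suc n)))) \<longlonglongrightarrow> 0"
        using LIMSEQ_Suc[OF LIMSEQ_inverse_real_of_nat] .
      then have ul: "un \<longlonglongrightarrow> v"
        using v tendsto_diff[OF tendsto_const[of 1], of "\<lambda>n. inverse (real (Suc (Suc n)))" 0]
        unfolding un_def[abs_def] by (elim disjE) simp_all
      have \<xi>l: "(\<lambda>n. \<xi> (un n)) \<longlonglongrightarrow> \<xi> v"
        by (rule continuous_on_tendsto_compose[OF cont ul v01]) (use un in simp)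
      have xl: "(\<lambda>n. A.ch F (\<xi> (un n))) \<longlonglongrightarrow> A.ch F (\<xi> v)"
        by (rule continuous_on_tendsto_compose[OF A.ch_cont[OF F(1)] \<xi>l \<xi>t[OF v01]]) (use \<xi>t un in simp)
      have xM: "A.ch F (\<xi> (un n)) \<in> M" for n by (rule A.ch_M[OF F(1) \<xi>t[OF un(3)]])
      obtain G k z z0 where G: "G \<in> faces T'" "strict_mono (k :: nat \<Rightarrow> nat)" "\<And>n. z n \<in> B.tri G"
        "\<And>n. B.ch G (z n) = A.ch F (\<xi> (un (k n)))" "z \<longlonglongrightarrow> z0" "z0 \<in> B.tri G" "B.ch G z0 = A.ch F (\<xi> v)"
        by (rule B.lift_sequence[of "\<lambda>n. A.ch F (\<xi> (un n))", OF xM xl]) blast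
      have uk: "(\<lambda>n. un (k n)) \<longlonglongrightarrow> v" using LIMSEQ_subseq_LIMSEQ[OF ul G(2)] by (simp add: o_def)
      have "(\<lambda>n. dist (B.emb G (\<tau> v) z0) (B.emb G (\<tau> (un (k n))) (z n))) \<longlonglongrightarrow>
          dist (B.emb G (\<tau> v) z0) (B.emb G (\<tau> v) z0)"
        unfolding B.emb_def \<tau>_def by (intro tendsto_intros uk G(5))
      then have "(\<lambda>n. dist (B.emb G (\<tau> v) z0) (B.emb G (\<tau> (un (k n))) (z n))) \<longlonglongrightarrow> 0" by simp
      then have "\<forall>\<^sub>F n in sequentially. dist (B.emb G (\<tau> v) z0) (B.emb G (\<tau> (un (k n))) (z n)) < \<epsilon>"
        using \<epsilon> by (rule order_tendstoD(2))
      moreover have "\<forall>\<^sub>F n in sequentially. dist (un (k n)) v < \<eta>" using tendstoD[OF uk \<eta>] .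
      ultimately have "\<forall>\<^sub>F n in sequentially. dist (B.emb G (\<tau> v) z0) (B.emb G (\<tau> (un (k n))) (z n)) < \<epsilon> \<and>
          dist (un (k n)) v < \<eta>" by (rule eventually_conj)
      then obtain n where n: "dist (B.emb G (\<tau> v) z0) (B.emb G (\<tau> (un (k n))) (z n)) < \<epsilon>" "dist (un (k n)) v < \<eta>"
        using eventually_happens'[OF sequentially_bot] by blast
      have "pyramid_dist M T' r' (Z v) (Z (un (k n))) (dist (B.emb G (\<tau> v) z0) (B.emb G (\<tau> (un (k n))) (z n)))"
        unfolding B.pyramid_dist_iff Z_def
        using G(1,3,4,6,7) \<tau>(2)[OF v01] \<tau>(2)[OF un(3)] by metis
      then have "D (Z v) (Z (un (k n))) < \<epsilon>" "D (Z (un (k n))) (Z v) < \<epsilon>"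
        unfolding D_def using B.glued_le B.pyramid_dist_sym n(1) by (meson le_less_trans)+
      then show ?thesis using un[of "k n"] n(2) by (intro exI[of _ "un (k n)"]) (simp add: dist_real_def)
    qed
    have "D P Q \<le> d"
    proof (rule field_le_epsilon)
      fix \<epsilon> :: real assume \<epsilon>: "0 < \<epsilon>"
      obtain a where a: "0 < a" "a < 1" "\<bar>a - 0\<bar> < 1/2" "D (Z 0) (Z a) < \<epsilon> / 2"
        using approach[of 0 "1/2" "\<epsilon> / 2"] \<epsilon> by auto
      obtain b where b: "0 < b" "b < 1" "\<bar>b - 1\<bar> < 1/2" "D (Z b) (Z 1) < \<epsilon> / 2"
        using approach[of 1 "1/2" "\<epsilon> / 2"] \<epsilon> by auto
      have ab: "a \<le> b" using a b by linarith
      have "(b - a) * d \<le> 1 * d" using a b d0 by (intro mult_right_mono) auto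
      moreover have "D (Z 0) (Z 1) \<le> D (Z 0) (Z a) + D (Z a) (Z 1)" using a by (intro tri) auto
      moreover have "D (Z a) (Z 1) \<le> D (Z a) (Z b) + D (Z b) (Z 1)" using a b by (intro tri) auto
      ultimately show "D P Q \<le> d + \<epsilon>" using inner[OF ab a(1) b(2)] a(4) b(4) unfolding PQ by linarith
    qed
    then show ?thesis by (simp add: D_def)
  qed
qed

lemma glued_dist_le:
  assumes A: "pyramids M T r" and B: "pyramids M T' r'"
    and eq: "triangulated.ext M T (triangulated.sq M r) = triangulated.ext M T' (triangulated.sq M r')"
    and PQ: "P \<in> polytope_carrier M" "Q \<in> polytope_carrier M"
  shows "glued_dist M T' r' P Q \<le> glued_dist M T r P Q"
proof -
  interpret A: pyramids M T r by (rule A)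
  interpret B: pyramids M T' r' by (rule B)
  have "Q \<in> polytope_carrier M \<and> glued_dist M T' r' P Q \<le> c" if "c \<in> chains M T r P Q" for c Q
    using that
  proof (induction rule: chain_induct)
    case refl then show ?case using PQ(1) B.glued_self by simp
  next
    case (step Q c R d)
    have R: "R \<in> polytope_carrier M" using A.pyramid_dist_carrier[OF step.hyps(2)] by blast
    then show ?case
      using B.glued_triangle[OF PQ(1) _ R, of Q] step.IH glued_dist_segment[OF A B eq step.hyps(2)] by simp
  qed
  then show ?thesis
    unfolding glued_dist_chains[of M T r P Q] by (intro cInf_greatest A.chains_nonempty PQ) blast
qed

lemma same_polytope_iff:
  assumes A: "pyramids M T r" and B: "pyramids M T' r'"
  shows "((T, r), (T', r')) \<in> same_polytope M \<longleftrightarrow>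
    triangulated.ext M T (triangulated.sq M r) = triangulated.ext M T' (triangulated.sq M r')"
proof -
  interpret A: pyramids M T r by (rule A)
  interpret B: pyramids M T' r' by (rule B)
  show ?thesis
  proof
    assume "((T, r), (T', r')) \<in> same_polytope M"
    then obtain g where g: "polytope_isometry M (T, r) (T', r') g" by (auto simp: same_polytope_def)
    show "A.f = B.f"
    proof
      fix x
      show "A.f x = B.f x"
      proof (cases "x \<in> M")
        case True
        have "cone_pt x 0 \<in> polytope_carrier M" "cone_pt x 1 \<in> polytope_carrier M"
          using True by (auto intro!: A.cone_pt_carrier)
        then have c: "Apex \<in> polytope_carrier M" "Pt x 1 \<in> polytope_carrier M" by (simp_all add: cone_pt_def)
        have "glued_dist M T' r' (g Apex) (g (Pt x 1)) = glued_dist M T r Apex (Pt x 1)"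
          "g Apex = Apex" "g (Pt x 1) = Pt x 1"
          using g c True unfolding polytope_isometry_def prod.case by blast+
        then have "sqrt (B.f x) = sqrt (A.f x)" using A.glued_apex[OF True] B.glued_apex[OF True] by simp
        then show ?thesis by simp
      next
        case False then show ?thesis by (simp add: A.ext_def B.ext_def)
      qed
    qed
  next
    assume eq: "A.f = B.f"
    \<comment> \<open>The carrier is built from points of \<open>M\<close> and parameters, so it is
      the same set for both couples and the identity is the isometry.\<close>
    have "polytope_isometry M (T, r) (T', r') id"
      unfolding polytope_isometry_def prod.case
      using glued_dist_le[OF A B eq] glued_dist_le[OF B A eq[symmetric]] by (simp add: order_antisym)
    then show "((T, r), (T', r')) \<in> same_polytope M"
      using A.couple B.couple by (auto simp: same_polytope_def)
  qed
qed

section \<open>The one-to-one correspondence\<close>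

theorem theorem2:
  fixes M :: "'a::metric_space set"
  assumes "M homeomorphic sphere (0::real^3) 1"
    and "polyhedral_metric M"
  shows "\<exists>\<Phi>. bij_betw \<Phi> (generalized_convex_polytopes M) (positive_Delaunay_tesselations M) \<and>
           (\<forall>(T, r)\<in>convex_couples M.
              \<Phi> (same_polytope M `` {(T, r)}) =
                Delaunay_tesselation M T (\<lambda>i\<in>Sing M. (r i)\<^sup>2))"
proof -
  have cM: "compact M" using homeomorphic_compactness[OF assms(1)] by simp
  have conn: "connected M" 
using homeomorphic_connectedness[OF assms(1)] connected_sphere[of "0::real^3" 1] by simp
  have tr: "triangulated M T" if "geodesic_triangulation M T" for T
    using cM assms(2) that by (intro triangulated.intro)
  have pyr: "pyramids M T r" if "(T, r) \<in> polytope_couples M" for T r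
    using that tr[of T] by (intro pyramids.intro pyramids_axioms.intro) (auto simp: polytope_couples_def)
  have conv: "(T, r) \<in> polytope_couples M" if "(T, r) \<in> convex_couples M" for T r
    using that by (auto simp: convex_couples_def)
  define S where "S r = (\<lambda>i\<in>Sing M. (r i)\<^sup>2)" for r :: "'a \<Rightarrow> real"
  define Del where "Del = (\<lambda>(T, r). Delaunay_tesselation M T (S r))"
  have eqv: "equiv (polytope_couples M) (same_polytope M)" by (rule equiv_same_polytope)
  \<comment> \<open>Both relations amount to equality of the PQ-extensions of the squared
    radii.\<close>
  have same: "(c, c') \<in> same_polytope M \<longleftrightarrow> Del c = Del c'"
    if "c \<in> polytope_couples M" "c' \<in> polytope_couples M" for c c'
  proof -
    obtain T r T' r' where c: "c = (T, r)" "c' = (T', r')" by (metis prod.exhaust)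
    interpret A: pyramids M T r using that(1) pyr by (simp add: c)
    interpret B: pyramids M T' r' using that(2) pyr by (simp add: c)
    have sq: "A.sq = S" "B.sq = S" by (simp_all add: A.sq_def B.sq_def S_def fun_eq_iff)
    have "Del c = Del c' \<longleftrightarrow> PQ_extension M T (S r) = PQ_extension M T' (S r')"
      unfolding c Del_def prod.case
      by (rule Delaunay_eq_iff[OF A.triangulated_axioms B.triangulated_axioms conn]) (simp_all add: S_def)
    also have "\<dots> \<longleftrightarrow> A.f = B.f" by (simp only: A.PQ_extension_eq B.PQ_extension_eq sq)
    finally show ?thesis using same_polytope_iff[OF A.pyramids_axioms B.pyramids_axioms] by (simp add: c)
  qed
  have into: "Del c \<in> positive_Delaunay_tesselations M" if "c \<in> convex_couples M" for c
  proof -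
    obtain T r where c: "c = (T, r)" by (meson surj_pair)
    interpret A: pyramids M T r using that conv pyr by (simp add: c)
    have sq: "A.sq = S" by (simp add: A.sq_def S_def fun_eq_iff)
    have "weighted_Delaunay_triangulation M T (S r)"
      using A.convex_couple_iff[of r] that A.geod
      by (simp add: weighted_Delaunay_triangulation_def c A.PQ_extension_eq sq) (simp add: S_def)
    moreover have "\<forall>x\<in>M. 0 < PQ_extension M T (S r) x" using A.f_pos by (simp add: A.PQ_extension_eq sq)
    ultimately show ?thesis unfolding positive_Delaunay_tesselations_def Del_def c prod.case by blast
  qed
  have onto: "\<exists>c\<in>convex_couples M. Del c = X" if X: "X \<in> positive_Delaunay_tesselations M" for X
  proof -
    obtain T q where q: "X = Delaunay_tesselation M T q" "weighted_Delaunay_triangulation M T q"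
      "\<forall>x\<in>M. 0 < PQ_extension M T q x" using X unfolding positive_Delaunay_tesselations_def by blast
    interpret A: triangulated M T using q(2) tr by (simp add: weighted_Delaunay_triangulation_def)
    have conc: "Q_concave M (A.ext q)" and ex: "q \<in> extensional (Sing M)"
      using q(2) by (simp_all add: weighted_Delaunay_triangulation_def A.PQ_extension_eq)
    have pos: "0 < A.ext q x" if "x \<in> M" for x using q(3) that by (simp add: A.PQ_extension_eq)
    \<comment> \<open>Weights are squared radii; the extension takes the value \<open>q i\<close> at
      a vertex, so its positivity justifies the root.\<close>
    define r where "r = (\<lambda>i\<in>Sing M. sqrt (q i))"
    have qpos: "0 < q i" if "i \<in> Sing M" for i
      using pos[of i] A.ext_sing[OF that, of q] that by (simp add: Sing_def)
    have sqr: "A.sq r = q"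
    proof
      fix i show "A.sq r i = q i"
        using qpos[of i] ex by (auto simp: A.sq_def r_def extensional_def)
    qed
    have "(T, r) \<in> polytope_couples M"
      unfolding A.couple_iff sqr
      using qpos A.positive_imp_cb_pos[OF conc pos] by (simp add: r_def)
    then have "(T, r) \<in> convex_couples M" using A.convex_couple_iff[of r] conc sqr by simp
    moreover have "Del (T, r) = X" using sqr by (simp add: Del_def q(1) S_def A.sq_def)
    ultimately show ?thesis by blast
  qed
  \<comment> \<open>Some convex representative of the class is taken; by \<open>same\<close> the
    resulting tesselation does not depend on it.\<close>
  define \<Phi> where "\<Phi> C = Del (SOME c. c \<in> convex_couples M \<and> C = same_polytope M `` {c})" for C
  have cc: "c \<in> polytope_couples M" if "c \<in> convex_couples M" for c using that conv by (cases c) auto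
  have \<Phi>: "\<Phi> (same_polytope M `` {c}) = Del c" if c: "c \<in> convex_couples M" for c
  proof -
    define c' where "c' = (SOME c'. c' \<in> convex_couples M \<and> same_polytope M `` {c} = same_polytope M `` {c'})"
    have c': "c' \<in> convex_couples M \<and> same_polytope M `` {c} = same_polytope M `` {c'}"
      unfolding c'_def by (rule someI[of _ c]) (use c in simp)
    then have "(c, c') \<in> same_polytope M"
      using eq_equiv_class_iff[OF eqv cc[OF c], of c'] cc[of c'] by simp
    then have "Del c = Del c'" using same cc c c' by blast
    then show ?thesis by (simp add: \<Phi>_def c'_def)
  qed
  have "bij_betw \<Phi> (generalized_convex_polytopes M) (positive_Delaunay_tesselations M)"
    unfolding bij_betw_def
  proof
    show "inj_on \<Phi> (generalized_convex_polytopes M)"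
    proof (rule inj_onI)
      fix C C' assume C: "C \<in> generalized_convex_polytopes M" "C' \<in> generalized_convex_polytopes M" "\<Phi> C = \<Phi> C'"
      obtain c c' where c: "c \<in> convex_couples M" "C = same_polytope M `` {c}"
        "c' \<in> convex_couples M" "C' = same_polytope M `` {c'}"
        using C unfolding generalized_convex_polytopes_def quotient_def by blast
      then have "Del c = Del c'" using C(3) \<Phi> by simp
      then have "(c, c') \<in> same_polytope M" using same cc c by blast
      then show "C = C'" using equiv_class_eq[OF eqv] c by simp
    qed
    show "\<Phi> ` generalized_convex_polytopes M = positive_Delaunay_tesselations M"
    proof (intro equalityI subsetI)
      fix X assume "X \<in> \<Phi> ` generalized_convex_polytopes M"
      then obtain c where "c \<in> convex_couples M" "X = \<Phi> (same_polytope M `` {c})"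
        unfolding generalized_convex_polytopes_def quotient_def by blast
      then show "X \<in> positive_Delaunay_tesselations M" using \<Phi> into by simp
    next
      fix X assume "X \<in> positive_Delaunay_tesselations M"
      then obtain c where c: "c \<in> convex_couples M" "Del c = X" using onto by blast
      have "same_polytope M `` {c} \<in> generalized_convex_polytopes M"
        unfolding generalized_convex_polytopes_def by (rule quotientI[OF c(1)])
      then show "X \<in> \<Phi> ` generalized_convex_polytopes M" using \<Phi>[OF c(1)] c(2) by (metis imageI)
    qed
  qed
  moreover have "\<forall>(T, r)\<in>convex_couples M.
      \<Phi> (same_polytope M `` {(T, r)}) = Delaunay_tesselation M T (\<lambda>i\<in>Sing M. (r i)\<^sup>2)"
    using \<Phi> by (auto simp: Del_def S_def)
  ultimately show ?thesis by blast
qed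

end
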